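(* Let $X_1,\dots,X_r$ be uniformly noncreasy Banach spaces and let $\|\cdot\|_\psi$ be an absolute normalized norm on $\mathbb{R}^r$ which is strictly monotone. Then the direct sum $(X_1\oplus\dots\oplus X_r)_\psi$ has the super fixed point property for asymptotically nonexpansive mappings in the intermediate sense.
   Context: A Banach space $X$ is uniformly noncreasy if for every $\varepsilon>0$ there is $\delta>0$ such that whenever $f,g\in S_{X^*}$ with $\|f-g\|\ge\varepsilon$, the set $\{x\in B_X: f(x)\ge1-\delta,\ g(x)\ge1-\delta\}$ has diameter at most $\varepsilon$. A norm on $\mathbb{R}^r$ is absolute if $\|(x_1,\dots,x_r)\|=\|(|x_1|,\dots,|x_r|)\|$, normalized if standard unit vectors have norm 1, strictly monotone if $\|(x_i)\|<\|(y_i)\|$ whenever $|x_i|\le|y_i|$ for all $i$ with strict inequality for some $i$. $(X_1\oplus\dots\oplus X_r)_\psi$ is $X_1\times\dots\times X_r$ with norm $\|(x_1,\dots,x_r)\|_\psi=\|(\|x_1\|,\dots,\|x_r\|)\|_\psi$. A mapping $T:C\to C$ is asymptotically nonexpansive in the intermediate sense if $T$ is continuous and $\limsup_{n\to\infty}\sup_{x,y\in C}(\|T^nx-T^ny\|-\|x-y\|)\le0$. $X$ has the super fixed point property for such mappings if every Banach space finitely representable in $X$ has the property that every such $T:C\to C$ on a nonempty bounded closed convex subset $C$ has a fixed point. *)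

theory Defs
  imports "HOL-Analysis.Analysis" "HOL-Library.Liminf_Limsup"
begin

text \<open>A Banach space X is modelled as a closed linear subspace S of a Banach type 'a
  (with the induced norm). A continuous linear functional on S is represented by a
  function f :: 'a => real that is linear and bounded on S (values off S are irrelevant).\<close>

definition lin_on :: "'a::real_vector set \<Rightarrow> ('a \<Rightarrow> real) \<Rightarrow> bool" where
  "lin_on S f \<longleftrightarrow> (\<forall>x\<in>S. \<forall>y\<in>S. f (x + y) = f x + f y) \<and> (\<forall>c. \<forall>x\<in>S. f (c *\<^sub>R x) = c * f x)"

definition dual_norm :: "'a::real_normed_vector set \<Rightarrow> ('a \<Rightarrow> real) \<Rightarrow> real" where
  "dual_norm S f = (SUP x\<in>{x\<in>S. norm x \<le> 1}. \<bar>f x\<bar>)"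

definition dual_sphere :: "'a::real_normed_vector set \<Rightarrow> ('a \<Rightarrow> real) set" where
  "dual_sphere S = {f. lin_on S f \<and> (\<exists>K. \<forall>x\<in>S. \<bar>f x\<bar> \<le> K * norm x) \<and> dual_norm S f = 1}"

definition unif_noncreasy :: "'a::real_normed_vector set \<Rightarrow> bool" where
  "unif_noncreasy S \<longleftrightarrow>
     (\<forall>\<epsilon>>0. \<exists>\<delta>>0. \<forall>f\<in>dual_sphere S. \<forall>g\<in>dual_sphere S.
        dual_norm S (\<lambda>x. f x - g x) \<ge> \<epsilon> \<longrightarrow>
        diameter {x\<in>S. norm x \<le> 1 \<and> f x \<ge> 1 - \<delta> \<and> g x \<ge> 1 - \<delta>} \<le> \<epsilon>)"

definition is_norm_fn :: "(real^'r \<Rightarrow> real) \<Rightarrow> bool" where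
  "is_norm_fn \<psi> \<longleftrightarrow> (\<forall>x. \<psi> x = 0 \<longleftrightarrow> x = 0) \<and> (\<forall>c x. \<psi> (c *\<^sub>R x) = \<bar>c\<bar> * \<psi> x)
      \<and> (\<forall>x y. \<psi> (x + y) \<le> \<psi> x + \<psi> y)"

definition absolute_norm :: "(real^'r \<Rightarrow> real) \<Rightarrow> bool" where
  "absolute_norm \<psi> \<longleftrightarrow> (\<forall>x. \<psi> x = \<psi> (\<chi> i. \<bar>x $ i\<bar>))"

definition normalized_norm :: "(real^'r \<Rightarrow> real) \<Rightarrow> bool" where
  "normalized_norm \<psi> \<longleftrightarrow> (\<forall>i. \<psi> (axis i 1) = 1)"

definition strictly_monotone_norm :: "(real^'r \<Rightarrow> real) \<Rightarrow> bool" where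
  "strictly_monotone_norm \<psi> \<longleftrightarrow>
     (\<forall>x y. (\<forall>i. \<bar>x $ i\<bar> \<le> \<bar>y $ i\<bar>) \<and> (\<exists>i. \<bar>x $ i\<bar> < \<bar>y $ i\<bar>) \<longrightarrow> \<psi> x < \<psi> y)"

definition psi_sum :: "('r \<Rightarrow> 'a::real_normed_vector set) \<Rightarrow> ('a^'r) set" where
  "psi_sum S = {x. \<forall>i. x $ i \<in> S i}"

definition psi_norm :: "(real^'r \<Rightarrow> real) \<Rightarrow> 'a::real_normed_vector^'r \<Rightarrow> real" where
  "psi_norm \<psi> x = \<psi> (\<chi> i. norm (x $ i))"

definition fin_rep :: "'y::real_normed_vector itself \<Rightarrow> 'v::real_vector set \<Rightarrow> ('v \<Rightarrow> real) \<Rightarrow> bool" where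
  "fin_rep _ V N \<longleftrightarrow>
     (\<forall>B::'y set. finite B \<longrightarrow> (\<forall>\<epsilon>>0. \<exists>T::'y \<Rightarrow> 'v.
        (\<forall>x\<in>span B. T x \<in> V) \<and>
        (\<forall>x\<in>span B. \<forall>y\<in>span B. T (x + y) = T x + T y) \<and>
        (\<forall>c. \<forall>x\<in>span B. T (c *\<^sub>R x) = c *\<^sub>R T x) \<and>
        (\<forall>x\<in>span B. norm x \<le> N (T x) \<and> N (T x) \<le> (1 + \<epsilon>) * norm x)))"

definition asympt_nonexp_intermediate :: "'y::real_normed_vector set \<Rightarrow> ('y \<Rightarrow> 'y) \<Rightarrow> bool" where
  "asympt_nonexp_intermediate C T \<longleftrightarrow> continuous_on C T \<and>
     limsup (\<lambda>n. SUP x\<in>C. SUP y\<in>C. ereal (dist ((T ^^ n) x) ((T ^^ n) y) - dist x y)) \<le> 0"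

definition fpp_ani :: "'y::banach itself \<Rightarrow> bool" where
  "fpp_ani _ \<longleftrightarrow> (\<forall>C::'y set. C \<noteq> {} \<and> bounded C \<and> closed C \<and> convex C \<longrightarrow>
     (\<forall>T. T ` C \<subseteq> C \<and> asympt_nonexp_intermediate C T \<longrightarrow> (\<exists>x\<in>C. T x = x)))"

end

theory Submission
  imports Defs
begin

text \<open>
  Let \<open>T\<close> be asymptotically nonexpansive in the intermediate sense on \<open>C \<subseteq> 'y\<close>. In the ultrapower
  of \<open>'y\<close>, the powers of \<open>T\<close> along all sequences of exponents tending to infinity induce a commuting
  family of nonexpansive maps, which leaves invariant the set of points \<open>[u\<^sub>j]\<close> with
  \<open>limsup\<^sub>n \<parallel>u\<^sub>j - T\<^sup>n x\<parallel> \<le> r\<close>. A common fixed point there yields, near any \<open>x\<close> with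
  \<open>limsup\<^sub>n \<parallel>x - T\<^sup>n x\<parallel> \<le> r\<close>, a point at which this limsup is at most \<open>r/2\<close>; iterating gives a fixed
  point of \<open>T\<close>.

  The ultrapower is again finitely representable in the direct sum, so its separable subspaces embed
  isometrically into a direct sum of ultrapowers of the \<open>S i\<close>, which are noncreasy. There nested bounded
  closed convex sets meet (a finite James configuration would use each coordinate at most twice), and
  this replaces weak compactness. If a commuting nonexpansive family had no common fixed point,
  a minimal invariant set \<open>K\<close> would contain approximate fixed points at asymptotic distance \<open>d > 0\<close> from
  every point of \<open>K\<close>, and from them an equidistant sequence together with points dividing its
  segments in the ratio \<open>\<mu> : 1 - \<mu>\<close> for infinitely many \<open>\<mu>\<close>. Passing to the limit in each noncreasy
  coordinate, such a point must agree with one of the two endpoints. Hence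
  \<open>\<mu> d\<close> is the \<open>\<psi>\<close>-norm of one of finitely many vectors, a contradiction.
\<close>

section \<open>Ultrafilters and ultrapowers\<close>

text \<open>\<open>T\<close> need not be Lipschitz: only its high powers are controlled, up to an
  additive error that does not shrink with the distance of the points. In the ultrapower this error
  disappears. All exponent sequences are needed at once, because the powers that still move the
  coordinates of a fixed point are known only after that point is. So large a family requires a
  theorem on arbitrary commuting families. The next obstacle is that fixed point sets of
  nonexpansive maps need not be convex here. Convex combinations are replaced by points with
  prescribed bounds for their distances to two given points, found as fixed points in smaller
  invariant sets; such points suffice for the coordinatewise argument. Noncreasiness is assumed of
  the summands only. Strict monotonicity of \<psi> is what turns extremal behaviour in the sum into
  extremal behaviour in every coordinate. Both contradictions are then counts: of steps shared out
  among coordinates, and of sets of coordinates.\<close>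

lemma maximal_fip_family:
  fixes \<A> \<C> :: "'a set set"
  assumes sub: "\<A> \<subseteq> \<C>" and ne: "\<A> \<noteq> {}"
    and int: "\<And>A B. A \<in> \<C> \<Longrightarrow> B \<in> \<C> \<Longrightarrow> A \<inter> B \<in> \<C>"
    and fip: "\<And>F. finite F \<Longrightarrow> F \<subseteq> \<A> \<Longrightarrow> \<Inter>F \<noteq> {}"
  shows "\<exists>M. \<A> \<subseteq> M \<and> M \<subseteq> \<C> \<and> {} \<notin> M \<and> (\<forall>A\<in>M. \<forall>B\<in>M. A \<inter> B \<in> M) \<and>
    (\<forall>B\<in>\<C>. (\<forall>A\<in>M. A \<inter> B \<noteq> {}) \<longrightarrow> B \<in> M)"
proof -
  define \<P> where "\<P> = {M. \<A> \<subseteq> M \<and> M \<subseteq> \<C> \<and> (\<forall>F. finite F \<longrightarrow> F \<subseteq> M \<longrightarrow> \<Inter>F \<noteq> {})}"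
  have "\<A> \<in> \<P>" using sub fip by (auto simp: \<P>_def)
  have "\<exists>M\<in>\<P>. \<forall>X\<in>\<P>. M \<subseteq> X \<longrightarrow> X = M"
  proof (rule subset_Zorn_nonempty)
    show "\<P> \<noteq> {}" using \<open>\<A> \<in> \<P>\<close> by blast
    fix C assume C: "C \<noteq> {}" "subset.chain \<P> C"
    have CP: "C \<subseteq> \<P>" using C(2) by (simp add: subset.chain_def)
    have "\<Inter>F \<noteq> {}" if F: "finite F" "F \<subseteq> \<Union>C" for F
    proof -
      obtain B where "B \<in> C" "F \<subseteq> B"
        using finite_subset_Union_chain[OF F C(1) C(2)] by blast
      then have "B \<in> \<P>" using CP by blast
      then show ?thesis using \<open>F \<subseteq> B\<close> F(1) by (simp add: \<P>_def)
    qed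
    moreover have "\<A> \<subseteq> \<Union>C"
    proof -
      obtain X where "X \<in> C" using C(1) by blast
    then have "X \<in> \<P>" using CP by blast
    then have "\<A> \<subseteq> X" by (simp add: \<P>_def)
    then show ?thesis using \<open>X \<in> C\<close> by blast
    qed
    moreover have "\<Union>C \<subseteq> \<C>" using CP C(1) by (auto 0 3 simp: \<P>_def)
    ultimately show "\<Union>C \<in> \<P>" by (simp add: \<P>_def)
  qed
  then obtain M where MP: "M \<in> \<P>" and max: "\<And>X. X \<in> \<P> \<Longrightarrow> M \<subseteq> X \<Longrightarrow> X = M" by blast
  have M: "\<A> \<subseteq> M" "M \<subseteq> \<C>" "\<And>F. finite F \<Longrightarrow> F \<subseteq> M \<Longrightarrow> \<Inter>F \<noteq> {}"
    using MP by (auto simp: \<P>_def)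
  have ext: "B \<in> M" if B: "B \<in> \<C>" and meet: "\<And>F. finite F \<Longrightarrow> F \<subseteq> M \<Longrightarrow> \<Inter>F \<inter> B \<noteq> {}" for B
  proof -
    have "\<Inter>F \<noteq> {}" if F: "finite F" "F \<subseteq> insert B M" for F
    proof -
      have "\<Inter>(F - {B}) \<inter> B \<noteq> {}" by (rule meet) (use F in auto)
      then show ?thesis by blast
    qed
    then have "insert B M \<in> \<P>" using B M by (auto simp: \<P>_def)
    then show ?thesis using max by blast
  qed
  have cap: "A \<inter> B \<in> M" if "A \<in> M" "B \<in> M" for A B
  proof (rule ext)
    show "A \<inter> B \<in> \<C>" using that M(2) int by blast
    fix F assume "finite F" "F \<subseteq> M"
    then have "\<Inter>(insert A (insert B F)) \<noteq> {}" using that by (intro M(3)) auto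
    then show "\<Inter>F \<inter> (A \<inter> B) \<noteq> {}" by (auto simp: Int_ac)
  qed
  have capF: "F \<noteq> {} \<longrightarrow> \<Inter>F \<in> M" if "finite F" "F \<subseteq> M" for F
    using that
  proof (induction F)
    case (insert x F)
    then show ?case using cap by (cases "F = {}") auto
  qed simp
  show ?thesis
  proof (intro exI conjI ballI impI)
    show "\<A> \<subseteq> M" "M \<subseteq> \<C>" by (fact M)+
    show "A \<inter> B \<in> M" if "A \<in> M" "B \<in> M" for A B by (rule cap[OF that])
    show "{} \<notin> M" using M(3)[of "{{}}"] by auto
    fix B assume B: "B \<in> \<C>" and meet: "\<forall>A\<in>M. A \<inter> B \<noteq> {}"
    show "B \<in> M"
    proof (rule ext[OF B])
      fix F assume F: "finite F" "F \<subseteq> M"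
      obtain A where "A \<in> M" using M(1) ne by blast
      with F have "insert A F \<noteq> {}" "finite (insert A F)" "insert A F \<subseteq> M" by auto
      then have "\<Inter>(insert A F) \<in> M" using capF by blast
      with meet have "\<Inter>(insert A F) \<inter> B \<noteq> {}" by blast
      then show "\<Inter>F \<inter> B \<noteq> {}" by auto
    qed
  qed
qed

lemma ex_free_ultrafilter:
  "\<exists>F::nat filter. F \<noteq> bot \<and> F \<le> sequentially \<and>
     (\<forall>P. eventually P F \<or> eventually (\<lambda>x. \<not> P x) F)"
proof -
  have fip: "\<Inter>F \<noteq> {}" if F: "finite F" "F \<subseteq> range atLeast" for F :: "nat set set"
  proof -
    obtain N where N: "finite N" "F = atLeast ` N" using finite_subset_image[OF F] by metis
    have "Max (insert 0 N) \<in> \<Inter>F" using N by auto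
    then show ?thesis by blast
  qed
  have "\<exists>M::nat set set. range atLeast \<subseteq> M \<and> M \<subseteq> UNIV \<and> {} \<notin> M \<and> (\<forall>A\<in>M. \<forall>B\<in>M. A \<inter> B \<in> M) \<and>
    (\<forall>B\<in>UNIV. (\<forall>A\<in>M. A \<inter> B \<noteq> {}) \<longrightarrow> B \<in> M)" (is "\<exists>M. ?Q M")
    by (rule maximal_fip_family) (use fip in simp_all)
  then obtain M where "?Q M" ..
  then have M: "range atLeast \<subseteq> M" "{} \<notin> M" "\<And>A B. A \<in> M \<Longrightarrow> B \<in> M \<Longrightarrow> A \<inter> B \<in> M"
    "\<And>B. (\<forall>A\<in>M. A \<inter> B \<noteq> {}) \<Longrightarrow> B \<in> M"
    by simp_all
  define F where "F = (INF A\<in>M. principal A)"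
  have ev: "eventually P F \<longleftrightarrow> (\<exists>A\<in>M. A \<subseteq> {x. P x})" for P
    unfolding F_def
  proof (subst eventually_INF_base)
    show "M \<noteq> {}" using M(1) by auto
    show "\<exists>x\<in>M. principal x \<le> inf (principal a) (principal b)" if "a \<in> M" "b \<in> M" for a b
      using M(3)[OF that] by (intro bexI[of _ "a \<inter> b"]) auto
  qed (auto simp: eventually_principal)
  have "F \<noteq> bot" unfolding trivial_limit_def ev using M(2) by auto
  moreover have "F \<le> sequentially"
    unfolding le_filter_def eventually_sequentially ev
  proof (intro allI impI)
    fix P :: "nat \<Rightarrow> bool" assume "\<exists>N. \<forall>n\<ge>N. P n"
    then obtain N where "atLeast N \<subseteq> {x. P x}" by auto
    then show "\<exists>A\<in>M. A \<subseteq> {x. P x}" using M(1) by blast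
  qed
  moreover have "eventually P F \<or> eventually (\<lambda>x. \<not> P x) F" for P
  proof (cases "{x. P x} \<in> M")
    case False
    then obtain A where "A \<in> M" "A \<inter> {x. P x} = {}" using M(4) by blast
    then show ?thesis unfolding ev by blast
  qed (auto simp: ev)
  ultimately show ?thesis by blast
qed

definition freeuf :: "nat filter" (\<open>\<U>\<close>) where
  "\<U> = (SOME F. F \<noteq> bot \<and> F \<le> sequentially \<and> (\<forall>P. eventually P F \<or> eventually (\<lambda>x. \<not> P x) F))"

lemma freeuf_bot [simp]: "\<U> \<noteq> bot"
  and freeuf_le: "\<U> \<le> sequentially"
  and freeuf_cases: "eventually P \<U> \<or> eventually (\<lambda>x. \<not> P x) \<U>"
  using someI_ex[OF ex_free_ultrafilter] unfolding freeuf_def[symmetric] by auto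

lemma not_eventually_freeuf: "\<not> eventually P \<U> \<longleftrightarrow> eventually (\<lambda>x. \<not> P x) \<U>"
  using freeuf_cases[of P] eventually_conj[of P \<U> "\<lambda>x. \<not> P x"] by auto

lemma eventually_freeufI: "eventually P sequentially \<Longrightarrow> eventually P \<U>"
  using freeuf_le by (simp add: le_filter_def)

lemma tendsto_freeufI: "(f \<longlongrightarrow> l) sequentially \<Longrightarrow> (f \<longlongrightarrow> l) \<U>"
  using freeuf_le by (rule tendsto_mono)

lemma freeuf_ge: "eventually (\<lambda>n. n \<ge> N) \<U>"
  by (rule eventually_freeufI) (rule eventually_ge_at_top)

lemma freeuf_convergent:
  fixes f :: "nat \<Rightarrow> real"
  assumes "bounded (range f)" shows "\<exists>l. (f \<longlongrightarrow> l) \<U>"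
proof -
  obtain K where K: "\<And>n. \<bar>f n\<bar> \<le> K" using assms by (auto simp: bounded_iff)
  define S where "S = {r. eventually (\<lambda>n. r \<le> f n) \<U>}"
  have up: "r \<le> K" if "r \<in> S" for r
  proof -
    have "eventually (\<lambda>n. r \<le> f n) \<U>" using that by (simp add: S_def)
    then obtain n where "r \<le> f n" using eventually_happens'[OF freeuf_bot] by blast
    then show ?thesis using K[of n] by linarith
  qed
  have "- K \<in> S" unfolding S_def using K by (auto intro!: always_eventually simp: abs_le_iff minus_le_iff)
  have bdd: "bdd_above S" using up by (auto simp: bdd_above_def)
  have "(f \<longlongrightarrow> Sup S) \<U>"
  proof (rule order_tendstoI)
    fix a assume "a < Sup S"
    then obtain r where r: "r \<in> S" "a < r" using less_cSup_iff[OF _ bdd] \<open>- K \<in> S\<close> by blast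
    then show "eventually (\<lambda>n. a < f n) \<U>" by (auto simp: S_def elim: eventually_mono)
  next
    fix a assume "Sup S < a"
    then have "a \<notin> S" using cSup_upper[OF _ bdd] by force
    then have "eventually (\<lambda>n. \<not> a \<le> f n) \<U>" unfolding S_def by (simp add: not_eventually_freeuf)
    then show "eventually (\<lambda>n. f n < a) \<U>" by (simp add: not_le)
  qed
  then show ?thesis by blast
qed

lemma freeuf_Lim:
  fixes f :: "nat \<Rightarrow> real"
  assumes "bounded (range f)" shows "(f \<longlongrightarrow> Lim \<U> f) \<U>"
  using freeuf_convergent[OF assms] tendsto_Lim[OF freeuf_bot] by metis

text \<open>Countable saturation. The witness at \<open>n\<close> serves the first conditions up to
  \<open>kk n\<close>, the largest \<open>k \<le> n\<close> for which they are jointly solvable. The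
  bound by \<open>n\<close> makes the maximum exist, and it eventually exceeds every
  \<open>k\<close> because \<U> is free.\<close>

lemma freeuf_saturation:
  assumes "\<And>k. eventually (\<lambda>n. \<exists>w. \<forall>j\<le>k. P j n w) \<U>"
  shows "\<exists>w. \<forall>k::nat. eventually (\<lambda>n. P k n (w n)) \<U>"
proof -
  define Q where "Q k n \<longleftrightarrow> (\<exists>w. \<forall>j\<le>k. P j n w)" for k n
  define kk where "kk n = Max {k. k \<le> n \<and> Q k n}" for n
  define w where "w n = (SOME w. \<forall>j\<le>kk n. P j n w)" for n
  have "eventually (\<lambda>n. P k n (w n)) \<U>" for k
  proof -
    have "eventually (\<lambda>n. Q k n \<and> n \<ge> k) \<U>"
      using assms[of k] freeuf_ge[of k] by (simp add: Q_def eventually_conj)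
    then show ?thesis
    proof (rule eventually_mono)
      fix n assume n: "Q k n \<and> n \<ge> k"
      have fin: "finite {k. k \<le> n \<and> Q k n}" by auto
      have "kk n \<in> {k. k \<le> n \<and> Q k n}" unfolding kk_def using n by (intro Max_in[OF fin]) auto
      then have "\<exists>w. \<forall>j\<le>kk n. P j n w" by (simp add: Q_def)
      then have "\<forall>j\<le>kk n. P j n (w n)" unfolding w_def by (rule someI_ex)
      moreover have "k \<le> kk n" unfolding kk_def using n fin by (intro Max_ge) auto
      ultimately show "P k n (w n)" by blast
    qed
  qed
  then show ?thesis by blast
qed

text \<open>On the discrete space \<open>nat\<close> every bounded function is continuous, so
  \<open>nat \<Rightarrow>\<^sub>C 'a\<close> is the space of bounded sequences. Dividing by the
  sequences that tend to 0 along \<U> gives the ultrapower.\<close>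

definition ultra_rel :: "(nat \<Rightarrow>\<^sub>C 'a::real_normed_vector) \<Rightarrow> (nat \<Rightarrow>\<^sub>C 'a) \<Rightarrow> bool" where
  "ultra_rel u v \<longleftrightarrow> ((\<lambda>n. norm (apply_bcontfun u n - apply_bcontfun v n)) \<longlongrightarrow> 0) \<U>"

lemma ultra_rel_alt: "ultra_rel u v \<longleftrightarrow> ((\<lambda>n. apply_bcontfun u n - apply_bcontfun v n) \<longlongrightarrow> 0) \<U>"
  by (simp add: ultra_rel_def tendsto_norm_zero_iff)

quotient_type (overloaded) 'a ultra = "nat \<Rightarrow>\<^sub>C ('a::real_normed_vector)" / ultra_rel
proof (rule equivpI)
  show "reflp ultra_rel" by (auto intro: reflpI simp: ultra_rel_alt)
  show "symp ultra_rel" by (auto intro!: sympI simp: ultra_rel_def norm_minus_commute)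
  show "transp (ultra_rel :: (nat \<Rightarrow>\<^sub>C 'a) \<Rightarrow> _)"
  proof (rule transpI)
    fix u v w :: "nat \<Rightarrow>\<^sub>C 'a" assume "ultra_rel u v" "ultra_rel v w"
    from tendsto_add[OF this[unfolded ultra_rel_alt]] show "ultra_rel u w" by (simp add: ultra_rel_alt)
  qed
qed

lemma bounded_range_bcontfun: "bounded (range (apply_bcontfun (u :: nat \<Rightarrow>\<^sub>C 'a::real_normed_vector)))"
  using bounded_apply_bcontfun[of u] by (auto simp: bounded_iff)

lemma bounded_range_norm:
  fixes f :: "nat \<Rightarrow> 'a::real_normed_vector"
  shows "bounded (range f) \<Longrightarrow> bounded (range (\<lambda>n. norm (f n)))"
  by (auto simp: bounded_iff)

section \<open>Linear structure, norm and completeness of the ultrapower\<close>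

instantiation ultra :: (real_normed_vector) real_vector
begin

lift_definition zero_ultra :: "'a ultra" is 0 .
lift_definition plus_ultra :: "'a ultra \<Rightarrow> 'a ultra \<Rightarrow> 'a ultra" is "(+)"
proof -
  fix u v x y :: "nat \<Rightarrow>\<^sub>C 'a" assume "ultra_rel u v" "ultra_rel x y"
  from tendsto_add[OF this[unfolded ultra_rel_alt]] show "ultra_rel (u + x) (v + y)"
    by (simp add: ultra_rel_alt algebra_simps)
qed
lift_definition uminus_ultra :: "'a ultra \<Rightarrow> 'a ultra" is "uminus"
proof -
  fix u v :: "nat \<Rightarrow>\<^sub>C 'a" assume "ultra_rel u v"
  then show "ultra_rel (- u) (- v)" by (simp add: ultra_rel_def norm_minus_commute)
qed
lift_definition minus_ultra :: "'a ultra \<Rightarrow> 'a ultra \<Rightarrow> 'a ultra" is "(-)"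
proof -
  fix u v x y :: "nat \<Rightarrow>\<^sub>C 'a" assume "ultra_rel u v" "ultra_rel x y"
  from tendsto_diff[OF this[unfolded ultra_rel_alt]] show "ultra_rel (u - x) (v - y)"
    by (simp add: ultra_rel_alt algebra_simps)
qed
lift_definition scaleR_ultra :: "real \<Rightarrow> 'a ultra \<Rightarrow> 'a ultra" is "scaleR"
proof -
  fix r and u v :: "nat \<Rightarrow>\<^sub>C 'a" assume "ultra_rel u v"
  from tendsto_scaleR[OF tendsto_const[of r] this[unfolded ultra_rel_alt]]
  show "ultra_rel (r *\<^sub>R u) (r *\<^sub>R v)" by (simp add: ultra_rel_alt algebra_simps)
qed

instance
proof
  fix a b c :: "'a ultra" and r s :: real
  show "a + b + c = a + (b + c)" "a + b = b + a" "0 + a = a" "- a + a = 0" "a - b = a + - b"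
    "r *\<^sub>R (a + b) = r *\<^sub>R a + r *\<^sub>R b" "(r + s) *\<^sub>R a = r *\<^sub>R a + s *\<^sub>R a"
    "r *\<^sub>R s *\<^sub>R a = (r * s) *\<^sub>R a" "1 *\<^sub>R a = a"
    by (transfer, simp add: algebra_simps ultra_rel_alt)+
qed

end

instantiation ultra :: (real_normed_vector) real_normed_vector
begin

lift_definition norm_ultra :: "'a ultra \<Rightarrow> real" is "\<lambda>u. Lim \<U> (\<lambda>n. norm (apply_bcontfun u n))"
proof -
  fix u v :: "nat \<Rightarrow>\<^sub>C 'a" assume r: "ultra_rel u v"
  have v: "((\<lambda>n. norm (apply_bcontfun v n)) \<longlongrightarrow> Lim \<U> (\<lambda>n. norm (apply_bcontfun v n))) \<U>"
    by (intro freeuf_Lim bounded_range_norm bounded_range_bcontfun)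
  have "((\<lambda>n. norm (apply_bcontfun u n) - norm (apply_bcontfun v n)) \<longlongrightarrow> 0) \<U>"
    by (rule Lim_null_comparison[OF _ r[unfolded ultra_rel_def]])
       (auto intro!: always_eventually simp: norm_triangle_ineq3)
  from tendsto_add[OF this v]
  show "Lim \<U> (\<lambda>n. norm (apply_bcontfun u n)) = Lim \<U> (\<lambda>n. norm (apply_bcontfun v n))"
    by (intro tendsto_Lim) auto
qed
definition dist_ultra :: "'a ultra \<Rightarrow> 'a ultra \<Rightarrow> real" where "dist_ultra x y = norm (x - y)"
definition sgn_ultra :: "'a ultra \<Rightarrow> 'a ultra" where "sgn_ultra x = x /\<^sub>R norm x"
definition uniformity_ultra :: "('a ultra \<times> 'a ultra) filter" where
  "uniformity_ultra = (INF e\<in>{0<..}. principal {(x, y). dist x y < e})"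
definition open_ultra :: "'a ultra set \<Rightarrow> bool" where
  "open_ultra U \<longleftrightarrow> (\<forall>x\<in>U. \<forall>\<^sub>F (x', y) in uniformity. x' = x \<longrightarrow> y \<in> U)"

lemma norm_ultra_tendsto:
  "((\<lambda>n. norm (apply_bcontfun u n)) \<longlongrightarrow> norm (abs_ultra u)) \<U>"
  unfolding norm_ultra.abs_eq by (intro freeuf_Lim bounded_range_norm bounded_range_bcontfun)

instance
proof
  fix a b :: "'a ultra" and r :: real
  show "dist a b = norm (a - b)" "sgn a = a /\<^sub>R norm a" by (fact dist_ultra_def sgn_ultra_def)+
  show "uniformity = (INF e\<in>{0<..}. principal {(x, y :: 'a ultra). dist x y < e})"
    by (fact uniformity_ultra_def)
  show "open U = (\<forall>x\<in>U. \<forall>\<^sub>F (x', y) in uniformity. x' = x \<longrightarrow> y \<in> U)" for U :: "'a ultra set"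
    by (fact open_ultra_def)
  show "(norm a = 0) = (a = 0)"
  proof (induct a)
    fix u :: "nat \<Rightarrow>\<^sub>C 'a"
    show "norm (abs_ultra u) = 0 \<longleftrightarrow> abs_ultra u = 0"
    proof
      assume "norm (abs_ultra u) = 0"
      then show "abs_ultra u = 0"
        using norm_ultra_tendsto[of u] by (simp add: zero_ultra_def ultra.abs_eq_iff ultra_rel_def)
    next
      assume "abs_ultra u = 0"
      then have "((\<lambda>n. norm (apply_bcontfun u n)) \<longlongrightarrow> 0) \<U>"
        by (simp add: zero_ultra_def ultra.abs_eq_iff ultra_rel_def)
      from tendsto_unique[OF freeuf_bot this norm_ultra_tendsto] show "norm (abs_ultra u) = 0" by simp
    qed
  qed
  show "norm (a + b) \<le> norm a + norm b"
  proof (induct a, induct b)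
    fix u v :: "nat \<Rightarrow>\<^sub>C 'a"
    show "norm (abs_ultra v + abs_ultra u) \<le> norm (abs_ultra v) + norm (abs_ultra u)"
      unfolding plus_ultra.abs_eq
      by (rule tendsto_le[OF freeuf_bot tendsto_add[OF norm_ultra_tendsto norm_ultra_tendsto] norm_ultra_tendsto])
         (auto intro!: always_eventually norm_triangle_ineq)
  qed
  show "norm (r *\<^sub>R a) = \<bar>r\<bar> * norm a"
  proof (induct a)
    fix u :: "nat \<Rightarrow>\<^sub>C 'a"
    show "norm (r *\<^sub>R abs_ultra u) = \<bar>r\<bar> * norm (abs_ultra u)"
      unfolding scaleR_ultra.abs_eq
      by (rule tendsto_unique[OF freeuf_bot norm_ultra_tendsto])
         (use tendsto_mult[OF tendsto_const[of "\<bar>r\<bar>"] norm_ultra_tendsto[of u]] in simp)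
  qed
qed

end

text \<open>\<open>Bcontfun\<close> is meaningful on bounded sequences only, so the class of an
  unbounded sequence is junk; hence the boundedness conditions that accompany its use.\<close>

definition ucls :: "(nat \<Rightarrow> 'a::real_normed_vector) \<Rightarrow> 'a ultra" where
  "ucls u = abs_ultra (Bcontfun u)"

lemma apply_Bcontfun_nat:
  "bounded (range u) \<Longrightarrow> apply_bcontfun (Bcontfun (u :: nat \<Rightarrow> 'a::real_normed_vector)) = u"
  by (rule Bcontfun_inverse) (auto simp: bcontfun_def)

lemma Bcontfun_eq_iff: "bounded (range u) \<Longrightarrow> f = Bcontfun (u :: nat \<Rightarrow> 'a::real_normed_vector) \<longleftrightarrow> apply_bcontfun f = u"
  using apply_Bcontfun_nat[of u] by (auto intro: bcontfun_eqI)

lemma bounded_range_plus: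
  fixes u v :: "nat \<Rightarrow> 'a::real_normed_vector"
  assumes "bounded (range u)" "bounded (range v)" shows "bounded (range (\<lambda>n. u n + v n))"
proof -
  obtain a b where "\<And>n. norm (u n) \<le> a" "\<And>n. norm (v n) \<le> b" using assms by (auto simp: bounded_iff)
  then have "norm (u n + v n) \<le> a + b" for n by (meson add_mono norm_triangle_ineq order_trans)
  then show ?thesis by (auto simp: bounded_iff)
qed

lemma bounded_range_scaleR:
  fixes u :: "nat \<Rightarrow> 'a::real_normed_vector"
  assumes "bounded (range u)" shows "bounded (range (\<lambda>n. c *\<^sub>R u n))"
  using bounded_scaling[OF assms, of c] by (simp add: image_image)

lemma bounded_range_minus:
  fixes u v :: "nat \<Rightarrow> 'a::real_normed_vector"
  assumes "bounded (range u)" "bounded (range v)" shows "bounded (range (\<lambda>n. u n - v n))"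
  using bounded_range_plus[OF assms(1) bounded_range_scaleR[OF assms(2), of "-1"]] by simp

lemma ucls_plus: "bounded (range u) \<Longrightarrow> bounded (range v) \<Longrightarrow> ucls (\<lambda>n. u n + v n) = ucls u + ucls v"
  unfolding ucls_def plus_ultra.abs_eq
  by (rule arg_cong[of _ _ abs_ultra], subst eq_commute, subst Bcontfun_eq_iff)
     (auto simp: apply_Bcontfun_nat bounded_range_plus)

lemma ucls_minus: "bounded (range u) \<Longrightarrow> bounded (range v) \<Longrightarrow> ucls (\<lambda>n. u n - v n) = ucls u - ucls v"
  unfolding ucls_def minus_ultra.abs_eq
  by (rule arg_cong[of _ _ abs_ultra], subst eq_commute, subst Bcontfun_eq_iff)
     (auto simp: apply_Bcontfun_nat bounded_range_minus)

lemma ucls_scaleR: "bounded (range u) \<Longrightarrow> ucls (\<lambda>n. c *\<^sub>R u n) = c *\<^sub>R ucls u"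
  unfolding ucls_def scaleR_ultra.abs_eq
  by (rule arg_cong[of _ _ abs_ultra], subst eq_commute, subst Bcontfun_eq_iff)
     (auto simp: apply_Bcontfun_nat bounded_range_scaleR)

lemma ucls_zero [simp]: "ucls (\<lambda>n. 0) = 0"
  using ucls_scaleR[of "\<lambda>n. 0" 0] by simp

lemma ucls_norm: "bounded (range u) \<Longrightarrow> ((\<lambda>n. norm (u n)) \<longlongrightarrow> norm (ucls u)) \<U>"
  using norm_ultra_tendsto[of "Bcontfun u"] by (simp add: ucls_def apply_Bcontfun_nat)

lemma ucls_dist:
  "bounded (range u) \<Longrightarrow> bounded (range v) \<Longrightarrow> ((\<lambda>n. norm (u n - v n)) \<longlongrightarrow> norm (ucls u - ucls v)) \<U>"
  using ucls_norm[OF bounded_range_minus] by (metis ucls_minus)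

lemma ucls_eq_iff:
  "bounded (range u) \<Longrightarrow> bounded (range v) \<Longrightarrow> ucls u = ucls v \<longleftrightarrow> ((\<lambda>n. norm (u n - v n)) \<longlongrightarrow> 0) \<U>"
  by (simp add: ucls_def ultra.abs_eq_iff ultra_rel_def apply_Bcontfun_nat)

lemma ucls_cong_ev:
  assumes "bounded (range u)" "bounded (range v)" "eventually (\<lambda>n. u n = v n) \<U>"
  shows "ucls u = ucls v"
  unfolding ucls_eq_iff[OF assms(1,2)]
  by (rule tendsto_eventually) (use assms(3) in \<open>auto elim: eventually_mono\<close>)

lemma ucls_cases:
  obtains u where "bounded (range u)" "x = ucls u"
proof (induct x)
  fix u assume *: "\<And>v. bounded (range v) \<Longrightarrow> abs_ultra u = ucls v \<Longrightarrow> thesis"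
  have "Bcontfun (apply_bcontfun u) = u" by (rule apply_bcontfun_inverse)
  then show thesis using *[OF bounded_range_bcontfun[of u]] by (simp add: ucls_def)
qed

instance ultra :: (real_normed_vector) banach
proof
  fix X :: "nat \<Rightarrow> 'a ultra" assume "Cauchy X"
  then have cau: "\<exists>M. \<forall>m\<ge>M. \<forall>n\<ge>M. dist (X m) (X n) < e" if "e > 0" for e
    using that by (auto simp: Cauchy_def)
  have "\<exists>M. \<forall>k. \<forall>m\<ge>M k. \<forall>n\<ge>M k. dist (X m) (X n) < 1 / real (Suc k)"
    by (intro choice allI) (rule cau, simp)
  then obtain M where M: "\<And>k m n. m \<ge> M k \<Longrightarrow> n \<ge> M k \<Longrightarrow> norm (X m - X n) < 1 / real (Suc k)"
    by (auto simp: dist_norm)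
  have "\<exists>u. \<forall>k. bounded (range (u k)) \<and> X k = ucls (u k)"
    by (intro choice allI) (meson ucls_cases)
  then obtain u where u: "\<And>k. bounded (range (u k))" "\<And>k. X k = ucls (u k)" by blast
  have "\<exists>w. \<forall>k. eventually (\<lambda>n. norm (w n - u (M k) n) \<le> 1 / real (Suc k)) \<U>"
  proof (rule freeuf_saturation)
    fix k
    \<comment> \<open>One term of the Cauchy sequence beyond all of \<open>M 0\<close>, ...,
      \<open>M k\<close> satisfies the conditions up to \<open>k\<close> simultaneously.\<close>
    define m where "m = Max (M ` {..k})"
    have "eventually (\<lambda>n. norm (u m n - u (M j) n) \<le> 1 / real (Suc j)) \<U>" if "j \<le> k" for j
    proof -
      have "M j \<le> m" using that by (auto simp: m_def)
      then have "norm (X m - X (M j)) < 1 / real (Suc j)" by (intro M) auto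
      from order_tendstoD(2)[OF ucls_dist[OF u(1) u(1)] this[unfolded u(2)]]
      show ?thesis by (auto elim: eventually_mono)
    qed
    then have "eventually (\<lambda>n. \<forall>j\<in>{..k}. norm (u m n - u (M j) n) \<le> 1 / real (Suc j)) \<U>"
      by (intro eventually_ball_finite) auto
    then show "eventually (\<lambda>n. \<exists>w. \<forall>j\<le>k. norm (w - u (M j) n) \<le> 1 / real (Suc j)) \<U>"
      by (auto elim!: eventually_mono)
  qed
  then obtain w0 where w0: "\<And>k. eventually (\<lambda>n. norm (w0 n - u (M k) n) \<le> 1 / real (Suc k)) \<U>" by blast
  obtain B where B: "\<And>n. norm (u (M 0) n) \<le> B" using u(1)[of "M 0"] by (auto simp: bounded_iff)
  \<comment> \<open>Saturation gives no bound on \<open>w0\<close>, but along \<U> it stays within 1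
    of the bounded sequence \<open>u (M 0)\<close>; the remaining terms are cut off.\<close>
  define w where "w n = (if norm (w0 n) \<le> B + 1 then w0 n else 0)" for n
  have "norm (w n) \<le> \<bar>B\<bar> + 1" for n by (auto simp: w_def)
  then have bw: "bounded (range w)" by (auto simp: bounded_iff)
  have "eventually (\<lambda>n. w n = w0 n) \<U>"
    using w0[of 0]
  proof (rule eventually_mono)
    fix n assume "norm (w0 n - u (M 0) n) \<le> 1 / real (Suc 0)"
    then show "w n = w0 n" using B[of n] norm_triangle_sub[of "w0 n" "u (M 0) n"] by (auto simp: w_def)
  qed
  then have wk: "eventually (\<lambda>n. norm (w n - u (M k) n) \<le> 1 / real (Suc k)) \<U>" for k
    using w0[of k] by eventually_elim simp
  have near: "norm (ucls w - X (M k)) \<le> 1 / real (Suc k)" for k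
    unfolding u(2) by (rule tendsto_upperbound[OF ucls_dist[OF bw u(1)] wk freeuf_bot])
  have "X \<longlonglongrightarrow> ucls w"
  proof (rule metric_LIMSEQ_I)
    fix r :: real assume "r > 0"
    then obtain k where k: "2 / real (Suc k) < r"
      using reals_Archimedean[of "r/2"] by (auto simp: field_simps)
    show "\<exists>no. \<forall>n\<ge>no. dist (X n) (ucls w) < r"
    proof (intro exI[of _ "M k"] allI impI)
      fix n assume "M k \<le> n"
      then have "norm (X n - X (M k)) < 1 / real (Suc k)" by (intro M) auto
      moreover have "norm (X n - ucls w) \<le> norm (X n - X (M k)) + norm (ucls w - X (M k))"
        using norm_triangle_ineq4[of "X n - X (M k)" "ucls w - X (M k)"] by simp
      ultimately have "norm (X n - ucls w) < 1 / real (Suc k) + 1 / real (Suc k)"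
        using near[of k] by linarith
      then show "dist (X n) (ucls w) < r" using k by (simp add: dist_norm)
    qed
  qed
  then show "convergent X" by (auto simp: convergent_def)
qed

section \<open>Norming functionals and noncreasy subspaces\<close>

text \<open>Hahn-Banach by Zorn's lemma on graphs, so that the union of a chain of partial
  functionals is its upper bound. Single-valuedness is automatic: in a subspace of pairs with
  \<open>r \<le> norm x\<close>, the pairs \<open>(0, t)\<close> and \<open>(0, - t)\<close> force
  \<open>t = 0\<close>.\<close>

lemma norming_functional_graph:
  fixes S :: "'a::real_normed_vector set"
  assumes S: "subspace S" "s \<in> S"
  obtains G where "subspace G" "\<And>x r. (x, r) \<in> G \<Longrightarrow> r \<le> norm x" "fst ` G = S" "(s, norm s) \<in> G"
proof -
  define \<P> where "\<P> = {G. subspace G \<and> (\<forall>x r. (x, r) \<in> G \<longrightarrow> r \<le> norm x) \<and> fst ` G \<subseteq> S \<and> (s, norm s) \<in> G}"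
  have G0: "span {(s, norm s)} \<in> \<P>"
    unfolding \<P>_def
  proof (intro CollectI conjI allI impI)
    show "r \<le> norm x" if "(x, r) \<in> span {(s, norm s)}" for x r
      using that by (auto simp: span_singleton abs_le_iff intro!: mult_right_mono)
    show "fst ` span {(s, norm s)} \<subseteq> S"
      using S by (auto simp: span_singleton subspace_scale)
  qed (auto simp: span_base)
  have "\<exists>M\<in>\<P>. \<forall>X\<in>\<P>. M \<subseteq> X \<longrightarrow> X = M"
  proof (rule subset_Zorn_nonempty)
    show "\<P> \<noteq> {}" using G0 by blast
    fix C assume C: "C \<noteq> {}" "subset.chain \<P> C"
    have CP: "G \<in> \<P>" if "G \<in> C" for G using C(2) that by (auto simp: subset.chain_def)
    have ch: "G \<subseteq> H \<or> H \<subseteq> G" if "G \<in> C" "H \<in> C" for G H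
      using C(2) that by (auto simp: subset.chain_def)
    have "subspace (\<Union>C)"
    proof (rule subspaceI)
      obtain G where "G \<in> C" using C(1) by blast
      then have "0 \<in> G" using CP[of G] by (auto simp: \<P>_def intro: subspace_0)
      then show "0 \<in> \<Union>C" using \<open>G \<in> C\<close> by blast
    next
      fix x y assume "x \<in> \<Union>C" "y \<in> \<Union>C"
      then obtain G H where GH: "G \<in> C" "x \<in> G" "H \<in> C" "y \<in> H" by blast
      then obtain K where K: "K \<in> C" "x \<in> K" "y \<in> K" using ch[of G H] by blast
      then have "x + y \<in> K" using CP[of K] by (auto simp: \<P>_def intro: subspace_add)
      then show "x + y \<in> \<Union>C" using K by blast
    next
      fix c and x assume "x \<in> \<Union>C"
      then obtain G where G: "G \<in> C" "x \<in> G" by blast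
      then have "c *\<^sub>R x \<in> G" using CP[of G] by (auto simp: \<P>_def intro: subspace_scale)
      then show "c *\<^sub>R x \<in> \<Union>C" using G by blast
    qed
    moreover have "\<forall>x r. (x, r) \<in> \<Union>C \<longrightarrow> r \<le> norm x" "fst ` \<Union>C \<subseteq> S"
      using CP by (auto simp: \<P>_def image_subset_iff)
    moreover have "(s, norm s) \<in> \<Union>C"
      using C(1) CP by (auto simp: \<P>_def)
    ultimately show "\<Union>C \<in> \<P>" by (simp add: \<P>_def)
  qed
  then obtain G where GP: "G \<in> \<P>" and max: "\<And>X. X \<in> \<P> \<Longrightarrow> G \<subseteq> X \<Longrightarrow> X = G" by blast
  then have G: "subspace G" "\<And>x r. (x, r) \<in> G \<Longrightarrow> r \<le> norm x" "fst ` G \<subseteq> S" "(s, norm s) \<in> G"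
    by (auto simp: \<P>_def)
  have "S \<subseteq> fst ` G"
  proof
    fix x0 assume x0: "x0 \<in> S"
    \<comment> \<open>A value \<open>a\<close> at the new vector \<open>x0\<close> is admissible if
      it lies between all \<open>r - norm (y - x0)\<close> and all \<open>norm (y + x0) - r\<close>.
      By \<open>sep\<close> the first numbers never exceed the second ones, and the supremum of the
      first is taken.\<close>
    define L where "L = (\<lambda>(y, r). r - norm (y - x0)) ` G"
    have sep: "r' - norm (y' - x0) \<le> norm (y + x0) - r" if "(y, r) \<in> G" "(y', r') \<in> G" for y r y' r'
    proof -
      have "(y + y', r + r') \<in> G" using subspace_add[OF G(1) that] by simp
      then have "r + r' \<le> norm (y + y')" by (rule G(2))
      also have "\<dots> \<le> norm (y + x0) + norm (y' - x0)"
        using norm_triangle_ineq[of "y + x0" "y' - x0"] by simp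
      finally show ?thesis by simp
    qed
    define a where "a = Sup L"
    have z: "(0, 0) \<in> G" using subspace_0[OF G(1)] by (simp add: zero_prod_def)
    have bdd: "bdd_above L" unfolding L_def using sep[OF z] by (auto intro!: bdd_aboveI2)
    have ne: "L \<noteq> {}" using z by (auto simp: L_def)
    have a1: "r - norm (y - x0) \<le> a" if "(y, r) \<in> G" for y r
      unfolding a_def by (rule cSup_upper[OF _ bdd]) (use that in \<open>force simp: L_def\<close>)
    have a2: "a \<le> norm (y + x0) - r" if "(y, r) \<in> G" for y r
      unfolding a_def by (rule cSup_least[OF ne]) (use sep[OF that] in \<open>auto simp: L_def\<close>)
    have "span (insert (x0, a) G) \<in> \<P>"
      unfolding \<P>_def
    proof (intro CollectI conjI allI impI)
      fix x r assume "(x, r) \<in> span (insert (x0, a) G)"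
      then obtain t where "(x, r) - t *\<^sub>R (x0, a) \<in> span G" by (auto simp: span_insert)
      then have tG: "(x - t *\<^sub>R x0, r - t * a) \<in> G" using G(1) by (simp add: span_eq_iff[THEN iffD2])
      consider "t = 0" | "t > 0" | "t < 0" by linarith
      then show "r \<le> norm x"
      proof cases
        case 1 then show ?thesis using G(2)[OF tG] by simp
      next
        case 2
        have "(1 / t) *\<^sub>R (x - t *\<^sub>R x0, r - t * a) \<in> G" by (rule subspace_scale[OF G(1) tG])
        then have "((1 / t) *\<^sub>R x - x0, r / t - a) \<in> G" using 2 by (simp add: algebra_simps diff_divide_distrib)
        from a2[OF this] have "r / t \<le> norm ((1 / t) *\<^sub>R x)" by simp
        then show ?thesis using 2 by (simp add: field_simps)
      next
        case 3
        have "(- 1 / t) *\<^sub>R (x - t *\<^sub>R x0, r - t * a) \<in> G" by (rule subspace_scale[OF G(1) tG])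
        then have "((- 1 / t) *\<^sub>R x + x0, a - r / t) \<in> G" using 3 by (simp add: algebra_simps diff_divide_distrib)
        from a1[OF this] have "- r / t \<le> norm ((- 1 / t) *\<^sub>R x)" by simp
        then show ?thesis using 3 by (simp add: field_simps)
      qed
    next
      have "(x0, a) \<in> S \<times> UNIV" "G \<subseteq> S \<times> UNIV" using x0 G(3) by auto
      moreover have "subspace (S \<times> (UNIV :: real set))" by (intro subspace_Times S(1) subspace_UNIV)
      ultimately have "span (insert (x0, a) G) \<subseteq> S \<times> UNIV" by (intro span_minimal) auto
      then show "fst ` span (insert (x0, a) G) \<subseteq> S" by auto
    next
      show "(s, norm s) \<in> span (insert (x0, a) G)" using G(4) by (intro span_base) simp
    qed simp
    moreover have "G \<subseteq> span (insert (x0, a) G)" using span_superset[of "insert (x0, a) G"] by blast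
    ultimately have "span (insert (x0, a) G) = G" by (rule max)
    then have "(x0, a) \<in> G" using span_base[of "(x0, a)" "insert (x0, a) G"] by simp
    then show "x0 \<in> fst ` G" by force
  qed
  then show thesis using that G by blast
qed

lemma norming_functional:
  fixes S :: "'a::real_normed_vector set"
  assumes S: "subspace S" "s \<in> S" "s \<noteq> 0"
  obtains f where "f \<in> dual_sphere S" "f s = norm s"
proof -
  obtain G where G: "subspace G" "\<And>x r. (x, r) \<in> G \<Longrightarrow> r \<le> norm x" "fst ` G = S" "(s, norm s) \<in> G"
    using norming_functional_graph[OF S(1,2)] by blast
  have uniq: "r = r'" if "(x, r) \<in> G" "(x, r') \<in> G" for x r r'
    using G(2)[of 0 "r - r'"] G(2)[of 0 "r' - r"]
      subspace_diff[OF G(1) that] subspace_diff[OF G(1) that(2,1)] by simp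
  define f where "f x = (THE r. (x, r) \<in> G)" for x
  have fI: "f x = r" if "(x, r) \<in> G" for x r
    unfolding f_def using that uniq by blast
  have fG: "(x, f x) \<in> G" if x: "x \<in> S" for x
  proof -
    have "x \<in> fst ` G" using x G(3) by simp
    then obtain r where "(x, r) \<in> G" by force
    then show ?thesis using fI by simp
  qed
  have lin: "lin_on S f"
    unfolding lin_on_def
  proof (intro conjI ballI allI)
    show "f (x + y) = f x + f y" if "x \<in> S" "y \<in> S" for x y
      using subspace_add[OF G(1) fG[OF that(1)] fG[OF that(2)]] by (intro fI) simp
    show "f (c *\<^sub>R x) = c * f x" if "x \<in> S" for c x
      using subspace_scale[OF G(1) fG[OF that], of c] by (intro fI) simp
  qed
  have abs: "\<bar>f x\<bar> \<le> norm x" if x: "x \<in> S" for x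
  proof -
    have "- x \<in> S" using x S(1) by (simp add: subspace_neg)
    then have "f (- x) = - f x" using lin x unfolding lin_on_def by (metis mult_minus1 scaleR_minus1_left)
    then show ?thesis using G(2)[OF fG[OF x]] G(2)[OF fG[OF \<open>- x \<in> S\<close>]] by simp
  qed
  have fs: "f s = norm s" using G(4) by (rule fI)
  have "dual_norm S f = 1"
    unfolding dual_norm_def
  proof (rule cSup_eq_maximum)
    have "f ((1 / norm s) *\<^sub>R s) = 1" using lin S fs by (simp add: lin_on_def)
    moreover have "(1 / norm s) *\<^sub>R s \<in> {x \<in> S. norm x \<le> 1}" using S by (simp add: subspace_scale)
    ultimately show "1 \<in> (\<lambda>x. \<bar>f x\<bar>) ` {x \<in> S. norm x \<le> 1}" by force
    show "y \<le> 1" if "y \<in> (\<lambda>x. \<bar>f x\<bar>) ` {x \<in> S. norm x \<le> 1}" for y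
      using that abs by force
  qed
  moreover have "\<exists>K. \<forall>x\<in>S. \<bar>f x\<bar> \<le> K * norm x" using abs by (intro exI[of _ 1]) simp
  ultimately have "f \<in> dual_sphere S" using lin by (simp add: dual_sphere_def)
  then show thesis using fs by (rule that)
qed

text \<open>The condition is relative to a norming set \<open>\<Phi>\<close> of functionals, and the
  distance of \<open>f\<close> and \<open>g\<close> is witnessed by a vector \<open>w\<close>. In
  this form it passes to the ultrapower, with limits of sequences of functionals in place of
  \<open>\<Phi>\<close>; the full dual of an ultrapower has no such description in general.\<close>

definition noncreasy_wrt :: "'b::real_normed_vector set \<Rightarrow> ('b \<Rightarrow> real) set \<Rightarrow> bool" where
  "noncreasy_wrt W \<Phi> \<longleftrightarrow> subspace W \<and> (\<forall>f\<in>\<Phi>. lin_on W f \<and> (\<forall>x\<in>W. \<bar>f x\<bar> \<le> norm x)) \<and>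
     (\<forall>s\<in>W. s \<noteq> 0 \<longrightarrow> (\<exists>f\<in>\<Phi>. f s = norm s)) \<and>
     (\<forall>\<epsilon>>0. \<exists>\<delta>>0. \<forall>f\<in>\<Phi>. \<forall>g\<in>\<Phi>. \<forall>w\<in>W. \<forall>p\<in>W. \<forall>q\<in>W. norm w \<le> 1 \<longrightarrow> norm p \<le> 1 \<longrightarrow> norm q \<le> 1 \<longrightarrow>
        f w - g w \<ge> \<epsilon> \<longrightarrow> f p \<ge> 1 - \<delta> \<longrightarrow> g p \<ge> 1 - \<delta> \<longrightarrow> f q \<ge> 1 - \<delta> \<longrightarrow> g q \<ge> 1 - \<delta> \<longrightarrow> norm (p - q) \<le> \<epsilon>)"

lemma dual_sphere_abs_le:
  assumes S: "subspace S" and f: "f \<in> dual_sphere S" and x: "x \<in> S"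
  shows "\<bar>f x\<bar> \<le> norm x"
proof (cases "x = 0")
  case True
  have "f (0 *\<^sub>R x) = 0 * f x" using f x unfolding dual_sphere_def lin_on_def by blast
  then show ?thesis using True by simp
next
  case False
  obtain K where K: "\<And>x. x \<in> S \<Longrightarrow> \<bar>f x\<bar> \<le> K * norm x" using f by (auto simp: dual_sphere_def)
  have "\<bar>f ((1 / norm x) *\<^sub>R x)\<bar> \<le> dual_norm S f"
    unfolding dual_norm_def
  proof (rule cSUP_upper)
    show "bdd_above ((\<lambda>x. \<bar>f x\<bar>) ` {x \<in> S. norm x \<le> 1})"
    proof (rule bdd_aboveI2)
      fix y assume y: "y \<in> {x \<in> S. norm x \<le> 1}"
      then have "\<bar>f y\<bar> \<le> K * norm y" using K by simp
      also have "\<dots> \<le> \<bar>K\<bar> * 1" using y by (intro mult_mono) auto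
      finally show "\<bar>f y\<bar> \<le> \<bar>K\<bar>" by simp
    qed
  qed (use S x False in \<open>simp add: subspace_scale\<close>)
  then have "\<bar>f ((1 / norm x) *\<^sub>R x)\<bar> \<le> 1" using f by (simp add: dual_sphere_def)
  moreover have "f ((1 / norm x) *\<^sub>R x) = f x / norm x" using f x by (simp add: dual_sphere_def lin_on_def)
  ultimately show ?thesis using False by (simp add: abs_divide divide_le_eq_1)
qed

lemma noncreasy_wrt_dual_sphere:
  assumes S: "subspace S" and unc: "unif_noncreasy S"
  shows "noncreasy_wrt S (dual_sphere S)"
  unfolding noncreasy_wrt_def
proof (intro conjI ballI impI allI)
  show "subspace S" by (rule S)
  show "\<exists>f\<in>dual_sphere S. f s = norm s" if "s \<in> S" "s \<noteq> 0" for s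
    using norming_functional[OF S that] by metis
  show "lin_on S f" if "f \<in> dual_sphere S" for f using that by (simp add: dual_sphere_def)
  show "\<bar>f x\<bar> \<le> norm x" if "f \<in> dual_sphere S" "x \<in> S" for f x
    by (rule dual_sphere_abs_le[OF S that])
  fix \<epsilon> :: real assume "\<epsilon> > 0"
  then obtain \<delta> where \<delta>: "\<delta> > 0" "\<And>f g. f \<in> dual_sphere S \<Longrightarrow> g \<in> dual_sphere S \<Longrightarrow>
        dual_norm S (\<lambda>x. f x - g x) \<ge> \<epsilon> \<Longrightarrow>
        diameter {x\<in>S. norm x \<le> 1 \<and> f x \<ge> 1 - \<delta> \<and> g x \<ge> 1 - \<delta>} \<le> \<epsilon>"
    using unc unfolding unif_noncreasy_def by meson
  have "norm (p - q) \<le> \<epsilon>"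
    if fg: "f \<in> dual_sphere S" "g \<in> dual_sphere S" and w: "w \<in> S" "norm w \<le> 1" "f w - g w \<ge> \<epsilon>"
      and pq: "p \<in> S" "q \<in> S" "norm p \<le> 1" "norm q \<le> 1" "f p \<ge> 1 - \<delta>" "g p \<ge> 1 - \<delta>" "f q \<ge> 1 - \<delta>" "g q \<ge> 1 - \<delta>"
    for f g w p q
  proof -
    have "\<bar>f w - g w\<bar> \<le> dual_norm S (\<lambda>x. f x - g x)"
      unfolding dual_norm_def
    proof (rule cSUP_upper)
      show "bdd_above ((\<lambda>x. \<bar>f x - g x\<bar>) ` {x \<in> S. norm x \<le> 1})"
      proof (rule bdd_aboveI2)
        fix y assume "y \<in> {x \<in> S. norm x \<le> 1}"
        then show "\<bar>f y - g y\<bar> \<le> 2"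
          using dual_sphere_abs_le[OF S fg(1), of y] dual_sphere_abs_le[OF S fg(2), of y]
          by (simp add: abs_le_iff)
      qed
    qed (use w in simp)
    then have d: "diameter {x\<in>S. norm x \<le> 1 \<and> f x \<ge> 1 - \<delta> \<and> g x \<ge> 1 - \<delta>} \<le> \<epsilon>"
      by (intro \<delta>(2) fg) (use w in linarith)
    have "bounded {x\<in>S. norm x \<le> 1 \<and> f x \<ge> 1 - \<delta> \<and> g x \<ge> 1 - \<delta>}"
      by (rule boundedI[of _ 1]) simp
    from diameter_bounded_bound[OF this, of p q] show ?thesis using pq d by (simp add: dist_norm)
  qed
  then show "\<exists>\<delta>>0. \<forall>f\<in>dual_sphere S. \<forall>g\<in>dual_sphere S. \<forall>w\<in>S. \<forall>p\<in>S. \<forall>q\<in>S. norm w \<le> 1 \<longrightarrow> norm p \<le> 1 \<longrightarrow> norm q \<le> 1 \<longrightarrow>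
        f w - g w \<ge> \<epsilon> \<longrightarrow> f p \<ge> 1 - \<delta> \<longrightarrow> g p \<ge> 1 - \<delta> \<longrightarrow> f q \<ge> 1 - \<delta> \<longrightarrow> g q \<ge> 1 - \<delta> \<longrightarrow> norm (p - q) \<le> \<epsilon>"
    using \<delta>(1) by (intro exI[of _ \<delta>]) blast
qed

section \<open>Passage of noncreasiness to ultrapowers\<close>

definition ultra_set :: "'a::real_normed_vector set \<Rightarrow> 'a ultra set" where
  "ultra_set W = ucls ` {u. bounded (range u) \<and> (\<forall>n. u n \<in> W)}"

text \<open>The internal functionals, that is, limits along \<U> of sequences from
  \<open>\<Phi>\<close>. Values off \<open>ultra_set W\<close> are unconstrained, in keeping with
  \<open>lin_on\<close>.\<close>

definition ultra_dual :: "'a::real_normed_vector set \<Rightarrow> ('a \<Rightarrow> real) set \<Rightarrow> ('a ultra \<Rightarrow> real) set" where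
  "ultra_dual W \<Phi> = {F. \<exists>f. (\<forall>n. f n \<in> \<Phi>) \<and>
     (\<forall>u. bounded (range u) \<longrightarrow> (\<forall>n. u n \<in> W) \<longrightarrow> ((\<lambda>n. f n (u n)) \<longlongrightarrow> F (ucls u)) \<U>)}"

lemma ultra_setI: "bounded (range u) \<Longrightarrow> (\<And>n. u n \<in> W) \<Longrightarrow> ucls u \<in> ultra_set W"
  by (auto simp: ultra_set_def)

lemma ultra_setE:
  assumes "x \<in> ultra_set W"
  obtains u where "bounded (range u)" "\<And>n. u n \<in> W" "x = ucls u"
  using assms by (auto simp: ultra_set_def)

lemma subspace_ultra_set: "subspace W \<Longrightarrow> subspace (ultra_set W)"
proof (rule subspaceI)
  assume W: "subspace W"
  show "0 \<in> ultra_set W" using ultra_setI[of "\<lambda>n. 0" W] W by (simp add: subspace_0)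
  show "x + y \<in> ultra_set W" if xy: "x \<in> ultra_set W" "y \<in> ultra_set W" for x y
  proof -
    obtain u v where u: "bounded (range u)" "\<And>n. u n \<in> W" "x = ucls u"
      and v: "bounded (range v)" "\<And>n. v n \<in> W" "y = ucls v" using xy by (meson ultra_setE)
    show ?thesis unfolding u(3) v(3) ucls_plus[OF u(1) v(1), symmetric]
      by (intro ultra_setI bounded_range_plus u v subspace_add W)
  qed
  show "c *\<^sub>R x \<in> ultra_set W" if x: "x \<in> ultra_set W" for c x
  proof -
    obtain u where u: "bounded (range u)" "\<And>n. u n \<in> W" "x = ucls u" using x by (meson ultra_setE)
    show ?thesis unfolding u(3) ucls_scaleR[OF u(1), symmetric]
      by (intro ultra_setI bounded_range_scaleR u subspace_scale W)
  qed
qed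

text \<open>Slices are cut from the unit ball, so representatives must lie in the ball at every
  index and not just in the limit. Dividing by \<open>max 1 (norm (v n))\<close> moves
  \<open>v n\<close> by at most \<open>max 1 (norm (v n)) - 1\<close>, which tends to 0.\<close>

lemma ultra_set_unit_rep:
  assumes W: "subspace W" and x: "x \<in> ultra_set W" "norm x \<le> 1"
  obtains u where "bounded (range u)" "\<And>n. u n \<in> W" "\<And>n. norm (u n) \<le> 1" "x = ucls u"
proof -
  obtain v where v: "bounded (range v)" "\<And>n. v n \<in> W" "x = ucls v" using x by (meson ultra_setE)
  define u where "u n = (1 / max 1 (norm (v n))) *\<^sub>R v n" for n
  have nu: "norm (u n) \<le> 1" for n by (auto simp: u_def max_def)
  then have bu: "bounded (range u)" by (auto simp: bounded_iff)
  have lim: "((\<lambda>n. max 1 (norm (v n)) - 1) \<longlongrightarrow> max 1 (norm x) - 1) \<U>"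
    unfolding v(3) by (intro tendsto_intros tendsto_max ucls_norm v)
  have diff: "norm (v n - u n) \<le> max 1 (norm (v n)) - 1" for n
  proof -
    have "v n - u n = (1 - 1 / max 1 (norm (v n))) *\<^sub>R v n" by (simp add: u_def algebra_simps)
    then have "norm (v n - u n) = \<bar>1 - 1 / max 1 (norm (v n))\<bar> * norm (v n)" by simp
    also have "\<dots> \<le> max 1 (norm (v n)) - 1"
    proof (cases "norm (v n) \<le> 1")
      case False
      then have "\<bar>1 - 1 / norm (v n)\<bar> = 1 - 1 / norm (v n)"
        by (intro abs_of_nonneg) (simp add: divide_le_eq_1)
      then show ?thesis using False by (auto simp: max_def left_diff_distrib)
    qed (simp add: max_def)
    finally show ?thesis .
  qed
  have "((\<lambda>n. norm (v n - u n)) \<longlongrightarrow> 0) \<U>"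
    by (rule Lim_null_comparison[where g = "\<lambda>n. max 1 (norm (v n)) - 1"])
       (use diff lim x(2) in \<open>simp_all add: max_absorb1\<close>)
  then have "x = ucls u" unfolding v(3) ucls_eq_iff[OF v(1) bu] .
  moreover have "u n \<in> W" for n unfolding u_def by (intro subspace_scale W v)
  ultimately show thesis using that bu nu by blast
qed

lemma noncreasy_wrt_ultra:
  assumes nc: "noncreasy_wrt W \<Phi>"
  shows "noncreasy_wrt (ultra_set W) (ultra_dual W \<Phi>)"
  unfolding noncreasy_wrt_def
proof (intro conjI ballI impI allI)
  have W: "subspace W" and lin: "\<And>f. f \<in> \<Phi> \<Longrightarrow> lin_on W f"
    and ab: "\<And>f x. f \<in> \<Phi> \<Longrightarrow> x \<in> W \<Longrightarrow> \<bar>f x\<bar> \<le> norm x"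
    and nm: "\<And>s. s \<in> W \<Longrightarrow> s \<noteq> 0 \<Longrightarrow> \<exists>f\<in>\<Phi>. f s = norm s"
    using nc by (auto simp: noncreasy_wrt_def)
  show "subspace (ultra_set W)" by (rule subspace_ultra_set[OF W])
  {
    fix F assume "F \<in> ultra_dual W \<Phi>"
    then obtain f where f: "\<And>n. f n \<in> \<Phi>"
      "\<And>u. bounded (range u) \<Longrightarrow> (\<And>n. u n \<in> W) \<Longrightarrow> ((\<lambda>n. f n (u n)) \<longlongrightarrow> F (ucls u)) \<U>"
      by (auto simp: ultra_dual_def)
    show "lin_on (ultra_set W) F"
      unfolding lin_on_def
    proof (intro conjI ballI allI)
      fix x y assume xy: "x \<in> ultra_set W" "y \<in> ultra_set W"
      obtain u v where u: "bounded (range u)" "\<And>n. u n \<in> W" "x = ucls u"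
        and v: "bounded (range v)" "\<And>n. v n \<in> W" "y = ucls v" using xy by (meson ultra_setE)
      have uv: "u n + v n \<in> W" for n by (intro subspace_add W u v)
      have "((\<lambda>n. f n (u n + v n)) \<longlongrightarrow> F (x + y)) \<U>"
        using f(2)[OF bounded_range_plus[OF u(1) v(1)] uv] by (simp add: ucls_plus u v)
      moreover have "((\<lambda>n. f n (u n + v n)) \<longlongrightarrow> F x + F y) \<U>"
        using tendsto_add[OF f(2)[OF u(1,2)] f(2)[OF v(1,2)]] lin[OF f(1)] u v
        by (simp add: lin_on_def)
      ultimately show "F (x + y) = F x + F y" by (rule tendsto_unique[OF freeuf_bot])
    next
      fix c x assume x: "x \<in> ultra_set W"
      obtain u where u: "bounded (range u)" "\<And>n. u n \<in> W" "x = ucls u" using x by (meson ultra_setE)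
      have cu: "c *\<^sub>R u n \<in> W" for n by (intro subspace_scale W u)
      have "((\<lambda>n. f n (c *\<^sub>R u n)) \<longlongrightarrow> F (c *\<^sub>R x)) \<U>"
        using f(2)[OF bounded_range_scaleR[OF u(1)] cu] by (simp add: ucls_scaleR u)
      moreover have "((\<lambda>n. f n (c *\<^sub>R u n)) \<longlongrightarrow> c * F x) \<U>"
        using tendsto_mult[OF tendsto_const[of c] f(2)[OF u(1,2)]] lin[OF f(1)] u by (simp add: lin_on_def)
      ultimately show "F (c *\<^sub>R x) = c * F x" by (rule tendsto_unique[OF freeuf_bot])
    qed
    show "\<bar>F x\<bar> \<le> norm x" if x: "x \<in> ultra_set W" for x
    proof -
      obtain u where u: "bounded (range u)" "\<And>n. u n \<in> W" "x = ucls u" using x by (meson ultra_setE)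
      show ?thesis unfolding u(3)
        by (rule tendsto_le[OF freeuf_bot ucls_norm[OF u(1)] tendsto_rabs[OF f(2)[OF u(1,2)]]])
           (auto intro!: always_eventually ab f u)
    qed
  }
  show "\<exists>F\<in>ultra_dual W \<Phi>. F s = norm s" if s: "s \<in> ultra_set W" "s \<noteq> 0" for s
  proof -
    obtain u where u: "bounded (range u)" "\<And>n. u n \<in> W" "s = ucls u" using s(1) by (meson ultra_setE)
    have pos: "eventually (\<lambda>n. norm (u n) > 0) \<U>"
      using order_tendstoD(1)[OF ucls_norm[OF u(1)], of 0] s(2) u(3) by simp
    then obtain n0 where "norm (u n0) > 0" using eventually_happens'[OF freeuf_bot] by blast
    then obtain f0 where f0: "f0 \<in> \<Phi>" using nm[OF u(2), of n0] by auto
    \<comment> \<open>Norming functionals are chosen index by index, with \<open>f0\<close> filling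
      the indices where \<open>u n = 0\<close>.\<close>
    have "\<exists>f. \<forall>n. f n \<in> \<Phi> \<and> (u n \<noteq> 0 \<longrightarrow> f n (u n) = norm (u n))"
      by (intro choice allI) (use f0 nm u(2) in metis)
    then obtain f where f: "\<And>n. f n \<in> \<Phi>" "\<And>n. u n \<noteq> 0 \<Longrightarrow> f n (u n) = norm (u n)" by blast
    \<comment> \<open>\<open>F\<close> has to be a function of classes: a representative is fixed
      first, and \<open>FF\<close> shows that every other one gives the same limit.\<close>
    define r where "r x = (SOME v. bounded (range v) \<and> (\<forall>n. v n \<in> W) \<and> x = ucls v)" for x
    define F where "F x = Lim \<U> (\<lambda>n. f n (r x n))" for x
    have FF: "((\<lambda>n. f n (v n)) \<longlongrightarrow> F (ucls v)) \<U>" if v: "bounded (range v)" "\<And>n. v n \<in> W" for v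
    proof -
      have "\<exists>v'. bounded (range v') \<and> (\<forall>n. v' n \<in> W) \<and> ucls v = ucls v'" using v by blast
      from someI_ex[OF this] have r: "bounded (range (r (ucls v)))" "\<And>n. r (ucls v) n \<in> W"
        "ucls v = ucls (r (ucls v))" by (auto simp: r_def)
      have "bounded (range (\<lambda>n. f n (r (ucls v) n)))"
      proof -
        obtain B where "\<And>n. norm (r (ucls v) n) \<le> B" using r(1) by (auto simp: bounded_iff)
        then have "\<bar>f n (r (ucls v) n)\<bar> \<le> B" for n using ab[OF f(1) r(2)] by (meson order_trans)
        then show ?thesis by (auto simp: bounded_iff)
      qed
      then have 1: "((\<lambda>n. f n (r (ucls v) n)) \<longlongrightarrow> F (ucls v)) \<U>" unfolding F_def by (rule freeuf_Lim)
      have "((\<lambda>n. norm (v n - r (ucls v) n)) \<longlongrightarrow> 0) \<U>"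
        using r(3) ucls_eq_iff[OF v(1) r(1)] by blast
      then have 2: "((\<lambda>n. f n (v n - r (ucls v) n)) \<longlongrightarrow> 0) \<U>"
        by (rule Lim_null_comparison[rotated]) (auto intro!: always_eventually ab f v r subspace_diff W)
      have "f n (v n) = f n (v n - r (ucls v) n) + f n (r (ucls v) n)" for n
        using lin[OF f(1), of n] v(2) r(2) W subspace_diff[OF W v(2) r(2), of n n]
        unfolding lin_on_def by (metis diff_add_cancel)
      then show ?thesis using tendsto_add[OF 2 1] by simp
    qed
    then have "F \<in> ultra_dual W \<Phi>" unfolding ultra_dual_def using f(1) by blast
    moreover have "((\<lambda>n. f n (u n)) \<longlongrightarrow> norm s) \<U>"
      using ucls_norm[OF u(1)] unfolding u(3)
      by (rule Lim_transform_eventually) (use pos in \<open>auto elim!: eventually_mono simp: f(2)\<close>)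
    then have "F s = norm s" using FF[OF u(1,2)] unfolding u(3) by (rule tendsto_unique[OF freeuf_bot, rotated])
    ultimately show ?thesis by blast
  qed
  fix \<epsilon> :: real assume "\<epsilon> > 0"
  \<comment> \<open>An inequality between limits holds at the indices only with some loss. Halving
    \<open>\<epsilon>\<close> for the separation and \<open>\<delta>\<close> for the slices leaves
    room for it.\<close>
  then have "\<epsilon> / 2 > 0" by simp
  then obtain \<delta> where \<delta>: "\<delta> > 0" "\<And>f g w p q. f \<in> \<Phi> \<Longrightarrow> g \<in> \<Phi> \<Longrightarrow> w \<in> W \<Longrightarrow> p \<in> W \<Longrightarrow> q \<in> W \<Longrightarrow>
        norm w \<le> 1 \<Longrightarrow> norm p \<le> 1 \<Longrightarrow> norm q \<le> 1 \<Longrightarrow>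
        f w - g w \<ge> \<epsilon> / 2 \<Longrightarrow> f p \<ge> 1 - \<delta> \<Longrightarrow> g p \<ge> 1 - \<delta> \<Longrightarrow> f q \<ge> 1 - \<delta> \<Longrightarrow> g q \<ge> 1 - \<delta> \<Longrightarrow> norm (p - q) \<le> \<epsilon> / 2"
    using nc unfolding noncreasy_wrt_def by meson
  have main: "norm (p - q) \<le> \<epsilon>"
    if FG: "F \<in> ultra_dual W \<Phi>" "G \<in> ultra_dual W \<Phi>" and mem: "w \<in> ultra_set W" "p \<in> ultra_set W" "q \<in> ultra_set W"
      and le: "norm w \<le> 1" "norm p \<le> 1" "norm q \<le> 1" and wd: "F w - G w \<ge> \<epsilon>"
      and sl: "F p \<ge> 1 - \<delta> / 2" "G p \<ge> 1 - \<delta> / 2" "F q \<ge> 1 - \<delta> / 2" "G q \<ge> 1 - \<delta> / 2" for F G w p q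
  proof -
    obtain f where f: "\<And>n. f n \<in> \<Phi>"
      "\<And>u. bounded (range u) \<Longrightarrow> (\<And>n. u n \<in> W) \<Longrightarrow> ((\<lambda>n. f n (u n)) \<longlongrightarrow> F (ucls u)) \<U>"
      using FG(1) by (auto simp: ultra_dual_def)
    obtain g where g: "\<And>n. g n \<in> \<Phi>"
      "\<And>u. bounded (range u) \<Longrightarrow> (\<And>n. u n \<in> W) \<Longrightarrow> ((\<lambda>n. g n (u n)) \<longlongrightarrow> G (ucls u)) \<U>"
      using FG(2) by (auto simp: ultra_dual_def)
    obtain w' where w': "bounded (range w')" "\<And>n. w' n \<in> W" "\<And>n. norm (w' n) \<le> 1" "w = ucls w'"
      using ultra_set_unit_rep[OF W mem(1) le(1)] by blast
    obtain p' where p': "bounded (range p')" "\<And>n. p' n \<in> W" "\<And>n. norm (p' n) \<le> 1" "p = ucls p'"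
      using ultra_set_unit_rep[OF W mem(2) le(2)] by blast
    obtain q' where q': "bounded (range q')" "\<And>n. q' n \<in> W" "\<And>n. norm (q' n) \<le> 1" "q = ucls q'"
      using ultra_set_unit_rep[OF W mem(3) le(3)] by blast
    have lw: "((\<lambda>n. f n (w' n) - g n (w' n)) \<longlongrightarrow> F w - G w) \<U>"
      unfolding w'(4) by (intro tendsto_diff f(2) g(2) w')
    have "eventually (\<lambda>n. f n (w' n) - g n (w' n) > \<epsilon> / 2) \<U>"
      by (rule order_tendstoD(1)[OF lw]) (use wd \<open>\<epsilon> > 0\<close> in linarith)
    moreover have "eventually (\<lambda>n. f n (p' n) > 1 - \<delta>) \<U>"
      by (rule order_tendstoD(1)[OF f(2)[OF p'(1,2)]]) (use sl \<delta>(1) p'(4) in simp)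
    moreover have "eventually (\<lambda>n. g n (p' n) > 1 - \<delta>) \<U>"
      by (rule order_tendstoD(1)[OF g(2)[OF p'(1,2)]]) (use sl \<delta>(1) p'(4) in simp)
    moreover have "eventually (\<lambda>n. f n (q' n) > 1 - \<delta>) \<U>"
      by (rule order_tendstoD(1)[OF f(2)[OF q'(1,2)]]) (use sl \<delta>(1) q'(4) in simp)
    moreover have "eventually (\<lambda>n. g n (q' n) > 1 - \<delta>) \<U>"
      by (rule order_tendstoD(1)[OF g(2)[OF q'(1,2)]]) (use sl \<delta>(1) q'(4) in simp)
    ultimately have "eventually (\<lambda>n. norm (p' n - q' n) \<le> \<epsilon> / 2) \<U>"
    proof eventually_elim
      case (elim n)
      then show ?case by (intro \<delta>(2)[of "f n" "g n" "w' n"]) (simp_all add: f g w' p' q')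
    qed
    then have "norm (p - q) \<le> \<epsilon> / 2" unfolding p'(4) q'(4)
      by (rule tendsto_upperbound[OF ucls_dist[OF p'(1) q'(1)] _ freeuf_bot])
    then show ?thesis using \<open>\<epsilon> > 0\<close> by linarith
  qed
  show "\<exists>\<delta>>0. \<forall>f\<in>ultra_dual W \<Phi>. \<forall>g\<in>ultra_dual W \<Phi>. \<forall>w\<in>ultra_set W. \<forall>p\<in>ultra_set W. \<forall>q\<in>ultra_set W.
      norm w \<le> 1 \<longrightarrow> norm p \<le> 1 \<longrightarrow> norm q \<le> 1 \<longrightarrow> f w - g w \<ge> \<epsilon> \<longrightarrow>
      f p \<ge> 1 - \<delta> \<longrightarrow> g p \<ge> 1 - \<delta> \<longrightarrow> f q \<ge> 1 - \<delta> \<longrightarrow> g q \<ge> 1 - \<delta> \<longrightarrow> norm (p - q) \<le> \<epsilon>"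
    using \<delta>(1) main by (intro exI[of _ "\<delta> / 2"]) simp
qed

section \<open>Finite representability and embeddings into ultrapowers\<close>

lemma bounded_range_sum:
  fixes u :: "'b \<Rightarrow> nat \<Rightarrow> 'a::real_normed_vector"
  assumes "finite B" "\<And>b. b \<in> B \<Longrightarrow> bounded (range (u b))"
  shows "bounded (range (\<lambda>n. \<Sum>b\<in>B. a b *\<^sub>R u b n))"
  using assms
proof (induction B)
  case (insert x B)
  have "bounded (range (\<lambda>n. a x *\<^sub>R u x n + (\<Sum>b\<in>B. a b *\<^sub>R u b n)))"
    by (intro bounded_range_plus bounded_range_scaleR insert) auto
  then show ?case using insert.hyps by simp
qed simp

lemma ucls_sum:
  fixes u :: "'b \<Rightarrow> nat \<Rightarrow> 'a::real_normed_vector"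
  assumes "finite B" "\<And>b. b \<in> B \<Longrightarrow> bounded (range (u b))"
  shows "ucls (\<lambda>n. \<Sum>b\<in>B. a b *\<^sub>R u b n) = (\<Sum>b\<in>B. a b *\<^sub>R ucls (u b))"
  using assms
proof (induction B)
  case (insert x B)
  have "ucls (\<lambda>n. a x *\<^sub>R u x n + (\<Sum>b\<in>B. a b *\<^sub>R u b n)) = a x *\<^sub>R ucls (u x) + (\<Sum>b\<in>B. a b *\<^sub>R ucls (u b))"
    using insert by (subst ucls_plus) (auto intro!: bounded_range_scaleR bounded_range_sum simp: ucls_scaleR)
  then show ?case using insert.hyps by simp
qed simp

text \<open>For fixed coefficients this is the definition of the norm; the point is uniformity.
  Violating coefficients, scaled to absolute sum 1, have a limit \<open>l\<close> along \<U>.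
  Independence of \<open>B\<close> makes \<open>v \<noteq> 0\<close>, while both norms tend to
  \<open>norm v\<close>, so the limit of the violated bound reads
  \<open>e * norm v \<le> 0\<close>.\<close>

lemma ultra_almost_isometric:
  fixes u :: "'a ultra \<Rightarrow> nat \<Rightarrow> 'a::real_normed_vector" and B :: "'a ultra set"
  assumes B: "finite B" "independent B" and u: "\<And>b. bounded (range (u b))" "\<And>b. b \<in> B \<Longrightarrow> ucls (u b) = b"
    and e: "e > 0"
  shows "eventually (\<lambda>n. \<forall>a. \<bar>norm (\<Sum>b\<in>B. a b *\<^sub>R u b n) - norm (\<Sum>b\<in>B. a b *\<^sub>R b)\<bar>
     \<le> e * norm (\<Sum>b\<in>B. a b *\<^sub>R b)) \<U>"
proof (rule ccontr)
  assume "\<not> ?thesis"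
  then have bad: "eventually (\<lambda>n. \<exists>a. e * norm (\<Sum>b\<in>B. a b *\<^sub>R b) <
      \<bar>norm (\<Sum>b\<in>B. a b *\<^sub>R u b n) - norm (\<Sum>b\<in>B. a b *\<^sub>R b)\<bar>) \<U>"
    by (simp add: not_eventually_freeuf not_le)
  have norm_sum1: "\<exists>a. (\<Sum>b\<in>B. \<bar>a b\<bar>) = 1 \<and> e * norm (\<Sum>b\<in>B. a b *\<^sub>R b) <
      \<bar>norm (\<Sum>b\<in>B. a b *\<^sub>R u b n) - norm (\<Sum>b\<in>B. a b *\<^sub>R b)\<bar>"
    if a: "e * norm (\<Sum>b\<in>B. a b *\<^sub>R b) < \<bar>norm (\<Sum>b\<in>B. a b *\<^sub>R u b n) - norm (\<Sum>b\<in>B. a b *\<^sub>R b)\<bar>" for a n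
  proof -
    define s where "s = (\<Sum>b\<in>B. \<bar>a b\<bar>)"
    have "s \<noteq> 0"
    proof
      assume "s = 0"
      then have "\<forall>b\<in>B. a b = 0" using B(1) by (simp add: s_def sum_nonneg_eq_0_iff)
      then show False using a by simp
    qed
    moreover have "s \<ge> 0" by (simp add: s_def sum_nonneg)
    ultimately have s: "s > 0" by simp
    have sc: "(\<Sum>b\<in>B. (a b / s) *\<^sub>R v b) = (1 / s) *\<^sub>R (\<Sum>b\<in>B. a b *\<^sub>R v b)" for v :: "_ \<Rightarrow> 'z::real_vector"
      by (simp add: scaleR_sum_right)
    have "(\<Sum>b\<in>B. \<bar>a b / s\<bar>) = 1" using s by (simp add: s_def[symmetric] sum_divide_distrib[symmetric])
    moreover have "e * norm (\<Sum>b\<in>B. (a b / s) *\<^sub>R b) <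
      \<bar>norm (\<Sum>b\<in>B. (a b / s) *\<^sub>R u b n) - norm (\<Sum>b\<in>B. (a b / s) *\<^sub>R b)\<bar>"
      using a s by (simp add: sc diff_divide_distrib[symmetric] abs_divide divide_strict_right_mono)
    ultimately show ?thesis by (intro exI[of _ "\<lambda>b. a b / s"]) simp
  qed
  define P where "P n a \<longleftrightarrow> (\<Sum>b\<in>B. \<bar>a b\<bar>) = 1 \<and> e * norm (\<Sum>b\<in>B. a b *\<^sub>R b) <
      \<bar>norm (\<Sum>b\<in>B. a b *\<^sub>R u b n) - norm (\<Sum>b\<in>B. a b *\<^sub>R b)\<bar>" for n a
  \<comment> \<open>Zero where no violation exists, so that the coefficients are bounded at all
    indices.\<close>
  define A where "A n = (if \<exists>a. P n a then SOME a. P n a else (\<lambda>_. 0))" for n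
  have PA: "eventually (\<lambda>n. P n (A n)) \<U>"
    using bad
  proof (rule eventually_mono)
    fix n assume "\<exists>a. e * norm (\<Sum>b\<in>B. a b *\<^sub>R b) < \<bar>norm (\<Sum>b\<in>B. a b *\<^sub>R u b n) - norm (\<Sum>b\<in>B. a b *\<^sub>R b)\<bar>"
    then have "\<exists>a. P n a" unfolding P_def using norm_sum1 by blast
    then show "P n (A n)" by (simp add: A_def someI_ex)
  qed
  have "\<bar>A n b\<bar> \<le> 1" if "b \<in> B" for n b
  proof (cases "\<exists>a. P n a")
    case True
    then have "P n (A n)" by (simp add: A_def someI_ex)
    then show ?thesis using member_le_sum[OF that, of "\<lambda>b. \<bar>A n b\<bar>"] B(1) by (simp add: P_def)
  qed (simp add: A_def)
  then have "bounded (range (\<lambda>n. A n b))" if "b \<in> B" for b using that by (auto simp: bounded_iff)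
  then have lim: "((\<lambda>n. A n b) \<longlongrightarrow> Lim \<U> (\<lambda>n. A n b)) \<U>" if "b \<in> B" for b
    using that by (intro freeuf_Lim)
  define l where "l b = Lim \<U> (\<lambda>n. A n b)" for b
  note lim = lim[folded l_def]
  define v where "v = (\<Sum>b\<in>B. l b *\<^sub>R b)"
  have sum1: "(\<Sum>b\<in>B. \<bar>l b\<bar>) = 1"
  proof (rule tendsto_unique[OF freeuf_bot])
    show "((\<lambda>n. \<Sum>b\<in>B. \<bar>A n b\<bar>) \<longlongrightarrow> (\<Sum>b\<in>B. \<bar>l b\<bar>)) \<U>" by (intro tendsto_intros lim)
    show "((\<lambda>n. \<Sum>b\<in>B. \<bar>A n b\<bar>) \<longlongrightarrow> 1) \<U>"
      by (rule tendsto_eventually) (use PA in \<open>auto simp: P_def elim: eventually_mono\<close>)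
  qed
  have "v \<noteq> 0"
  proof
    assume "v = 0"
    then have "\<forall>b\<in>B. l b = 0" using B unfolding v_def by (auto dest: independentD)
    then show False using sum1 by simp
  qed
  have t1: "((\<lambda>n. norm (\<Sum>b\<in>B. A n b *\<^sub>R b)) \<longlongrightarrow> norm v) \<U>"
    unfolding v_def by (intro tendsto_intros lim)
  have "((\<lambda>n. norm (\<Sum>b\<in>B. l b *\<^sub>R u b n)) \<longlongrightarrow> norm (ucls (\<lambda>n. \<Sum>b\<in>B. l b *\<^sub>R u b n))) \<U>"
    by (intro ucls_norm bounded_range_sum B u)
  then have t2: "((\<lambda>n. norm (\<Sum>b\<in>B. l b *\<^sub>R u b n)) \<longlongrightarrow> norm v) \<U>"
    using B u by (simp add: ucls_sum v_def)
  have "((\<lambda>n. \<Sum>b\<in>B. (A n b - l b) *\<^sub>R u b n) \<longlongrightarrow> (\<Sum>b\<in>B. 0)) \<U>"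
  proof (rule tendsto_sum)
    fix b assume b: "b \<in> B"
    obtain K where K: "\<And>n. norm (u b n) \<le> K" using u(1)[of b] by (auto simp: bounded_iff)
    have "((\<lambda>n. \<bar>A n b - l b\<bar> * K) \<longlongrightarrow> \<bar>l b - l b\<bar> * K) \<U>" by (intro tendsto_intros lim b)
    then have "((\<lambda>n. \<bar>A n b - l b\<bar> * K) \<longlongrightarrow> 0) \<U>" by simp
    then show "((\<lambda>n. (A n b - l b) *\<^sub>R u b n) \<longlongrightarrow> 0) \<U>"
      by (rule Lim_null_comparison[rotated]) (auto intro!: always_eventually mult_left_mono K)
  qed
  then have t3: "((\<lambda>n. \<Sum>b\<in>B. (A n b - l b) *\<^sub>R u b n) \<longlongrightarrow> 0) \<U>" by simp
  have "((\<lambda>n. norm (\<Sum>b\<in>B. A n b *\<^sub>R u b n) - norm (\<Sum>b\<in>B. l b *\<^sub>R u b n)) \<longlongrightarrow> 0) \<U>"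
  proof (rule Lim_null_comparison[OF _ tendsto_norm_zero[OF t3]], intro always_eventually allI)
    fix n
    have "(\<Sum>b\<in>B. A n b *\<^sub>R u b n) - (\<Sum>b\<in>B. l b *\<^sub>R u b n) = (\<Sum>b\<in>B. (A n b - l b) *\<^sub>R u b n)"
      by (simp add: sum_subtractf[symmetric] scaleR_diff_left)
    then show "norm (norm (\<Sum>b\<in>B. A n b *\<^sub>R u b n) - norm (\<Sum>b\<in>B. l b *\<^sub>R u b n))
        \<le> norm (\<Sum>b\<in>B. (A n b - l b) *\<^sub>R u b n)"
      using norm_triangle_ineq3[of "\<Sum>b\<in>B. A n b *\<^sub>R u b n" "\<Sum>b\<in>B. l b *\<^sub>R u b n"] by simp
  qed
  from tendsto_add[OF this t2] have t4: "((\<lambda>n. norm (\<Sum>b\<in>B. A n b *\<^sub>R u b n)) \<longlongrightarrow> norm v) \<U>" by simp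
  have "e * norm v \<le> \<bar>norm v - norm v\<bar>"
    by (rule tendsto_le[OF freeuf_bot tendsto_rabs[OF tendsto_diff[OF t4 t1]] tendsto_mult[OF tendsto_const t1]])
       (use PA in \<open>auto simp: P_def elim: eventually_mono\<close>)
  then show False using e \<open>v \<noteq> 0\<close> by (simp add: mult_le_0_iff)
qed

lemma fin_repD:
  fixes B :: "'y::real_normed_vector set"
  assumes "fin_rep TYPE('y) V N" "finite B" "\<epsilon> > 0"
  shows "\<exists>T. (\<forall>x\<in>span B. T x \<in> V) \<and> (\<forall>x\<in>span B. \<forall>y\<in>span B. T (x + y) = T x + T y) \<and>
        (\<forall>c. \<forall>x\<in>span B. T (c *\<^sub>R x) = c *\<^sub>R T x) \<and>
        (\<forall>x\<in>span B. norm x \<le> N (T x) \<and> N (T x) \<le> (1 + \<epsilon>) * norm x)"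
  using assms by (simp add: fin_rep_def)

text \<open>An almost isometry of a finite-dimensional subspace into the space itself, read off at a
  single index \<open>n\<close>, is followed by one into the direct sum.\<close>

lemma fin_rep_ultra:
  assumes fr: "fin_rep TYPE('y::real_normed_vector) V N"
  shows "fin_rep TYPE('y ultra) V N"
  unfolding fin_rep_def
proof (intro allI impI)
  fix B0 :: "'y ultra set" and \<epsilon> :: real assume B0: "finite B0" and "\<epsilon> > 0"
  obtain B where B: "B \<subseteq> B0" "independent B" "B0 \<subseteq> span B"
    using maximal_independent_subset[of B0] by blast
  have fB: "finite B" using B B0 finite_subset by blast
  have sp: "span B0 = span B" using B by (metis span_mono span_span subset_antisym)
  \<comment> \<open>The two distortions and the rescaling in \<open>L\<close> multiply to
    \<open>(1 + \<eta>) * (1 + \<eta>) / (1 - \<eta>)\<close>, which has to stay below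
    \<open>1 + \<epsilon>\<close>.\<close>
  have "((\<lambda>\<eta>::real. (1 + \<eta>) * (1 + \<eta>) / (1 - \<eta>)) \<longlongrightarrow> (1 + 0) * (1 + 0) / (1 - 0)) (at_right 0)"
    by (intro tendsto_intros) auto
  then have "eventually (\<lambda>\<eta>::real. (1 + \<eta>) * (1 + \<eta>) / (1 - \<eta>) < 1 + \<epsilon>) (at_right 0)"
    by (rule order_tendstoD) (use \<open>\<epsilon> > 0\<close> in simp)
  moreover have "eventually (\<lambda>\<eta>::real. \<eta> \<in> {0<..<1}) (at_right 0)" by (rule eventually_at_right_real) simp
  ultimately have "eventually (\<lambda>\<eta>::real. (1 + \<eta>) * (1 + \<eta>) / (1 - \<eta>) < 1 + \<epsilon> \<and> \<eta> \<in> {0<..<1}) (at_right 0)"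
    by (rule eventually_conj)
  then have "\<exists>\<eta>::real. (1 + \<eta>) * (1 + \<eta>) / (1 - \<eta>) < 1 + \<epsilon> \<and> \<eta> \<in> {0<..<1}"
    by (rule eventually_happens'[OF trivial_limit_at_right_real])
  then obtain \<eta> :: real where \<eta>: "0 < \<eta>" "\<eta> < 1" "(1 + \<eta>) * (1 + \<eta>) / (1 - \<eta>) < 1 + \<epsilon>"
    by auto
  have "\<exists>u. \<forall>b. bounded (range (u b)) \<and> b = ucls (u b)" by (intro choice allI) (meson ucls_cases)
  then obtain u :: "'y ultra \<Rightarrow> nat \<Rightarrow> 'y" where u: "\<And>b. bounded (range (u b))" "\<And>b. ucls (u b) = b" by metis
  obtain n where n: "\<And>a. \<bar>norm (\<Sum>b\<in>B. a b *\<^sub>R u b n) - norm (\<Sum>b\<in>B. a b *\<^sub>R b)\<bar> \<le> \<eta> * norm (\<Sum>b\<in>B. a b *\<^sub>R b)"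
    using eventually_happens'[OF freeuf_bot ultra_almost_isometric[OF fB B(2) u(1) u(2) \<eta>(1)]] by blast
  \<comment> \<open>\<open>fin_rep\<close> demands that norms do not decrease; the factor
    \<open>1 / (1 - \<eta>)\<close> compensates the contraction that
    \<open>ultra_almost_isometric\<close> allows.\<close>
  define L where "L x = (1 / (1 - \<eta>)) *\<^sub>R (\<Sum>b\<in>B. representation B x b *\<^sub>R u b n)" for x
  have Ladd: "L (x + y) = L x + L y" if "x \<in> span B" "y \<in> span B" for x y
    using that B(2) by (simp add: L_def representation_add scaleR_add_left sum.distrib scaleR_add_right)
  have Lscale: "L (c *\<^sub>R x) = c *\<^sub>R L x" if "x \<in> span B" for c x
    using that B(2) by (simp add: L_def representation_scale scaleR_sum_right mult.assoc mult.left_commute)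
  have Lin: "L x \<in> span ((\<lambda>b. u b n) ` B)" for x
    unfolding L_def by (intro span_scale span_sum span_base) auto
  have Lnorm: "norm x \<le> norm (L x)" "norm (L x) \<le> (1 + \<eta>) / (1 - \<eta>) * norm x" if x: "x \<in> span B" for x
  proof -
    have "(\<Sum>b\<in>B. representation B x b *\<^sub>R b) = x"
      by (rule sum_representation_eq[OF B(2) x fB]) simp
    with n[of "representation B x"] have 1: "\<bar>(1 - \<eta>) * norm (L x) - norm x\<bar> \<le> \<eta> * norm x"
      using \<eta> by (simp add: L_def)
    then have "(1 - \<eta>) * norm x \<le> (1 - \<eta>) * norm (L x)" by (simp add: algebra_simps abs_le_iff)
    then show "norm x \<le> norm (L x)" using \<eta> by simp
    from 1 have "(1 - \<eta>) * norm (L x) \<le> (1 + \<eta>) * norm x" by (simp add: algebra_simps abs_le_iff)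
    then show "norm (L x) \<le> (1 + \<eta>) / (1 - \<eta>) * norm x" using \<eta> by (simp add: field_simps)
  qed
  let ?E = "span ((\<lambda>b. u b n) ` B)"
  obtain T where TQ: "(\<forall>x\<in>?E. T x \<in> V) \<and> (\<forall>x\<in>?E. \<forall>y\<in>?E. T (x + y) = T x + T y) \<and>
      (\<forall>c. \<forall>x\<in>?E. T (c *\<^sub>R x) = c *\<^sub>R T x) \<and>
      (\<forall>x\<in>?E. norm x \<le> N (T x) \<and> N (T x) \<le> (1 + \<eta>) * norm x)"
    using fin_repD[OF fr finite_imageI[OF fB, of "\<lambda>b. u b n"] \<eta>(1)] ..
  then have T: "\<And>x. x \<in> ?E \<Longrightarrow> T x \<in> V"
    "\<And>x y. x \<in> ?E \<Longrightarrow> y \<in> ?E \<Longrightarrow> T (x + y) = T x + T y"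
    "\<And>c x. x \<in> ?E \<Longrightarrow> T (c *\<^sub>R x) = c *\<^sub>R T x"
    "\<And>x. x \<in> ?E \<Longrightarrow> norm x \<le> N (T x)"
    "\<And>x. x \<in> ?E \<Longrightarrow> N (T x) \<le> (1 + \<eta>) * norm x"
    by simp_all
  show "\<exists>T. (\<forall>x\<in>span B0. T x \<in> V) \<and> (\<forall>x\<in>span B0. \<forall>y\<in>span B0. T (x + y) = T x + T y) \<and>
        (\<forall>c. \<forall>x\<in>span B0. T (c *\<^sub>R x) = c *\<^sub>R T x) \<and>
        (\<forall>x\<in>span B0. norm x \<le> N (T x) \<and> N (T x) \<le> (1 + \<epsilon>) * norm x)"
    unfolding sp
  proof (intro exI[of _ "\<lambda>x. T (L x)"] conjI ballI allI)
    fix x assume x: "x \<in> span B"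
    show "norm x \<le> N (T (L x))" using Lnorm(1)[OF x] T(4)[OF Lin[of x]] by linarith
    have "N (T (L x)) \<le> (1 + \<eta>) * norm (L x)" by (rule T(5)[OF Lin])
    also have "\<dots> \<le> (1 + \<eta>) * ((1 + \<eta>) / (1 - \<eta>) * norm x)"
      using Lnorm(2)[OF x] \<eta> by (intro mult_left_mono) auto
    also have "\<dots> = (1 + \<eta>) * (1 + \<eta>) / (1 - \<eta>) * norm x" by simp
    also have "\<dots> \<le> (1 + \<epsilon>) * norm x" using \<eta> by (intro mult_right_mono) auto
    finally show "N (T (L x)) \<le> (1 + \<epsilon>) * norm x" .
  qed (simp_all add: Ladd Lscale T Lin)
qed

section \<open>Strictly monotone absolute norms, and embeddings of separable subspaces\<close>

locale strict_psi =
  fixes \<psi> :: "real^'r::finite \<Rightarrow> real"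
  assumes nf: "is_norm_fn \<psi>" and abso: "absolute_norm \<psi>" and nrm: "normalized_norm \<psi>"
    and smono: "strictly_monotone_norm \<psi>"
begin

lemma psi_scale: "\<psi> (c *\<^sub>R x) = \<bar>c\<bar> * \<psi> x" using nf by (simp add: is_norm_fn_def)
lemma psi_tri: "\<psi> (x + y) \<le> \<psi> x + \<psi> y" using nf by (simp add: is_norm_fn_def)
lemma psi_zero_iff [simp]: "\<psi> x = 0 \<longleftrightarrow> x = 0" using nf by (simp add: is_norm_fn_def)
lemma psi_0: "\<psi> 0 = 0" by simp

lemma psi_strict: "(\<And>i. \<bar>x $ i\<bar> \<le> \<bar>y $ i\<bar>) \<Longrightarrow> \<bar>x $ j\<bar> < \<bar>y $ j\<bar> \<Longrightarrow> \<psi> x < \<psi> y"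
  using smono unfolding strictly_monotone_norm_def by blast

lemma psi_mono: assumes "\<And>i. \<bar>x $ i\<bar> \<le> \<bar>y $ i\<bar>" shows "\<psi> x \<le> \<psi> y"
proof (cases "\<exists>j. \<bar>x $ j\<bar> < \<bar>y $ j\<bar>")
  case True then show ?thesis using psi_strict[of x y] assms by force
next
  case False
  then have "(\<chi> i. \<bar>x $ i\<bar>) = (\<chi> i. \<bar>y $ i\<bar>)" using assms by (simp add: vec_eq_iff not_less order_antisym)
  then show ?thesis using abso unfolding absolute_norm_def by (metis order_refl)
qed

text \<open>The form in which strict monotonicity is mostly used: a coordinatewise bound that is
  attained in norm is attained in every coordinate. Lower bounds for \<psi>-norms thereby become
  equalities in each summand.\<close>

lemma psi_eqI:
  assumes "\<And>i. 0 \<le> x $ i" "\<And>i. x $ i \<le> y $ i" "\<psi> y \<le> \<psi> x" shows "x = y"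
proof (rule ccontr)
  assume "x \<noteq> y"
  then obtain j where "x $ j \<noteq> y $ j" by (auto simp: vec_eq_iff)
  then have "\<psi> x < \<psi> y"
  proof (intro psi_strict[of x y j])
    have "0 \<le> y $ i" for i using assms(1,2)[of i] by linarith
    then show "\<bar>x $ i\<bar> \<le> \<bar>y $ i\<bar>" for i using assms(1,2)[of i] by simp
    then show "\<bar>x $ j\<bar> < \<bar>y $ j\<bar>" using \<open>x $ j \<noteq> y $ j\<close> assms(1,2)[of j] by simp
  qed
  then show False using assms(3) by simp
qed

lemma psi_axis: "\<psi> (axis i c) = \<bar>c\<bar>"
proof -
  have "axis i c = c *\<^sub>R axis i (1::real)" by (simp add: vec_eq_iff axis_def)
  then show ?thesis using nrm by (simp add: psi_scale normalized_norm_def)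
qed

lemma psi_component: "\<bar>x $ i\<bar> \<le> \<psi> x"
  using psi_mono[of "axis i (x $ i)" x] by (simp add: psi_axis) (simp add: axis_def)

lemma psi_le_sum: "\<psi> x \<le> (\<Sum>i\<in>UNIV. \<bar>x $ i\<bar>)"
proof -
  have fin: "\<psi> (\<Sum>i\<in>I. axis i (x $ i)) \<le> (\<Sum>i\<in>I. \<bar>x $ i\<bar>)" if "finite I" for I
    using that
  proof (induction I)
    case (insert j I)
    then show ?case using psi_tri[of "axis j (x $ j)" "\<Sum>i\<in>I. axis i (x $ i)"] by (simp add: psi_axis)
  qed (simp add: psi_0 del: psi_zero_iff)
  have "(\<Sum>i\<in>UNIV. axis i (x $ i)) = x"
    by (simp add: vec_eq_iff axis_def sum.delta if_distrib cong: if_cong)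
  then show ?thesis using fin[of UNIV] by simp
qed

lemma psi_diff: "\<bar>\<psi> x - \<psi> y\<bar> \<le> (\<Sum>i\<in>UNIV. \<bar>x $ i - y $ i\<bar>)"
proof -
  have "\<psi> x \<le> \<psi> y + \<psi> (x - y)" using psi_tri[of y "x - y"] by simp
  moreover have "\<psi> y \<le> \<psi> x + \<psi> (x - y)" using psi_tri[of x "y - x"] psi_scale[of "-1" "x - y"] by simp
  moreover have "\<psi> (x - y) \<le> (\<Sum>i\<in>UNIV. \<bar>x $ i - y $ i\<bar>)" using psi_le_sum[of "x - y"] by simp
  ultimately show ?thesis by linarith
qed

lemma psi_tendsto:
  assumes "\<And>i. ((\<lambda>n. f n $ i) \<longlongrightarrow> l $ i) F" shows "((\<lambda>n. \<psi> (f n)) \<longlongrightarrow> \<psi> l) F"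
proof -
  have "((\<lambda>n. \<Sum>i\<in>UNIV. \<bar>f n $ i - l $ i\<bar>) \<longlongrightarrow> (\<Sum>i\<in>UNIV. \<bar>l $ i - l $ i\<bar>)) F"
    by (intro tendsto_intros assms)
  then have "((\<lambda>n. \<Sum>i\<in>UNIV. \<bar>f n $ i - l $ i\<bar>) \<longlongrightarrow> 0) F" by simp
  then have "((\<lambda>n. \<psi> (f n) - \<psi> l) \<longlongrightarrow> 0) F"
    by (rule Lim_null_comparison[rotated]) (simp add: psi_diff)
  then show ?thesis by (simp add: LIM_zero_iff)
qed

text \<open>\<open>fin_rep\<close> yields almost isometries of finite-dimensional subspaces only.
  Taken on the spans of initial pieces of \<open>b\<close>, with constants
  \<open>1 + 1 / real (Suc n)\<close>, they have an exact linear isometry as their limit along \<U>.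
  Countability of the spanning set lets a sequence of such spans exhaust it.\<close>

lemma embed_countable:
  fixes S :: "'r \<Rightarrow> 'a::real_normed_vector set" and b :: "nat \<Rightarrow> 'z::real_normed_vector"
  assumes fr: "fin_rep TYPE('z) (psi_sum S) (psi_norm \<psi>)" and S: "\<And>i. subspace (S i)"
  obtains J :: "'z \<Rightarrow> ('a ultra)^'r" where
    "\<And>x i. x \<in> span (range b) \<Longrightarrow> J x $ i \<in> ultra_set (S i)"
    "\<And>x. x \<in> span (range b) \<Longrightarrow> psi_norm \<psi> (J x) = norm x"
    "\<And>x y. x \<in> span (range b) \<Longrightarrow> y \<in> span (range b) \<Longrightarrow> J (x + y) = J x + J y"
    "\<And>c x. x \<in> span (range b) \<Longrightarrow> J (c *\<^sub>R x) = c *\<^sub>R J x"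
proof -
  define E where "E n = span (b ` {..n})" for n
  have Emono: "E m \<subseteq> E n" if "m \<le> n" for m n unfolding E_def using that by (intro span_mono) auto
  let ?Q = "\<lambda>n T. (\<forall>x\<in>E n. T x \<in> psi_sum S) \<and>
        (\<forall>x\<in>E n. \<forall>y\<in>E n. T (x + y) = T x + T y) \<and>
        (\<forall>c. \<forall>x\<in>E n. T (c *\<^sub>R x) = c *\<^sub>R T x) \<and>
        (\<forall>x\<in>E n. norm x \<le> psi_norm \<psi> (T x) \<and> psi_norm \<psi> (T x) \<le> (1 + 1 / real (Suc n)) * norm x)"
  have "\<forall>n. \<exists>T::'z \<Rightarrow> 'a^'r. ?Q n T"
    unfolding E_def by (intro allI fin_repD[OF fr]) auto
  then obtain T :: "nat \<Rightarrow> 'z \<Rightarrow> 'a^'r" where TQ: "\<And>n. ?Q n (T n)" by metis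
  note T0 = TQ[THEN conjunct1, THEN bspec]
    and Tadd = TQ[THEN conjunct2, THEN conjunct1, THEN bspec, THEN bspec]
    and Tsc = TQ[THEN conjunct2, THEN conjunct2, THEN conjunct1, THEN spec, THEN bspec]
    and Tn = TQ[THEN conjunct2, THEN conjunct2, THEN conjunct2, THEN bspec, THEN conjunct1]
      TQ[THEN conjunct2, THEN conjunct2, THEN conjunct2, THEN bspec, THEN conjunct2]
  \<comment> \<open>Nothing is known of \<open>T n\<close> outside \<open>E n\<close>; the value 0
    keeps \<open>j x i\<close> bounded and inside \<open>S i\<close>. Each vector of the span lies
    in \<open>E n\<close> from some \<open>n\<close> on.\<close>
  define j where "j x i n = (if x \<in> E n then T n x $ i else 0)" for x i n
  have jS: "j x i n \<in> S i" for x i n using T0[of x n] S by (simp add: j_def psi_sum_def subspace_0)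
  have jb: "norm (j x i n) \<le> 2 * norm x" for x i n
  proof (cases "x \<in> E n")
    case True
    have "norm (j x i n) \<le> psi_norm \<psi> (T n x)"
      using psi_component[of "\<chi> i. norm (T n x $ i)" i] True by (simp add: psi_norm_def j_def)
    also have "\<dots> \<le> (1 + 1 / real (Suc n)) * norm x" by (rule Tn(2)[OF True])
    also have "\<dots> \<le> 2 * norm x" by (intro mult_right_mono) auto
    finally show ?thesis .
  qed (simp add: j_def)
  have bj: "bounded (range (j x i))" for x i using jb[of x i] by (auto simp: bounded_iff)
  have evE: "eventually (\<lambda>n. x \<in> E n) \<U>" if x: "x \<in> span (range b)" for x
  proof -
    have "\<exists>m. x \<in> E m"
    proof (rule span_induct[OF x, of "\<lambda>x. \<exists>m. x \<in> E m"])
      have "b k \<in> E k" for k unfolding E_def by (intro span_base) auto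
      then show "\<exists>m. y \<in> E m" if "y \<in> range b" for y using that by auto
      show "subspace {x. \<exists>m. x \<in> E m}"
      proof (rule subspaceI)
        show "0 \<in> {x. \<exists>m. x \<in> E m}" by (simp add: E_def span_zero)
        show "x + y \<in> {x. \<exists>m. x \<in> E m}" if xy: "x \<in> {x. \<exists>m. x \<in> E m}" "y \<in> {x. \<exists>m. x \<in> E m}" for x y
        proof -
          obtain m n where "x \<in> E m" "y \<in> E n" using xy by blast
          then have "x \<in> E (max m n)" "y \<in> E (max m n)" using Emono[of m "max m n"] Emono[of n "max m n"] by auto
          then have "x + y \<in> E (max m n)" unfolding E_def by (rule span_add)
          then show ?thesis by blast
        qed
        show "c *\<^sub>R x \<in> {x. \<exists>m. x \<in> E m}" if "x \<in> {x. \<exists>m. x \<in> E m}" for c x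
          using that unfolding E_def by (auto intro: span_scale)
      qed
    qed
    then obtain m where "x \<in> E m" by blast
    then show ?thesis using freeuf_ge[of m] Emono by (auto elim!: eventually_mono)
  qed
  define J :: "'z \<Rightarrow> ('a ultra)^'r" where "J x = (\<chi> i. ucls (j x i))" for x
  show thesis
  proof (rule that[of J])
    show "J x $ i \<in> ultra_set (S i)" for x i by (simp add: J_def ultra_setI bj jS)
    fix x assume x: "x \<in> span (range b)"
    have "((\<lambda>n. \<psi> (\<chi> i. norm (j x i n))) \<longlongrightarrow> \<psi> (\<chi> i. norm (ucls (j x i)))) \<U>"
      by (rule psi_tendsto) (simp add: ucls_norm bj)
    moreover have "((\<lambda>n. \<psi> (\<chi> i. norm (j x i n))) \<longlongrightarrow> norm x) \<U>"
    proof (rule tendsto_sandwich[where f = "\<lambda>_. norm x" and h = "\<lambda>n. (1 + 1 / real (Suc n)) * norm x"])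
      show "\<forall>\<^sub>F n in \<U>. norm x \<le> \<psi> (\<chi> i. norm (j x i n))"
        using evE[OF x] by eventually_elim (use Tn(1) in \<open>simp add: j_def psi_norm_def\<close>)
      show "\<forall>\<^sub>F n in \<U>. \<psi> (\<chi> i. norm (j x i n)) \<le> (1 + 1 / real (Suc n)) * norm x"
        using evE[OF x] by eventually_elim (use Tn(2) in \<open>simp add: j_def psi_norm_def\<close>)
      have "(\<lambda>n. (1 + 1 / real (Suc n)) * norm x) \<longlonglongrightarrow> (1 + 0) * norm x"
        by (intro tendsto_intros) (use LIMSEQ_inverse_real_of_nat in \<open>simp add: inverse_eq_divide\<close>)
      then show "((\<lambda>n. (1 + 1 / real (Suc n)) * norm x) \<longlongrightarrow> norm x) \<U>"
        by (intro tendsto_freeufI) simp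
    qed simp
    ultimately show "psi_norm \<psi> (J x) = norm x"
      using tendsto_unique[OF freeuf_bot] by (fastforce simp: psi_norm_def J_def)
    show "J (c *\<^sub>R x) = c *\<^sub>R J x" for c
    proof -
      have "ucls (j (c *\<^sub>R x) i) = ucls (\<lambda>n. c *\<^sub>R j x i n)" for i
      proof (rule ucls_cong_ev[OF bj bounded_range_scaleR[OF bj]])
        show "\<forall>\<^sub>F n in \<U>. j (c *\<^sub>R x) i n = c *\<^sub>R j x i n"
          using evE[OF x] evE[OF span_scale[OF x, of c]] by eventually_elim (simp add: j_def Tsc)
      qed
      then show ?thesis by (simp add: J_def vec_eq_iff ucls_scaleR bj)
    qed
    fix y assume y: "y \<in> span (range b)"
    have "ucls (j (x + y) i) = ucls (\<lambda>n. j x i n + j y i n)" for i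
    proof (rule ucls_cong_ev[OF bj bounded_range_plus[OF bj bj]])
      show "\<forall>\<^sub>F n in \<U>. j (x + y) i n = j x i n + j y i n"
        using evE[OF x] evE[OF y] evE[OF span_add[OF x y]] by eventually_elim (simp add: j_def Tadd)
    qed
    then show "J (x + y) = J x + J y" by (simp add: J_def vec_eq_iff ucls_plus bj)
  qed
qed

end

section \<open>Geometry of noncreasy spaces\<close>

lemma lin_onD:
  assumes "lin_on W f" "subspace W"
  shows "x \<in> W \<Longrightarrow> y \<in> W \<Longrightarrow> f (x + y) = f x + f y"
    "x \<in> W \<Longrightarrow> f (c *\<^sub>R x) = c * f x"
    "x \<in> W \<Longrightarrow> y \<in> W \<Longrightarrow> f (x - y) = f x - f y"
proof -
  show 1: "f (x + y) = f x + f y" if "x \<in> W" "y \<in> W" for x y using assms(1) that by (simp add: lin_on_def)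
  show 2: "f (c *\<^sub>R x) = c * f x" if "x \<in> W" for c x using assms(1) that by (simp add: lin_on_def)
  show "f (x - y) = f x - f y" if "x \<in> W" "y \<in> W"
    using 1[OF that(1), of "(-1) *\<^sub>R y"] 2[OF that(2), of "-1"] subspace_scale[OF assms(2) that(2), of "-1"] by simp
qed

lemma lin_on_sum:
  assumes "lin_on W f" "subspace W" "finite A" "\<And>j. j \<in> A \<Longrightarrow> x j \<in> W"
  shows "f (\<Sum>j\<in>A. x j) = (\<Sum>j\<in>A. f (x j))"
  using assms(3,4)
proof (induction A)
  case empty
  have "f (0 *\<^sub>R 0) = 0 * f 0" using assms(2) by (intro lin_onD(2)[OF assms(1,2)] subspace_0)
  then show ?case by simp
next
  case (insert j A)
  then show ?case using subspace_sum[OF assms(2), of A x] by (simp add: lin_onD(1)[OF assms(1,2)])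
qed

locale noncreasy =
  fixes W :: "'b::real_normed_vector set" and \<Phi> :: "('b \<Rightarrow> real) set"
  assumes nc: "noncreasy_wrt W \<Phi>"
begin

lemma sub: "subspace W" using nc by (simp add: noncreasy_wrt_def)
lemma lin: "f \<in> \<Phi> \<Longrightarrow> lin_on W f" using nc by (simp add: noncreasy_wrt_def)
lemma absle: "f \<in> \<Phi> \<Longrightarrow> x \<in> W \<Longrightarrow> \<bar>f x\<bar> \<le> norm x" using nc by (simp add: noncreasy_wrt_def)
lemma le: "f \<in> \<Phi> \<Longrightarrow> x \<in> W \<Longrightarrow> f x \<le> norm x" using absle abs_le_D1 by blast
lemma norming: "s \<in> W \<Longrightarrow> s \<noteq> 0 \<Longrightarrow> \<exists>f\<in>\<Phi>. f s = norm s" using nc by (simp add: noncreasy_wrt_def)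
lemmas flin = lin_onD[OF lin sub]
lemma memI: "x \<in> W \<Longrightarrow> y \<in> W \<Longrightarrow> x + y \<in> W" "x \<in> W \<Longrightarrow> y \<in> W \<Longrightarrow> x - y \<in> W" "x \<in> W \<Longrightarrow> c *\<^sub>R x \<in> W"
  by (simp_all add: subspace_add[OF sub] subspace_diff[OF sub] subspace_scale[OF sub])

lemma slices:
  assumes "\<epsilon> > 0"
  obtains \<delta> where "\<delta> > 0" "\<And>f g w p q. f \<in> \<Phi> \<Longrightarrow> g \<in> \<Phi> \<Longrightarrow> w \<in> W \<Longrightarrow> p \<in> W \<Longrightarrow> q \<in> W \<Longrightarrow>
     norm w \<le> 1 \<Longrightarrow> norm p \<le> 1 \<Longrightarrow> norm q \<le> 1 \<Longrightarrow> f w - g w \<ge> \<epsilon> \<Longrightarrow>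
     f p \<ge> 1 - \<delta> \<Longrightarrow> g p \<ge> 1 - \<delta> \<Longrightarrow> f q \<ge> 1 - \<delta> \<Longrightarrow> g q \<ge> 1 - \<delta> \<Longrightarrow> norm (p - q) \<le> \<epsilon>"
  using nc assms unfolding noncreasy_wrt_def by meson

text \<open>The normalised points \<open>p\<close> and \<open>q\<close> lie in both slices for every
  \<open>\<delta>\<close>. As the functionals differ by \<open>e\<close> at the normalised
  \<open>w\<close>, noncreasiness applies with every positive \<open>\<epsilon> \<le> e\<close> and
  brings the two points together.\<close>

lemma slices_exact:
  assumes fg: "f \<in> \<Phi>" "g \<in> \<Phi>" and mem: "p \<in> W" "q \<in> W" "w \<in> W"
    and p: "f p = norm p" "g p = norm p" "p \<noteq> 0" and q: "f q = norm q" "g q = norm q" "q \<noteq> 0"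
    and w: "f w > g w"
  shows "norm q *\<^sub>R p = norm p *\<^sub>R q"
proof -
  let ?p = "(1 / norm p) *\<^sub>R p" and ?q = "(1 / norm q) *\<^sub>R q"
  have "w \<noteq> 0"
  proof
    assume "w = 0"
    then have "f w = 0" "g w = 0" using absle[OF fg(1) mem(3)] absle[OF fg(2) mem(3)] by auto
    then show False using w by simp
  qed
  define e where "e = (f w - g w) / norm w"
  have e: "e > 0" using w \<open>w \<noteq> 0\<close> by (simp add: e_def)
  have "norm (?p - ?q) \<le> \<epsilon>" if \<epsilon>: "0 < \<epsilon>" "\<epsilon> \<le> e" for \<epsilon>
  proof -
    obtain \<delta> where \<delta>: "\<delta> > 0" "\<And>f g w p q. f \<in> \<Phi> \<Longrightarrow> g \<in> \<Phi> \<Longrightarrow> w \<in> W \<Longrightarrow> p \<in> W \<Longrightarrow> q \<in> W \<Longrightarrow>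
     norm w \<le> 1 \<Longrightarrow> norm p \<le> 1 \<Longrightarrow> norm q \<le> 1 \<Longrightarrow> f w - g w \<ge> \<epsilon> \<Longrightarrow>
     f p \<ge> 1 - \<delta> \<Longrightarrow> g p \<ge> 1 - \<delta> \<Longrightarrow> f q \<ge> 1 - \<delta> \<Longrightarrow> g q \<ge> 1 - \<delta> \<Longrightarrow> norm (p - q) \<le> \<epsilon>"
      using slices[OF \<epsilon>(1)] by blast
    show ?thesis
    proof (rule \<delta>(2)[OF fg, of "(1 / norm w) *\<^sub>R w"])
      show "\<epsilon> \<le> f ((1 / norm w) *\<^sub>R w) - g ((1 / norm w) *\<^sub>R w)"
        using \<epsilon>(2) mem(3) fg by (simp add: flin e_def diff_divide_distrib)
    qed (use mem p q \<delta>(1) \<open>w \<noteq> 0\<close> fg in \<open>simp_all add: flin memI\<close>)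
  qed
  from this[of "min e _"] have "norm (?p - ?q) \<le> 0 + \<epsilon>" if "\<epsilon> > 0" for \<epsilon>
    using e that by (metis add_0 min.cobounded1 min.cobounded2 min_less_iff_conj order_trans)
  then have "norm (?p - ?q) \<le> 0" by (rule field_le_epsilon)
  then have "?p = ?q" by simp
  then have "(norm p * norm q) *\<^sub>R ?p = (norm p * norm q) *\<^sub>R ?q" by simp
  then show ?thesis using p q by simp
qed

text \<open>A functional norming a point against the midpoint of two others norms both differences.\<close>

lemma metric_segment:
  assumes mem: "x \<in> W" "y \<in> W" "c \<in> W" "z \<in> W" and a: "a > 0"
    and d: "norm (x - y) \<le> a" "norm (x - c) \<le> a" "norm (y - c) \<le> a"
    and m: "norm (x - (1/2) *\<^sub>R (y + c)) \<ge> a" "norm (y - (1/2) *\<^sub>R (x + c)) \<ge> a"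
    and z: "norm (z - x) + norm (z - y) \<le> a"
  shows "z = x + (norm (z - x) / a) *\<^sub>R (y - x)"
proof (cases "z = x")
  case False
  let ?s = "x - (1/2) *\<^sub>R (y + c)" and ?t = "(1/2) *\<^sub>R (x + c) - y"
  have "?s \<noteq> 0" using m(1) a by auto
  then obtain g where g: "g \<in> \<Phi>" "g ?s = norm ?s" using norming[of ?s] mem by (auto simp: memI)
  have "norm ?t \<ge> a" using m(2) by (simp add: norm_minus_commute)
  moreover have "?t \<noteq> 0" using calculation a by auto
  ultimately obtain f where f: "f \<in> \<Phi>" "f ?t = norm ?t" using norming[of ?t] mem by (auto simp: memI)
  have "g ?s = g x - (g y + g c) / 2" "f ?t = (f x + f c) / 2 - f y" using mem f g by (simp_all add: flin memI)
  moreover have "g x - g y \<le> a" "g x - g c \<le> a"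
    using le[OF g(1), of "x - y"] le[OF g(1), of "x - c"] mem d g(1) by (simp_all add: flin memI)
  moreover have "f x - f y \<le> a" "f c - f y \<le> a"
    using le[OF f(1), of "x - y"] le[OF f(1), of "c - y"] mem d f(1) by (simp_all add: flin memI norm_minus_commute)
  \<comment> \<open>An average of numbers that are at most \<open>a\<close> is at least
    \<open>a\<close>, so each of them equals \<open>a\<close>. The same step recurs in
    \<open>segment_interior_false\<close>.\<close>
  ultimately have gg: "g x - g y = a" "g x - g c = a" and ff: "f x - f y = a" "f c - f y = a"
    using g(2) f(2) m(1) \<open>norm ?t \<ge> a\<close> by - argo+
  have b: "h (x - z) = norm (x - z)" if h: "h \<in> \<Phi>" "h x - h y = a" for h
  proof -
    have "h x - h z \<le> norm (z - x)" "h z - h y \<le> norm (z - y)"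
      using le[OF h(1), of "x - z"] le[OF h(1), of "z - y"] mem h(1) by (simp_all add: flin memI norm_minus_commute)
    then have "h x - h z = norm (z - x)" using h(2) z by linarith
    then show ?thesis using mem h(1) by (simp add: flin norm_minus_commute)
  qed
  have nxy: "norm (x - y) = a"
    using gg(1) le[OF g(1), of "x - y"] d(1) mem g(1) by (simp add: flin memI)
  have "norm (x - y) *\<^sub>R (x - z) = norm (x - z) *\<^sub>R (x - y)"
  proof (rule slices_exact[OF g(1) f(1)])
    \<comment> \<open>The two functionals are distinct: \<open>g (y - c) = 0\<close>, whereas
      \<open>f (y - c) = - a\<close>.\<close>
    show "f (y - c) < g (y - c)" using mem f(1) g(1) gg ff a by (simp add: flin)
    show "x - y \<noteq> 0" using nxy a by auto
  qed (use mem b[OF g(1) gg(1)] b[OF f(1) ff(1)] False nxy f(1) g(1) gg(1) ff(1) in \<open>simp_all add: memI flin\<close>)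
  then have "a *\<^sub>R (x - z) = norm (z - x) *\<^sub>R (x - y)" by (simp add: nxy norm_minus_commute)
  then have "(1 / a) *\<^sub>R (a *\<^sub>R (x - z)) = (1 / a) *\<^sub>R (norm (z - x) *\<^sub>R (x - y))" by simp
  then have "x - z = (norm (z - x) / a) *\<^sub>R (x - y)" using a by simp
  then show ?thesis by (simp add: algebra_simps)
qed simp

text \<open>Let \<open>h\<close> norm the difference of \<open>z\<close> and the midpoint of
  \<open>c\<close> and \<open>e\<close>. As \<open>z\<close> is inner to the segment, both end
  points attain the maximum; so \<open>h\<close> norms \<open>x - c\<close> and \<open>y - c\<close>
  and agrees at \<open>c\<close> and \<open>e\<close>. A functional \<open>k\<close> norming the
  difference of the barycentre of \<open>x\<close>, \<open>y\<close>, \<open>e\<close> and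
  \<open>c\<close> norms \<open>x - c\<close> and \<open>y - c\<close> as well, but separates
  \<open>e\<close> from \<open>c\<close>. Hence \<open>x - c\<close> and \<open>y - c\<close>
  coincide, against \<open>norm (x - y) = a\<close>.\<close>

lemma segment_interior_false:
  assumes mem: "x \<in> W" "y \<in> W" "c \<in> W" "e \<in> W" and a: "a > 0" and xy: "norm (x - y) = a"
    and d: "norm (x - c) \<le> a" "norm (y - c) \<le> a" "norm (x - e) \<le> a" "norm (y - e) \<le> a" "norm (c - e) \<le> a"
    and t: "0 < t" "t < 1" and z: "z = x + t *\<^sub>R (y - x)"
    and m: "norm (z - (1/2) *\<^sub>R (c + e)) \<ge> a" "norm (c - (1/3) *\<^sub>R (x + y + e)) \<ge> a"
  shows False
proof -
  let ?s = "z - (1/2) *\<^sub>R (c + e)" and ?t = "(1/3) *\<^sub>R (x + y + e) - c"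
  have zW: "z \<in> W" unfolding z using mem by (simp add: memI)
  have "?s \<noteq> 0" using m(1) a by auto
  then obtain h where h: "h \<in> \<Phi>" "h ?s = norm ?s" using norming[of ?s] mem zW by (auto simp: memI)
  have "norm ?t \<ge> a" using m(2) by (simp add: norm_minus_commute)
  moreover have "?t \<noteq> 0" using calculation a by auto
  ultimately obtain k where k: "k \<in> \<Phi>" "k ?t = norm ?t" using norming[of ?t] mem by (auto simp: memI)
  have "k ?t = (k x + k y + k e) / 3 - k c" using mem k by (simp add: flin memI)
  moreover have "k x - k c \<le> a" "k y - k c \<le> a" "k e - k c \<le> a"
    using le[OF k(1), of "x - c"] le[OF k(1), of "y - c"] le[OF k(1), of "e - c"] mem d k(1)
    by (simp_all add: flin memI norm_minus_commute)
  ultimately have kk: "k x - k c = a" "k y - k c = a" "k e - k c = a"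
    using k(2) \<open>norm ?t \<ge> a\<close> by - argo+
  have hz: "h z = h x + t * (h y - h x)" unfolding z using mem h(1) by (simp add: flin memI)
  have hs: "h ?s = h z - (h c + h e) / 2" using mem zW h(1) by (simp add: flin memI)
  have hle: "h x - h c \<le> a" "h y - h c \<le> a" "h x - h e \<le> a" "h y - h e \<le> a"
    using le[OF h(1), of "x - c"] le[OF h(1), of "y - c"] le[OF h(1), of "x - e"] le[OF h(1), of "y - e"] mem d h(1)
    by (simp_all add: flin memI norm_minus_commute)
  define X where "X = h x - (h c + h e) / 2"
  define Y where "Y = h y - (h c + h e) / 2"
  have "X \<le> a" "Y \<le> a" using hle unfolding X_def Y_def by - argo+
  moreover have "(1 - t) * X + t * Y \<ge> a"
  proof -
    have "(1 - t) * X + t * Y = X + t * (Y - X)" by (simp add: algebra_simps)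
    also have "\<dots> = h ?s" unfolding hs hz by (simp add: X_def Y_def)
    finally show ?thesis using h(2) m(1) by linarith
  qed
  ultimately have "X = a" "Y = a"
  proof -
    have "(1 - t) * (a - X) + t * (a - Y) \<le> 0" using \<open>(1 - t) * X + t * Y \<ge> a\<close> by (simp add: algebra_simps)
    moreover have "(1 - t) * (a - X) \<ge> 0" "t * (a - Y) \<ge> 0" using t \<open>X \<le> a\<close> \<open>Y \<le> a\<close> by simp_all
    ultimately have "(1 - t) * (a - X) \<le> 0" "t * (a - Y) \<le> 0" by - linarith+
    with \<open>(1 - t) * (a - X) \<ge> 0\<close> \<open>t * (a - Y) \<ge> 0\<close> have "(1 - t) * (a - X) = 0" "t * (a - Y) = 0"
      by (simp_all add: order_antisym)
    then show "X = a" "Y = a" using t by simp_all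
  qed
  then have hh: "h x - h c = a" "h y - h c = a" "h x - h e = a"
    using hle unfolding X_def Y_def by - argo+
  have nx: "norm (x - c) = a" "norm (y - c) = a"
    using hh le[OF h(1), of "x - c"] le[OF h(1), of "y - c"] d mem h(1) by (simp_all add: flin memI)
  have "norm (y - c) *\<^sub>R (x - c) = norm (x - c) *\<^sub>R (y - c)"
  proof (rule slices_exact[OF k(1) h(1)])
    show "h (e - c) < k (e - c)" using mem h(1) k(1) hh kk a by (simp add: flin)
    show "x - c \<noteq> 0" "y - c \<noteq> 0" using nx a by auto
  qed (use mem nx hh kk h(1) k(1) in \<open>simp_all add: memI flin\<close>)
  then have "x - c = y - c" using nx a by simp
  then show False using xy a by simp
qed

text \<open>A functional \<open>\<phi>\<close> norming the sum from \<open>k\<close> on norms each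
  of its terms. A functional \<open>\<theta>\<close> norming
  \<open>s - \<alpha> *\<^sub>R x k\<close> is at most 0 at \<open>x k\<close>, since the
  subtraction did not lower the norm, yet its total loss on the terms from \<open>l\<close> on is at
  most \<open>\<alpha> * norm (x k)\<close>. The two differ by at least 1 at the normalised
  \<open>x k\<close>, while the normalised \<open>x j1\<close> and \<open>x j2\<close> lie in both
  slices.\<close>

lemma ray:
  fixes x :: "nat \<Rightarrow> 'b"
  assumes mem: "\<And>j. x j \<in> W" and kl: "l = Suc k" "l < m"
    and add: "norm (\<Sum>j=k..<m. x j) = (\<Sum>j=k..<m. norm (x j))" "norm (\<Sum>j=l..<m. x j) = (\<Sum>j=l..<m. norm (x j))"
    and pos: "x k \<noteq> 0"
    and grow: "\<And>\<eta>. \<eta> > 0 \<Longrightarrow> \<exists>\<alpha>. 0 < \<alpha> \<and> \<alpha> < \<eta> \<and> norm ((\<Sum>j=l..<m. x j) - \<alpha> *\<^sub>R x k) \<ge> norm (\<Sum>j=l..<m. x j)"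
    and jj: "j1 \<in> {l..<m}" "j2 \<in> {l..<m}"
  shows "norm (x j2) *\<^sub>R x j1 = norm (x j1) *\<^sub>R x j2"
proof (cases "x j1 = 0 \<or> x j2 = 0")
  case True then show ?thesis by auto
next
  case False
  let ?p = "(1 / norm (x j1)) *\<^sub>R x j1" and ?q = "(1 / norm (x j2)) *\<^sub>R x j2"
  define s where "s = (\<Sum>j=l..<m. x j)"
  have sW: "s \<in> W" unfolding s_def by (intro subspace_sum sub mem)
  have skW: "(\<Sum>j=k..<m. x j) \<in> W" by (intro subspace_sum sub mem)
  have sp: "norm s > 0"
  proof -
    have "norm (x j1) \<le> (\<Sum>j=l..<m. norm (x j))" using jj by (intro member_le_sum) auto
    then show ?thesis using False add(2) by (simp add: s_def) (smt (verit) zero_less_norm_iff)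
  qed
  have "norm (x k) \<le> (\<Sum>j=k..<m. norm (x j))" using kl by (intro member_le_sum) auto
  then have "(\<Sum>j=k..<m. x j) \<noteq> 0" using add(1) pos by auto
  then obtain \<phi> where \<phi>: "\<phi> \<in> \<Phi>" "\<phi> (\<Sum>j=k..<m. x j) = (\<Sum>j=k..<m. norm (x j))"
    using norming[OF skW] add(1) by auto
  have \<phi>x: "\<phi> (x j) = norm (x j)" if "j \<in> {k..<m}" for j
  proof (rule ccontr)
    assume "\<phi> (x j) \<noteq> norm (x j)"
    then have "\<phi> (x j) < norm (x j)" using le[OF \<phi>(1) mem, of j] by simp
    then have "(\<Sum>j=k..<m. \<phi> (x j)) < (\<Sum>j=k..<m. norm (x j))"
      using that le[OF \<phi>(1) mem] by (intro sum_strict_mono_ex1) auto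
    then show False using \<phi>(2) lin_on_sum[OF lin[OF \<phi>(1)] sub, of "{k..<m}" x] mem by simp
  qed
  have "norm (?p - ?q) \<le> 0 + \<epsilon>" if "\<epsilon> > 0" for \<epsilon>
  proof -
    have "min \<epsilon> 1 > 0" using that by simp
    then obtain \<delta> where \<delta>: "\<delta> > 0" "\<And>f g w p q. f \<in> \<Phi> \<Longrightarrow> g \<in> \<Phi> \<Longrightarrow> w \<in> W \<Longrightarrow> p \<in> W \<Longrightarrow> q \<in> W \<Longrightarrow>
     norm w \<le> 1 \<Longrightarrow> norm p \<le> 1 \<Longrightarrow> norm q \<le> 1 \<Longrightarrow> f w - g w \<ge> min \<epsilon> 1 \<Longrightarrow>
     f p \<ge> 1 - \<delta> \<Longrightarrow> g p \<ge> 1 - \<delta> \<Longrightarrow> f q \<ge> 1 - \<delta> \<Longrightarrow> g q \<ge> 1 - \<delta> \<Longrightarrow> norm (p - q) \<le> min \<epsilon> 1"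
      using slices[of "min \<epsilon> 1"] by blast
    \<comment> \<open>Passing to unit vectors divides the loss by \<open>norm (x j)\<close>;
      measuring \<open>\<alpha>\<close> against the smaller of the two norms keeps the loss below
      \<open>\<delta>\<close>.\<close>
    define \<mu> where "\<mu> = min (norm (x j1)) (norm (x j2))"
    have \<mu>: "\<mu> > 0" using False by (simp add: \<mu>_def)
    have "\<delta> * \<mu> / norm (x k) > 0" using \<delta>(1) \<mu> pos by simp
    then obtain \<alpha> where \<alpha>: "0 < \<alpha>" "\<alpha> < \<delta> * \<mu> / norm (x k)" "norm (s - \<alpha> *\<^sub>R x k) \<ge> norm s"
      using grow unfolding s_def by blast
    then have small: "\<alpha> * norm (x k) < \<delta> * \<mu>" using pos by (simp add: field_simps)
    have "s - \<alpha> *\<^sub>R x k \<noteq> 0" using \<alpha>(3) sp by (metis norm_zero not_less)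
    then obtain \<theta> where \<theta>: "\<theta> \<in> \<Phi>" "\<theta> (s - \<alpha> *\<^sub>R x k) = norm (s - \<alpha> *\<^sub>R x k)"
      using norming[of "s - \<alpha> *\<^sub>R x k"] sW mem by (auto simp: memI)
    have th: "\<theta> s - \<alpha> * \<theta> (x k) \<ge> norm s" using \<theta> \<alpha>(3) sW mem by (simp add: flin memI)
    then have "\<alpha> * \<theta> (x k) \<le> 0" using le[OF \<theta>(1) sW] by linarith
    then have neg: "\<theta> (x k) \<le> 0" using \<alpha>(1) by (simp add: mult_le_0_iff)
    have "- \<theta> (x k) \<le> norm (x k)" using absle[OF \<theta>(1) mem, of k] by linarith
    then have "\<alpha> * (- \<theta> (x k)) \<le> \<alpha> * norm (x k)" using \<alpha>(1) by (intro mult_left_mono) auto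
    then have th2: "\<theta> s \<ge> (\<Sum>j=l..<m. norm (x j)) - \<alpha> * norm (x k)" using th add(2) by (simp add: s_def)
    have ths: "\<theta> s = (\<Sum>j=l..<m. \<theta> (x j))"
      unfolding s_def by (rule lin_on_sum[OF lin[OF \<theta>(1)] sub]) (simp_all add: mem)
    have th3: "\<theta> (x j) \<ge> norm (x j) - \<delta> * \<mu>" if j: "j \<in> {l..<m}" for j
    proof -
      have "norm (x j) - \<theta> (x j) \<le> (\<Sum>j=l..<m. norm (x j) - \<theta> (x j))"
        using j le[OF \<theta>(1) mem] by (intro member_le_sum[of j "{l..<m}" "\<lambda>j. norm (x j) - \<theta> (x j)"]) auto
      also have "\<dots> \<le> \<alpha> * norm (x k)" using th2 ths by (simp add: sum_subtractf)
      finally show ?thesis using small by linarith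
    qed
    have th4: "\<theta> ((1 / norm (x j)) *\<^sub>R x j) \<ge> 1 - \<delta>" if j: "j \<in> {j1, j2}" for j
    proof -
      have nz: "norm (x j) > 0" "\<mu> \<le> norm (x j)" "j \<in> {l..<m}" using j False jj by (auto simp: \<mu>_def)
      have "norm (x j) - \<delta> * norm (x j) \<le> norm (x j) - \<delta> * \<mu>" using nz \<delta>(1) by simp
      also have "\<dots> \<le> \<theta> (x j)" by (rule th3[OF nz(3)])
      finally have "(1 - \<delta>) * norm (x j) \<le> \<theta> (x j)" by (simp add: algebra_simps)
      then show ?thesis using nz(1) mem \<theta>(1) by (simp add: flin pos_le_divide_eq)
    qed
    have ph: "\<phi> ((1 / norm (x j)) *\<^sub>R x j) = 1" if "j \<in> {j1, j2, k}" for j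
      using that False pos jj kl \<phi>x[of j] mem \<phi>(1) by (auto simp: flin)
    have "norm (?p - ?q) \<le> min \<epsilon> 1"
    proof (rule \<delta>(2)[OF \<phi>(1) \<theta>(1), of "(1 / norm (x k)) *\<^sub>R x k"])
      have "\<theta> ((1 / norm (x k)) *\<^sub>R x k) \<le> 0" using neg pos mem \<theta>(1) by (simp add: flin divide_nonpos_pos)
      then show "min \<epsilon> 1 \<le> \<phi> ((1 / norm (x k)) *\<^sub>R x k) - \<theta> ((1 / norm (x k)) *\<^sub>R x k)"
        using ph[of k] by (simp add: min_def)
    qed (use th4 ph \<delta>(1) mem False pos in \<open>simp_all add: memI\<close>)
    then show ?thesis by simp
  qed
  then have "norm (?p - ?q) \<le> 0" by (rule field_le_epsilon)
  then have "?p = ?q" by simp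
  then have "(norm (x j1) * norm (x j2)) *\<^sub>R ?p = (norm (x j1) * norm (x j2)) *\<^sub>R ?q" by simp
  then show ?thesis using False by simp
qed

text \<open>After the first index the \<open>x j\<close> lie on one ray; after the second they vanish.\<close>

lemma no_three:
  fixes x :: "nat \<Rightarrow> 'b"
  assumes mem: "\<And>j. x j \<in> W"
    and add: "\<And>k. k < m \<Longrightarrow> norm (\<Sum>j=k..<m. x j) = (\<Sum>j=k..<m. norm (x j))"
    and nz: "x k1 \<noteq> 0" "x k2 \<noteq> 0" "x k3 \<noteq> 0" and kk: "k1 < k2" "k2 < k3" "k3 < m"
    and grow: "\<And>k \<eta>. k \<in> {k1, k2} \<Longrightarrow> \<eta> > 0 \<Longrightarrow>
      \<exists>\<alpha>. 0 < \<alpha> \<and> \<alpha> < \<eta> \<and> norm ((\<Sum>j=Suc k..<m. x j) - \<alpha> *\<^sub>R x k) \<ge> norm (\<Sum>j=Suc k..<m. x j)"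
  shows False
proof -
  have on_ray: "x j = (norm (x j) / norm (x k2)) *\<^sub>R x k2" if "j \<in> {Suc k1..<m}" for j
  proof -
    have "norm (x k2) *\<^sub>R x j = norm (x j) *\<^sub>R x k2"
      by (rule ray[OF mem refl _ add add nz(1) grow]) (use kk that in auto)
    then have "(1 / norm (x k2)) *\<^sub>R (norm (x k2) *\<^sub>R x j) = (1 / norm (x k2)) *\<^sub>R (norm (x j) *\<^sub>R x k2)" by simp
    then show ?thesis using nz(2) by simp
  qed
  define N where "N = (\<Sum>j=Suc k2..<m. norm (x j))"
  have S: "(\<Sum>j=Suc k2..<m. x j) = (N / norm (x k2)) *\<^sub>R x k2"
  proof -
    have "(\<Sum>j=Suc k2..<m. x j) = (\<Sum>j=Suc k2..<m. (norm (x j) / norm (x k2)) *\<^sub>R x k2)"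
      by (rule sum.cong[OF refl]) (use on_ray kk in auto)
    then show ?thesis by (simp add: N_def scaleR_left.sum sum_divide_distrib)
  qed
  have "norm (x k3) \<le> N" unfolding N_def using kk by (intro member_le_sum) auto
  then have N: "N > 0" using nz(3) by (smt (verit) zero_less_norm_iff)
  then have "N / norm (x k2) > 0" using nz(2) by simp
  then obtain \<alpha> where \<alpha>: "0 < \<alpha>" "\<alpha> < N / norm (x k2)"
    "norm ((\<Sum>j=Suc k2..<m. x j) - \<alpha> *\<^sub>R x k2) \<ge> norm (\<Sum>j=Suc k2..<m. x j)" using grow[of k2] by blast
  \<comment> \<open>The tail is a positive multiple of \<open>x k2\<close>, so subtracting a small
    positive multiple of \<open>x k2\<close> shortens it, against \<open>grow\<close>.\<close>
  have "(\<Sum>j=Suc k2..<m. x j) - \<alpha> *\<^sub>R x k2 = (N / norm (x k2) - \<alpha>) *\<^sub>R x k2"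
    unfolding S by (simp add: scaleR_diff_left)
  then have "norm ((\<Sum>j=Suc k2..<m. x j) - \<alpha> *\<^sub>R x k2) = (N / norm (x k2) - \<alpha>) * norm (x k2)"
    using \<alpha> by simp
  moreover have "norm (\<Sum>j=Suc k2..<m. x j) = N / norm (x k2) * norm (x k2)" unfolding S using N by simp
  ultimately have "\<alpha> * norm (x k2) \<le> 0" using \<alpha>(3) by (simp add: algebra_simps)
  then show False using \<alpha>(1) nz(2) by (simp add: mult_le_0_iff)
qed

end

section \<open>Finite James configurations in the direct sum\<close>

context strict_psi
begin

lemma psi_norm_sum:
  fixes v :: "'c \<Rightarrow> 'b::real_normed_vector^'r"
  assumes "finite A"
  shows "\<psi> (\<chi> i. \<Sum>j\<in>A. norm (v j $ i)) \<le> (\<Sum>j\<in>A. psi_norm \<psi> (v j))"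
  using assms
proof (induction A)
  case empty
  have "(\<chi> i. 0) = (0 :: real^'r)" by (simp add: vec_eq_iff)
  then show ?case by (simp add: psi_0 del: psi_zero_iff)
next
  case (insert j A)
  have "\<psi> (\<chi> i. \<Sum>j\<in>insert j A. norm (v j $ i)) = \<psi> ((\<chi> i. norm (v j $ i)) + (\<chi> i. \<Sum>j\<in>A. norm (v j $ i)))"
    using insert.hyps by (intro arg_cong[of _ _ \<psi>]) (simp add: vec_eq_iff)
  also have "\<dots> \<le> psi_norm \<psi> (v j) + \<psi> (\<chi> i. \<Sum>j\<in>A. norm (v j $ i))" unfolding psi_norm_def by (rule psi_tri)
  finally show ?case using insert by simp
qed

text \<open>A finite form of James's obstruction to reflexivity, excluded in a direct sum with \<open>r\<close>
  noncreasy summands because each summand can absorb at most two of the \<open>2 r + 1\<close> steps.\<close>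

lemma no_james_configuration:
  fixes W :: "'r \<Rightarrow> 'b::real_normed_vector set" and x :: "nat \<Rightarrow> 'b^'r"
  assumes nc: "\<And>i. noncreasy_wrt (W i) (\<Phi> i)" and mem: "\<And>j i. x j $ i \<in> W i"
    and m: "m = 2 * CARD('r) + 2"
    and le1: "\<And>j. psi_norm \<psi> (x j) \<le> 1"
    and ge: "\<And>l. l < m \<Longrightarrow> psi_norm \<psi> (\<Sum>j=l..<m. x j) \<ge> real (m - l)"
    and ge2: "\<And>k s. Suc k < m \<Longrightarrow>
      psi_norm \<psi> ((\<Sum>j=Suc k..<m. x j) - (real (m - Suc k) / real (Suc s)) *\<^sub>R x k) \<ge> real (m - Suc k)"
  shows False
proof -
  \<comment> \<open>The lower bound \<open>m - l\<close> for the norm of the sum meets the upper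
    bound from \<open>le1\<close>; by \<open>psi_eqI\<close> the triangle inequality is an equality
    in every coordinate.\<close>
  have eq: "norm ((\<Sum>j=l..<m. x j) $ i) = (\<Sum>j=l..<m. norm (x j $ i))" if l: "l < m" for l i
  proof -
    have "(\<chi> i. norm ((\<Sum>j=l..<m. x j) $ i)) = (\<chi> i. \<Sum>j=l..<m. norm (x j $ i))"
    proof (rule psi_eqI)
      have "\<psi> (\<chi> i. \<Sum>j=l..<m. norm (x j $ i)) \<le> (\<Sum>j=l..<m. psi_norm \<psi> (x j))" by (rule psi_norm_sum) simp
      also have "\<dots> \<le> (\<Sum>j=l..<m. 1)" by (intro sum_mono le1)
      finally show "\<psi> (\<chi> i. \<Sum>j=l..<m. norm (x j $ i)) \<le> \<psi> (\<chi> i. norm ((\<Sum>j=l..<m. x j) $ i))"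
        using ge[OF l] by (simp add: psi_norm_def)
    qed (simp_all add: norm_sum)
    then show ?thesis by (simp add: vec_eq_iff)
  qed
  have step: "\<exists>i. x k $ i \<noteq> 0 \<and> (\<forall>\<eta>>0. \<exists>\<alpha>. 0 < \<alpha> \<and> \<alpha> < \<eta> \<and>
      norm ((\<Sum>j=Suc k..<m. x j $ i) - \<alpha> *\<^sub>R (x k $ i)) \<ge> norm (\<Sum>j=Suc k..<m. x j $ i))" if k: "Suc k < m" for k
  proof -
    define w where "w = (\<Sum>j=Suc k..<m. x j)"
    have wi: "w $ i = (\<Sum>j=Suc k..<m. x j $ i)" for i by (simp add: w_def)
    have xk: "x k \<noteq> 0"
    proof
      assume "x k = 0"
      have "psi_norm \<psi> (\<Sum>j=k..<m. x j) \<le> \<psi> (\<chi> i. \<Sum>j=k..<m. norm (x j $ i))"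
        unfolding psi_norm_def by (rule psi_mono) (simp add: order_trans[OF norm_sum abs_ge_self])
      also have "\<dots> \<le> (\<Sum>j=k..<m. psi_norm \<psi> (x j))" by (rule psi_norm_sum) simp
      also have "\<dots> = psi_norm \<psi> (x k) + (\<Sum>j=Suc k..<m. psi_norm \<psi> (x j))"
        using k by (simp add: sum.atLeast_Suc_lessThan)
      also have "psi_norm \<psi> (x k) = 0"
        unfolding psi_norm_def psi_zero_iff by (simp add: \<open>x k = 0\<close> vec_eq_iff)
      also have "0 + (\<Sum>j=Suc k..<m. psi_norm \<psi> (x j)) \<le> 0 + (\<Sum>j=Suc k..<m. 1)" by (intro add_mono sum_mono le1) simp
      finally show False using ge[of k] k by simp
    qed
    \<comment> \<open>If subtracting this multiple of \<open>x k\<close> shortened \<open>w\<close>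
      in every coordinate where \<open>x k\<close> is nonzero, strict monotonicity would push the
      \<psi>-norm below \<open>m - Suc k\<close>.\<close>
    have "\<forall>s. \<exists>i. x k $ i \<noteq> 0 \<and> norm (w $ i - (real (m - Suc k) / real (Suc s)) *\<^sub>R (x k $ i)) \<ge> norm (w $ i)"
    proof (rule ccontr)
      assume "\<not> ?thesis"
      then obtain s where s: "\<And>i. x k $ i \<noteq> 0 \<Longrightarrow>
        norm (w $ i - (real (m - Suc k) / real (Suc s)) *\<^sub>R (x k $ i)) < norm (w $ i)" by (metis not_le)
      obtain i0 where i0: "x k $ i0 \<noteq> 0" using xk by (auto simp: vec_eq_iff)
      have "psi_norm \<psi> (w - (real (m - Suc k) / real (Suc s)) *\<^sub>R x k) < psi_norm \<psi> w"
        unfolding psi_norm_def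
      proof (rule psi_strict)
        show "\<bar>(\<chi> i. norm ((w - (real (m - Suc k) / real (Suc s)) *\<^sub>R x k) $ i)) $ i\<bar>
            \<le> \<bar>(\<chi> i. norm (w $ i)) $ i\<bar>" for i
          using s[of i] by (cases "x k $ i = 0") auto
        show "\<bar>(\<chi> i. norm ((w - (real (m - Suc k) / real (Suc s)) *\<^sub>R x k) $ i)) $ i0\<bar>
            < \<bar>(\<chi> i. norm (w $ i)) $ i0\<bar>" using s[OF i0] by simp
      qed
      also have "\<dots> \<le> \<psi> (\<chi> i. \<Sum>j=Suc k..<m. norm (x j $ i))"
        unfolding psi_norm_def w_def by (rule psi_mono) (simp add: order_trans[OF norm_sum abs_ge_self])
      also have "\<dots> \<le> (\<Sum>j=Suc k..<m. psi_norm \<psi> (x j))" by (rule psi_norm_sum) simp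
      also have "\<dots> \<le> (\<Sum>j=Suc k..<m. 1)" by (intro sum_mono le1)
      finally show False using ge2[OF k, of s] by (simp add: w_def)
    qed
    then obtain I where I: "\<And>s. x k $ I s \<noteq> 0"
      "\<And>s. norm (w $ I s - (real (m - Suc k) / real (Suc s)) *\<^sub>R (x k $ I s)) \<ge> norm (w $ I s)" by metis
    \<comment> \<open>The coordinate may depend on \<open>s\<close>; one that occurs for infinitely
      many \<open>s\<close> serves arbitrarily small multiples.\<close>
    obtain i where i: "infinite {s. I s = i}"
      using pigeonhole_infinite[of "UNIV :: nat set" I] by auto
    obtain s0 where "I s0 = i" using i not_finite_existsD by blast
    show ?thesis
    proof (intro exI[of _ i] conjI allI impI)
      show "x k $ i \<noteq> 0" using I(1)[of s0] \<open>I s0 = i\<close> by simp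
      fix \<eta> :: real assume "\<eta> > 0"
      obtain n :: nat where n: "real (m - Suc k) / \<eta> < real n" using reals_Archimedean2 by blast
      obtain s where s: "n \<le> s" "I s = i" using i by (auto simp: infinite_nat_iff_unbounded_le)
      have "real (m - Suc k) / real (Suc s) < \<eta>"
      proof -
        have "real (m - Suc k) / \<eta> < real (Suc s)" using n s(1) by linarith
        then show ?thesis using \<open>\<eta> > 0\<close> by (simp add: field_simps)
      qed
      moreover have "0 < real (m - Suc k) / real (Suc s)" using k by simp
      ultimately show "\<exists>\<alpha>. 0 < \<alpha> \<and> \<alpha> < \<eta> \<and>
          norm ((\<Sum>j=Suc k..<m. x j $ i) - \<alpha> *\<^sub>R (x k $ i)) \<ge> norm (\<Sum>j=Suc k..<m. x j $ i)"
        using I(2)[of s] unfolding wi s(2) by blast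
    qed
  qed
  then obtain I where I: "\<And>k. Suc k < m \<Longrightarrow> x k $ I k \<noteq> 0"
    "\<And>k \<eta>. Suc k < m \<Longrightarrow> \<eta> > 0 \<Longrightarrow> \<exists>\<alpha>. 0 < \<alpha> \<and> \<alpha> < \<eta> \<and>
      norm ((\<Sum>j=Suc k..<m. x j $ I k) - \<alpha> *\<^sub>R (x k $ I k)) \<ge> norm (\<Sum>j=Suc k..<m. x j $ I k)" by metis
  \<comment> \<open>The last index has no successor, so \<open>m - 1\<close> steps are available:
    twice the number of coordinates plus one. Hence some coordinate is chosen three times.\<close>
  have "\<exists>i. card {k \<in> {..<m - 1}. I k = i} \<ge> 3"
  proof (rule ccontr)
    assume "\<not> ?thesis"
    then have c: "card {k \<in> {..<m - 1}. I k = i} \<le> 2" for i by (metis Suc_leI not_less_eq_eq numeral_2_eq_2 numeral_3_eq_3)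
    have "m - 1 = card (\<Union>i\<in>UNIV. {k \<in> {..<m - 1}. I k = i})"
    proof -
      have "(\<Union>i\<in>UNIV. {k \<in> {..<m - 1}. I k = i}) = {..<m - 1}" by auto
      then show ?thesis by simp
    qed
    also have "\<dots> \<le> (\<Sum>i\<in>UNIV. card {k \<in> {..<m - 1}. I k = i})" by (rule card_UN_le) simp
    also have "\<dots> \<le> (\<Sum>i\<in>(UNIV :: 'r set). 2)" by (intro sum_mono c)
    finally show False using m by simp
  qed
  then obtain i where i: "card {k \<in> {..<m - 1}. I k = i} \<ge> 3" by blast
  define A where "A = {k \<in> {..<m - 1}. I k = i}"
  have "finite A" "card A \<ge> 3" using i by (simp_all add: A_def)
  then have finA: "finite A" "A \<noteq> {}" "card A \<ge> 3" by auto
  have "\<not> A \<subseteq> {Min A, Max A}"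
  proof
    assume "A \<subseteq> {Min A, Max A}"
    then have "card A \<le> card {Min A, Max A}" by (intro card_mono) auto
    also have "\<dots> \<le> 2" by (simp add: card_insert_if)
    finally show False using finA by simp
  qed
  then obtain k2 where k2: "k2 \<in> A" "k2 \<noteq> Min A" "k2 \<noteq> Max A" by blast
  have k13: "Min A \<in> A" "Max A \<in> A" using finA by simp_all
  have lt: "Min A < k2" "k2 < Max A" using k2 finA(1) Min_le[of A k2] Max_ge[of A k2] by (simp_all add: order_less_le)
  have inA: "Suc k < m \<and> I k = i" if "k \<in> A" for k using that by (auto simp: A_def)
  interpret noncreasy "W i" "\<Phi> i" by standard (rule nc)
  show False
  proof (rule no_three[of "\<lambda>j. x j $ i" m "Min A" k2 "Max A"])
    show "norm (\<Sum>j=k..<m. x j $ i) = (\<Sum>j=k..<m. norm (x j $ i))" if "k < m" for k using eq[OF that, of i] by simp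
    show "x (Min A) $ i \<noteq> 0" "x k2 $ i \<noteq> 0" "x (Max A) $ i \<noteq> 0" using I(1) inA k13 k2(1) by metis+
    show "\<exists>\<alpha>. 0 < \<alpha> \<and> \<alpha> < \<eta> \<and> norm ((\<Sum>j=Suc k..<m. x j $ i) - \<alpha> *\<^sub>R (x k $ i)) \<ge> norm (\<Sum>j=Suc k..<m. x j $ i)"
      if "k \<in> {Min A, k2}" "\<eta> > 0" for k \<eta> using I(2)[of k \<eta>] inA[of k] k13 k2(1) that by auto
    show "Max A < m" using inA[OF k13(2)] by simp
  qed (use mem lt in auto)
qed

end

section \<open>Direct sums: compactness of closed convex sets\<close>

definition bdd_in :: "'z::real_normed_vector set \<Rightarrow> (nat \<Rightarrow> 'z) \<Rightarrow> bool" where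
  "bdd_in E v \<longleftrightarrow> bounded (range v) \<and> (\<forall>n. v n \<in> E)"

lemma bdd_inI: "(\<And>n. norm (v n) \<le> B) \<Longrightarrow> (\<And>n. v n \<in> E) \<Longrightarrow> bdd_in E v"
  by (auto simp: bdd_in_def bounded_iff)

lemma bdd_in_lin:
  assumes "subspace E" "bdd_in E u" "bdd_in E v"
  shows "bdd_in E (\<lambda>n. u n + v n)" "bdd_in E (\<lambda>n. u n - v n)" "bdd_in E (\<lambda>n. c *\<^sub>R u n)"
  using assms by (auto simp: bdd_in_def bounded_range_plus bounded_range_minus bounded_range_scaleR
      subspace_add subspace_diff subspace_scale)

lemma bdd_in_sum:
  assumes "subspace E" "finite A" "\<And>j. j \<in> A \<Longrightarrow> bdd_in E (v j)"
  shows "bdd_in E (\<lambda>n. \<Sum>j\<in>A. v j n)"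
  using assms(2,3)
proof (induction A)
  case empty
  then show ?case using assms(1) by (auto simp: bdd_in_def subspace_0)
next
  case (insert j A)
  then show ?case using bdd_in_lin(1)[OF assms(1), of "v j" "\<lambda>n. \<Sum>j\<in>A. v j n"] by simp
qed

locale unc_sum = strict_psi \<psi> for \<psi> :: "real^'r::finite \<Rightarrow> real" +
  fixes S :: "'r \<Rightarrow> 'a::real_normed_vector set"
  assumes subS: "\<And>i. subspace (S i)" and uncS: "\<And>i. unif_noncreasy (S i)"
begin

text \<open>Two ultrapowers: the inner one receives the isometric image of a separable subspace, the
  outer one the limits of bounded sequences in that image.\<close>

definition W :: "'r \<Rightarrow> 'a ultra ultra set" where
  "W i = ultra_set (ultra_set (S i))"

definition \<Phi> :: "'r \<Rightarrow> ('a ultra ultra \<Rightarrow> real) set" where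
  "\<Phi> i = ultra_dual (ultra_set (S i)) (ultra_dual (S i) (dual_sphere (S i)))"

lemma ncW: "noncreasy_wrt (W i) (\<Phi> i)"
  unfolding W_def \<Phi>_def by (intro noncreasy_wrt_ultra noncreasy_wrt_dual_sphere subS uncS)

text \<open>Asymptotic inequalities for sequences in a separable subspace become exact ones for
  their images under \<open>K\<close>, where noncreasiness of the coordinates applies.
  \<open>N i\<close> measures the \<open>i\<close>-th coordinate of single vectors, so that indices
  can be picked by coordinate norms before any limit is taken.\<close>

lemma ex_embed_sequences:
  fixes b :: "nat \<Rightarrow> 'z::real_normed_vector"
  assumes fr: "fin_rep TYPE('z) (psi_sum S) (psi_norm \<psi>)"
  defines "D \<equiv> bdd_in (span (range b))"
  shows "\<exists>(N :: 'r \<Rightarrow> 'z \<Rightarrow> real) (K :: (nat \<Rightarrow> 'z) \<Rightarrow> ('a ultra ultra)^'r).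
    (\<forall>i x. x \<in> span (range b) \<longrightarrow> 0 \<le> N i x \<and> N i x \<le> norm x) \<and>
    (\<forall>v i. D v \<longrightarrow> K v $ i \<in> W i) \<and>
    (\<forall>v. D v \<longrightarrow> ((\<lambda>n. norm (v n)) \<longlongrightarrow> psi_norm \<psi> (K v)) \<U>) \<and>
    (\<forall>v i. D v \<longrightarrow> ((\<lambda>n. N i (v n)) \<longlongrightarrow> norm (K v $ i)) \<U>) \<and>
    (\<forall>u v. D u \<longrightarrow> D v \<longrightarrow> K (\<lambda>n. u n + v n) = K u + K v) \<and>
    (\<forall>c v. D v \<longrightarrow> K (\<lambda>n. c *\<^sub>R v n) = c *\<^sub>R K v)"
proof -
  obtain J :: "'z \<Rightarrow> ('a ultra)^'r" where J:
    "\<And>x i. x \<in> span (range b) \<Longrightarrow> J x $ i \<in> ultra_set (S i)"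
    "\<And>x. x \<in> span (range b) \<Longrightarrow> psi_norm \<psi> (J x) = norm x"
    "\<And>x y. x \<in> span (range b) \<Longrightarrow> y \<in> span (range b) \<Longrightarrow> J (x + y) = J x + J y"
    "\<And>c x. x \<in> span (range b) \<Longrightarrow> J (c *\<^sub>R x) = c *\<^sub>R J x"
    using embed_countable[OF fr subS, of b] by blast
  define K :: "(nat \<Rightarrow> 'z) \<Rightarrow> ('a ultra ultra)^'r" where "K v = (\<chi> i. ucls (\<lambda>n. J (v n) $ i))" for v
  have Jle: "norm (J x $ i) \<le> norm x" if "x \<in> span (range b)" for x i
    using psi_component[of "\<chi> i. norm (J x $ i)" i] J(2)[OF that] by (simp add: psi_norm_def)
  have bd: "bounded (range (\<lambda>n. J (v n) $ i))" if v: "D v" for v i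
  proof -
    obtain B where "\<And>n. norm (v n) \<le> B" using v by (auto simp: D_def bdd_in_def bounded_iff)
    moreover have "v n \<in> span (range b)" for n using v by (simp add: D_def bdd_in_def)
    ultimately have "norm (J (v n) $ i) \<le> B" for n using order_trans[OF Jle] by blast
    then show ?thesis by (auto simp: bounded_iff)
  qed
  show ?thesis
  proof (intro exI[of _ "\<lambda>i x. norm (J x $ i)"] exI[of _ K] conjI allI impI)
    fix v i assume v: "D v"
    then have vs: "v n \<in> span (range b)" for n by (simp add: D_def bdd_in_def)
    show "K v $ i \<in> W i" unfolding W_def K_def by (simp add: ultra_setI[OF bd[OF v]] J(1)[OF vs])
    have lim: "((\<lambda>n. norm (J (v n) $ i)) \<longlongrightarrow> norm (K v $ i)) \<U>" for i
      using ucls_norm[OF bd[OF v, of i]] by (simp add: K_def)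
    then show "((\<lambda>n. norm (J (v n) $ i)) \<longlongrightarrow> norm (K v $ i)) \<U>" .
    have "((\<lambda>n. psi_norm \<psi> (J (v n))) \<longlongrightarrow> psi_norm \<psi> (K v)) \<U>"
      unfolding psi_norm_def by (rule psi_tendsto) (simp add: lim)
    then show "((\<lambda>n. norm (v n)) \<longlongrightarrow> psi_norm \<psi> (K v)) \<U>" by (simp add: J(2) vs)
  next
    fix u v assume u: "D u" and v: "D v"
    then have "u n \<in> span (range b)" "v n \<in> span (range b)" for n by (simp_all add: D_def bdd_in_def)
    then show "K (\<lambda>n. u n + v n) = K u + K v"
      by (simp add: K_def vec_eq_iff J(3) ucls_plus[OF bd[OF u] bd[OF v], symmetric])
  next
    fix c v assume v: "D v"
    then have "v n \<in> span (range b)" for n by (simp add: D_def bdd_in_def)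
    then show "K (\<lambda>n. c *\<^sub>R v n) = c *\<^sub>R K v"
      by (simp add: K_def vec_eq_iff J(4) ucls_scaleR[OF bd[OF v], symmetric])
  qed (use Jle in auto)
qed

end

locale seq_embedding = unc_sum \<psi> S for \<psi> :: "real^'r::finite \<Rightarrow> real" and S :: "'r \<Rightarrow> 'a::real_normed_vector set" +
  fixes b :: "nat \<Rightarrow> 'z::real_normed_vector"
    and N :: "'r \<Rightarrow> 'z \<Rightarrow> real" and K :: "(nat \<Rightarrow> 'z) \<Rightarrow> ('a ultra ultra)^'r"
  assumes emb: "(\<forall>i x. x \<in> span (range b) \<longrightarrow> 0 \<le> N i x \<and> N i x \<le> norm x) \<and>
    (\<forall>v i. bdd_in (span (range b)) v \<longrightarrow> K v $ i \<in> W i) \<and>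
    (\<forall>v. bdd_in (span (range b)) v \<longrightarrow> ((\<lambda>n. norm (v n)) \<longlongrightarrow> psi_norm \<psi> (K v)) \<U>) \<and>
    (\<forall>v i. bdd_in (span (range b)) v \<longrightarrow> ((\<lambda>n. N i (v n)) \<longlongrightarrow> norm (K v $ i)) \<U>) \<and>
    (\<forall>u v. bdd_in (span (range b)) u \<longrightarrow> bdd_in (span (range b)) v \<longrightarrow> K (\<lambda>n. u n + v n) = K u + K v) \<and>
    (\<forall>c v. bdd_in (span (range b)) v \<longrightarrow> K (\<lambda>n. c *\<^sub>R v n) = c *\<^sub>R K v)"
begin

abbreviation D where "D \<equiv> bdd_in (span (range b))"

lemma N_bounds: "x \<in> span (range b) \<Longrightarrow> 0 \<le> N i x" "x \<in> span (range b) \<Longrightarrow> N i x \<le> norm x"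
  and K_in: "D v \<Longrightarrow> K v $ i \<in> W i"
  and K_norm: "D v \<Longrightarrow> ((\<lambda>n. norm (v n)) \<longlongrightarrow> psi_norm \<psi> (K v)) \<U>"
  and K_N: "D v \<Longrightarrow> ((\<lambda>n. N i (v n)) \<longlongrightarrow> norm (K v $ i)) \<U>"
  and K_plus: "D u \<Longrightarrow> D v \<Longrightarrow> K (\<lambda>n. u n + v n) = K u + K v"
  and K_scale: "D v \<Longrightarrow> K (\<lambda>n. c *\<^sub>R v n) = c *\<^sub>R K v"
  using emb by simp_all

lemma D_sub: "subspace (span (range b))" by simp
lemmas D_lin = bdd_in_lin[OF D_sub]

lemma K_minus: "D u \<Longrightarrow> D v \<Longrightarrow> K (\<lambda>n. u n - v n) = K u - K v"
  using K_plus[of u "\<lambda>n. (-1) *\<^sub>R v n"] K_scale[of v "-1"] D_lin(3)[of v v "-1"] by simp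

lemma K_sum: "finite A \<Longrightarrow> (\<And>j. j \<in> A \<Longrightarrow> D (v j)) \<Longrightarrow> K (\<lambda>n. \<Sum>j\<in>A. v j n) = (\<Sum>j\<in>A. K (v j))"
proof (induction A rule: finite_induct)
  case empty
  have D0: "D (\<lambda>n. 0)" by (auto simp: bdd_in_def span_zero)
  have "K (\<lambda>n. 0 *\<^sub>R 0) = 0 *\<^sub>R K (\<lambda>n. 0)" using K_scale[OF D0, of 0] by simp
  then show ?case by simp
next
  case (insert j A)
  then show ?case using K_plus[of "v j" "\<lambda>n. \<Sum>j\<in>A. v j n"] bdd_in_sum[OF D_sub, of A v] by simp
qed

lemma K_norm_le: "D v \<Longrightarrow> eventually (\<lambda>n. norm (v n) \<le> f n) \<U> \<Longrightarrow> (f \<longlongrightarrow> c) \<U> \<Longrightarrow> psi_norm \<psi> (K v) \<le> c"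
  by (rule tendsto_le[OF freeuf_bot _ K_norm])

lemma K_norm_ge: "D v \<Longrightarrow> eventually (\<lambda>n. norm (v n) \<ge> f n) \<U> \<Longrightarrow> (f \<longlongrightarrow> c) \<U> \<Longrightarrow> psi_norm \<psi> (K v) \<ge> c"
  by (rule tendsto_le[OF freeuf_bot K_norm])

end

lemma freeuf_inverse_Suc: "((\<lambda>n. 1 / real (Suc n)) \<longlongrightarrow> 0) \<U>"
  using tendsto_freeufI[OF LIMSEQ_inverse_real_of_nat] by (simp add: inverse_eq_divide)

context unc_sum
begin

lemma no_james_sequences:
  fixes x :: "nat \<Rightarrow> nat \<Rightarrow> 'z::real_normed_vector"
  assumes fr: "fin_rep TYPE('z) (psi_sum S) (psi_norm \<psi>)" and m: "m = 2 * CARD('r) + 2"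
    and le: "\<And>n j. norm (x n j) \<le> 1 + 1 / real (Suc n)"
    and ge: "\<And>n l. l < m \<Longrightarrow> norm (\<Sum>j=l..<m. x n j) \<ge> real (m - l) * (1 - 1 / real (Suc n))"
    and ge2: "\<And>n k s. Suc k < m \<Longrightarrow> s \<le> n \<Longrightarrow>
      norm ((\<Sum>j=Suc k..<m. x n j) - (real (m - Suc k) / real (Suc s)) *\<^sub>R x n k)
        \<ge> real (m - Suc k) * (1 - 1 / real (Suc n))"
  shows False
proof -
  \<comment> \<open>The vectors of all configurations together are countable, so a single embedding
    serves every \<open>n\<close>.\<close>
  define b where "b k = (case prod_decode k of (n, j) \<Rightarrow> x n j)" for k
  obtain N :: "'r \<Rightarrow> 'z \<Rightarrow> real" and K :: "(nat \<Rightarrow> 'z) \<Rightarrow> ('a ultra ultra)^'r"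
    where NK: "seq_embedding \<psi> S b N K"
    using ex_embed_sequences[OF fr, of b] unc_sum_axioms
    unfolding seq_embedding_def seq_embedding_axioms_def by blast
  interpret E: seq_embedding \<psi> S b N K by (rule NK)
  have xb: "x n j \<in> span (range b)" for n j
  proof -
    have "b (prod_encode (n, j)) = x n j" by (simp add: b_def)
    then show ?thesis by (metis rangeI span_base)
  qed
  have n2: "norm (x n j) \<le> 2" for n j
  proof -
    have "1 / real (Suc n) \<le> 1" by simp
    then show ?thesis using le[of n j] by linarith
  qed
  define v where "v j n = x n j" for j n
  have Dv: "E.D (v j)" for j unfolding v_def by (rule bdd_inI[OF n2 xb])
  have Ds: "E.D (\<lambda>n. \<Sum>j=l..<m. v j n)" for l by (rule bdd_in_sum[OF E.D_sub _ Dv]) simp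
  have Ks: "(\<Sum>j=l..<m. K (v j)) = K (\<lambda>n. \<Sum>j=l..<m. v j n)" for l
    by (rule E.K_sum[symmetric]) (simp_all add: Dv)
  have lim: "((\<lambda>n. real c * (1 - 1 / real (Suc n))) \<longlongrightarrow> real c) \<U>" for c
    using tendsto_mult[OF tendsto_const[of "real c"] tendsto_diff[OF tendsto_const[of 1] freeuf_inverse_Suc]] by simp
  show False
  proof (rule no_james_configuration[OF ncW _ m, of "\<lambda>j. K (v j)"])
    show "K (v j) $ i \<in> W i" for j i by (rule E.K_in[OF Dv])
    show "psi_norm \<psi> (K (v j)) \<le> 1" for j
      by (rule E.K_norm_le[OF Dv, where f = "\<lambda>n. 1 + 1 / real (Suc n)"])
         (use le tendsto_add[OF tendsto_const[of 1] freeuf_inverse_Suc] in \<open>simp_all add: v_def\<close>)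
    show "real (m - l) \<le> psi_norm \<psi> (\<Sum>j=l..<m. K (v j))" if "l < m" for l
      unfolding Ks by (rule E.K_norm_ge[OF Ds _ lim]) (use ge[OF that] in \<open>simp add: v_def\<close>)
    show "real (m - Suc k) \<le> psi_norm \<psi> ((\<Sum>j=Suc k..<m. K (v j)) - (real (m - Suc k) / real (Suc s)) *\<^sub>R K (v k))"
      if k: "Suc k < m" for k s
    proof -
      let ?c = "real (m - Suc k) / real (Suc s)"
      have Dk: "E.D (\<lambda>n. ?c *\<^sub>R v k n)" by (rule E.D_lin(3)[OF Dv Dv])
      have eq: "(\<Sum>j=Suc k..<m. K (v j)) - ?c *\<^sub>R K (v k) = K (\<lambda>n. (\<Sum>j=Suc k..<m. v j n) - ?c *\<^sub>R v k n)"
        unfolding Ks E.K_scale[OF Dv, symmetric] by (rule E.K_minus[OF Ds Dk, symmetric])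
      show ?thesis unfolding eq
      proof (rule E.K_norm_ge[OF E.D_lin(2)[OF Ds Dk] _ lim])
        show "\<forall>\<^sub>F n in \<U>. real (m - Suc k) * (1 - 1 / real (Suc n)) \<le> norm ((\<Sum>j=Suc k..<m. v j n) - ?c *\<^sub>R v k n)"
          using freeuf_ge[of s] by (rule eventually_mono) (use ge2[OF k] in \<open>simp add: v_def\<close>)
      qed
    qed
  qed
qed

text \<open>The points come from a decreasing sequence of members of \<open>M\<close>, each avoiding
  the \<rho>-balls about \<open>p\<close> and about finitely many points between \<open>p\<close>
  and the earlier choices. By convexity the averages of later points stay in the same set and avoid
  the same balls; multiplied by the number of terms, this is the conclusion.\<close>

lemma james_sequence:
  fixes M :: "'z::real_normed_vector set set" and d \<eta> r :: real
  assumes M: "{} \<notin> M" "\<And>A B. A \<in> M \<Longrightarrow> B \<in> M \<Longrightarrow> A \<inter> B \<in> M" and cvx: "\<And>A. A \<in> M \<Longrightarrow> convex A"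
    and ball: "cball p r \<in> M" and d: "d > 0"
    and far: "\<And>v. \<exists>A\<in>M. \<forall>a\<in>A. norm (a - v) > \<rho>"
  obtains X where "\<And>j. norm (X j - p) \<le> r"
    "\<And>l m. l < m \<Longrightarrow> norm ((\<Sum>j=l..<m. X j - p)) \<ge> real (m - l) * \<rho>"
    "\<And>k m s. Suc k < m \<Longrightarrow> s \<le> n \<Longrightarrow>
      norm ((\<Sum>j=Suc k..<m. X j - p) - (real (m - Suc k) / real (Suc s)) *\<^sub>R (X k - p)) \<ge> real (m - Suc k) * \<rho>"
proof -
  define V where "V f k = insert p ((\<lambda>(j, s). p + (1 / real (Suc s)) *\<^sub>R (fst (f j) - p)) ` ({..<k} \<times> {..n}))"
    for f :: "nat \<Rightarrow> 'z \<times> 'z set" and k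
  define P where "P f k r' \<longleftrightarrow> snd r' \<in> M \<and> snd r' \<subseteq> cball p r \<and> fst r' \<in> snd r' \<and> (\<forall>j<k. snd r' \<subseteq> snd (f j)) \<and>
     (\<forall>v\<in>V f k. \<forall>a\<in>snd r'. norm (a - v) > \<rho>)" for f k and r' :: "'z \<times> 'z set"
  have farF: "\<exists>A\<in>M. \<forall>v\<in>F. \<forall>a\<in>A. norm (a - v) > \<rho>" if "finite F" for F
    using that
  proof (induction F)
    case empty then show ?case using ball by blast
  next
    case (insert v F)
    then obtain A where A: "A \<in> M" "\<forall>v\<in>F. \<forall>a\<in>A. norm (a - v) > \<rho>" by blast
    obtain B where B: "B \<in> M" "\<forall>a\<in>B. norm (a - v) > \<rho>" using far by blast
    show ?case by (rule bexI[OF _ M(2)[OF A(1) B(1)]]) (use A B in auto)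
  qed
  have "\<exists>f. \<forall>k. P f k (f k)"
  proof (rule dependent_wellorder_choice)
    fix r' :: "'z \<times> 'z set" and f g :: "nat \<Rightarrow> 'z \<times> 'z set" and k :: nat
    assume "\<And>y. y < k \<Longrightarrow> f y = g y"
    then have "V f k = V g k"
      unfolding V_def by (intro arg_cong[of _ _ "insert p"] image_cong) auto
    moreover have "\<forall>j<k. snd (f j) = snd (g j)" using \<open>\<And>y. y < k \<Longrightarrow> f y = g y\<close> by simp
    ultimately show "P f k r' = P g k r'" by (simp add: P_def)
  next
    fix k :: nat and f assume IH: "\<And>y. y < k \<Longrightarrow> P f y (f y)"
    have "finite (V f k)" by (simp add: V_def)
    then obtain A where A: "A \<in> M" "\<forall>v\<in>V f k. \<forall>a\<in>A. norm (a - v) > \<rho>" using farF by blast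
    \<comment> \<open>The sets decrease, so intersecting with the previous one is enough; only the
      first has to be cut to the ball.\<close>
    define B where "B = (if k = 0 then A \<inter> cball p r else A \<inter> snd (f (k - 1)))"
    have BM: "B \<in> M" using A(1) ball IH[of "k - 1"] M(2) by (auto simp: B_def P_def)
    then obtain a where "a \<in> B" using M(1) by (metis all_not_in_conv)
    have "B \<subseteq> cball p r"
    proof (cases "k = 0")
      case False
      then have "snd (f (k - 1)) \<subseteq> cball p r" using IH[of "k - 1"] by (simp add: P_def)
      then show ?thesis using False by (auto simp: B_def)
    qed (simp add: B_def)
    moreover have "B \<subseteq> snd (f j)" if "j < k" for j
    proof (cases "j = k - 1")
      case False
      then have "j < k - 1" using that by simp
      then have "snd (f (k - 1)) \<subseteq> snd (f j)" using IH[of "k - 1"] that by (simp add: P_def)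
      then show ?thesis using that by (auto simp: B_def)
    qed (use that in \<open>auto simp: B_def\<close>)
    moreover have "B \<subseteq> A" by (auto simp: B_def)
    ultimately have "P f k (a, B)" using BM \<open>a \<in> B\<close> A(2) by (auto simp: P_def)
    then show "\<exists>r'. P f k r'" by blast
  qed
  then obtain f where f: "\<And>k. P f k (f k)" by blast
  define X where "X k = fst (f k)" for k
  define A where "A k = snd (f k)" for k
  have A: "A k \<in> M" "A k \<subseteq> cball p r" "X k \<in> A k" "j < k \<Longrightarrow> A k \<subseteq> A j"
    "a \<in> A k \<Longrightarrow> norm (a - p) > \<rho>"
    "j < k \<Longrightarrow> s \<le> n \<Longrightarrow> a \<in> A k \<Longrightarrow> norm (a - (p + (1 / real (Suc s)) *\<^sub>R (X j - p))) > \<rho>" for j k s a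
  proof -
    have *: "P f k (f k)" by (rule f)
    show "A k \<in> M" "A k \<subseteq> cball p r" "X k \<in> A k" "j < k \<Longrightarrow> A k \<subseteq> A j" "a \<in> A k \<Longrightarrow> norm (a - p) > \<rho>"
      using * by (auto simp: P_def A_def X_def V_def)
    assume "j < k" "s \<le> n" "a \<in> A k"
    then have "p + (1 / real (Suc s)) *\<^sub>R (X j - p) \<in> V f k" by (force simp: V_def X_def)
    then show "norm (a - (p + (1 / real (Suc s)) *\<^sub>R (X j - p))) > \<rho>"
      using * \<open>a \<in> A k\<close> unfolding P_def A_def by blast
  qed
  define avg where "avg l m = (1 / real (m - l)) *\<^sub>R (\<Sum>j=l..<m. X j)" for l m
  have avgA: "avg l m \<in> A l" if "l < m" for l m
  proof -
    have "(\<Sum>j\<in>{l..<m}. (1 / real (m - l)) *\<^sub>R X j) \<in> A l"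
    proof (rule convex_sum)
      show "convex (A l)" by (rule cvx[OF A(1)])
      show "X j \<in> A l" if "j \<in> {l..<m}" for j using that A(3)[of j] A(4)[of l j] by (cases "j = l") auto
    qed (use that in auto)
    then show ?thesis by (simp add: avg_def scaleR_sum_right)
  qed
  have sumX: "(\<Sum>j=l..<m. X j - p) = real (m - l) *\<^sub>R (avg l m - p)" if "l < m" for l m
    using that by (simp add: avg_def sum_subtractf scaleR_diff_right sum_constant_scaleR of_nat_diff)
  show thesis
  proof (rule that[of X])
    show "norm (X j - p) \<le> r" for j using A(2)[of j] A(3)[of j] by (auto simp: dist_norm norm_minus_commute)
    show "real (m - l) * \<rho> \<le> norm (\<Sum>j=l..<m. X j - p)" if "l < m" for l m
      unfolding sumX[OF that] using A(5)[OF avgA[OF that]] by (simp add: mult_left_mono)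
    show "real (m - Suc k) * \<rho> \<le> norm ((\<Sum>j=Suc k..<m. X j - p) - (real (m - Suc k) / real (Suc s)) *\<^sub>R (X k - p))"
      if k: "Suc k < m" and s: "s \<le> n" for k m s
    proof -
      have "(\<Sum>j=Suc k..<m. X j - p) - (real (m - Suc k) / real (Suc s)) *\<^sub>R (X k - p)
         = real (m - Suc k) *\<^sub>R (avg (Suc k) m - (p + (1 / real (Suc s)) *\<^sub>R (X k - p)))"
        unfolding sumX[OF k] by (simp add: algebra_simps)
      then show ?thesis using A(6)[OF _ s avgA[OF k], of k] by (simp add: mult_left_mono)
    qed
  qed
qed

text \<open>In a maximal family of closed convex sets let \<open>d\<close> be the infimum of the
  radii of its balls. If \<open>d > 0\<close>, a ball of the family with radius just above
  \<open>d\<close>, and the fact that by maximality every smaller ball is missed by some member,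
  produce James configurations. If \<open>d = 0\<close>, the centres of shrinking balls form a
  Cauchy sequence, whose limit lies in all members.\<close>

theorem closed_convex_fip:
  fixes \<A> :: "'z::banach set set"
  assumes fr: "fin_rep TYPE('z) (psi_sum S) (psi_norm \<psi>)"
    and cc: "\<And>A. A \<in> \<A> \<Longrightarrow> closed A \<and> convex A" and A0: "A0 \<in> \<A>" "bounded A0"
    and fip: "\<And>F. finite F \<Longrightarrow> F \<subseteq> \<A> \<Longrightarrow> \<Inter>F \<noteq> {}"
  shows "\<Inter>\<A> \<noteq> {}"
proof -
  define \<C> where "\<C> = {A :: 'z set. closed A \<and> convex A}"
  have "\<exists>M. \<A> \<subseteq> M \<and> M \<subseteq> \<C> \<and> {} \<notin> M \<and> (\<forall>A\<in>M. \<forall>B\<in>M. A \<inter> B \<in> M) \<and>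
    (\<forall>B\<in>\<C>. (\<forall>A\<in>M. A \<inter> B \<noteq> {}) \<longrightarrow> B \<in> M)" (is "\<exists>M. ?Q M")
    by (rule maximal_fip_family) (use cc A0 fip in \<open>auto simp: \<C>_def closed_Int convex_Int\<close>)
  then obtain M where "?Q M" ..
  then have M: "\<A> \<subseteq> M" "M \<subseteq> \<C>" "{} \<notin> M" "\<And>A B. A \<in> M \<Longrightarrow> B \<in> M \<Longrightarrow> A \<inter> B \<in> M"
    "\<And>B. B \<in> \<C> \<Longrightarrow> (\<forall>A\<in>M. A \<inter> B \<noteq> {}) \<Longrightarrow> B \<in> M" by simp_all
  have ballM: "cball p r \<in> M" if "\<forall>A\<in>M. A \<inter> cball p r \<noteq> {}" for p r
    by (rule M(5)[OF _ that]) (simp add: \<C>_def)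
  define R where "R = {r. 0 \<le> r \<and> (\<exists>p. cball p r \<in> M)}"
  define d where "d = Inf R"
  have "R \<noteq> {}"
  proof -
    obtain p r where r: "A0 \<subseteq> cball p r" using A0(2) by (auto simp: bounded_def subset_eq)
    have "A \<inter> cball p (max r 0) \<noteq> {}" if "A \<in> M" for A
    proof -
      have "A \<inter> A0 \<in> M" using that A0(1) M(1,4) by blast
      then have "A \<inter> A0 \<noteq> {}" using M(3) by metis
      then show ?thesis using r by (force simp: le_max_iff_disj)
    qed
    then have "cball p (max r 0) \<in> M" by (intro ballM ballI)
    then have "max r 0 \<in> R" unfolding R_def by auto
    then show ?thesis by blast
  qed
  have bdd: "bdd_below R" by (auto simp: R_def bdd_below_def)
  have d0: "d \<ge> 0" unfolding d_def using \<open>R \<noteq> {}\<close> by (intro cInf_greatest) (auto simp: R_def)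
  have near: "\<exists>p r. cball p r \<in> M \<and> 0 \<le> r \<and> r < d + e" if "e > 0" for e
  proof -
    have "Inf R < d + e" using that by (simp add: d_def)
    then obtain r where "r \<in> R" "r < d + e" using cInf_lessD[OF \<open>R \<noteq> {}\<close>] by blast
    then show ?thesis by (auto simp: R_def)
  qed
  have "d = 0"
  proof (rule ccontr)
    assume "d \<noteq> 0"
    then have d: "d > 0" using d0 by simp
    define m where "m = 2 * CARD('r) + 2"
    have "\<exists>x :: nat \<Rightarrow> 'z. (\<forall>j. norm (x j) \<le> 1 + 1 / real (Suc n)) \<and>
      (\<forall>l<m. norm (\<Sum>j=l..<m. x j) \<ge> real (m - l) * (1 - 1 / real (Suc n))) \<and>
      (\<forall>k s. Suc k < m \<longrightarrow> s \<le> n \<longrightarrow>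
      norm ((\<Sum>j=Suc k..<m. x j) - (real (m - Suc k) / real (Suc s)) *\<^sub>R x k)
        \<ge> real (m - Suc k) * (1 - 1 / real (Suc n)))" for n
    proof -
      \<comment> \<open>Radii \<open>d * (1 - 1 / real (Suc n))\<close> and
        \<open>d * (1 + 1 / real (Suc n))\<close> turn into the tolerances of
        \<open>no_james_sequences\<close> after scaling by \<open>1 / d\<close>.\<close>
      define \<rho> where "\<rho> = d * (1 - 1 / real (Suc n))"
      have \<rho>: "\<rho> \<ge> 0" "\<rho> < d" using d by (simp_all add: \<rho>_def field_simps)
      obtain p r where pr: "cball p r \<in> M" "0 \<le> r" "r < d + d / real (Suc n)"
        using near[of "d / real (Suc n)"] d by auto
      have far: "\<exists>A\<in>M. \<forall>a\<in>A. norm (a - v) > \<rho>" for v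
      proof (rule ccontr)
        assume far: "\<not> ?thesis"
        have "A \<inter> cball v \<rho> \<noteq> {}" if A: "A \<in> M" for A
        proof -
          obtain a where "a \<in> A" "norm (a - v) \<le> \<rho>" using far A by (meson not_less)
          then have "a \<in> A \<inter> cball v \<rho>" by (simp add: dist_norm norm_minus_commute)
          then show ?thesis by blast
        qed
        then have "cball v \<rho> \<in> M" by (intro ballM ballI)
        then have "\<rho> \<in> R" using \<rho>(1) by (auto simp: R_def)
        then show False using cInf_lower[OF _ bdd] \<rho>(2) by (force simp: d_def)
      qed
      have cvx: "convex A" if "A \<in> M" for A using that M(2) by (auto simp: \<C>_def)
      obtain X where X: "\<And>j. norm (X j - p) \<le> r"
        "\<And>l m. l < m \<Longrightarrow> norm ((\<Sum>j=l..<m. X j - p)) \<ge> real (m - l) * \<rho>"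
        "\<And>k m s. Suc k < m \<Longrightarrow> s \<le> n \<Longrightarrow>
          norm ((\<Sum>j=Suc k..<m. X j - p) - (real (m - Suc k) / real (Suc s)) *\<^sub>R (X k - p)) \<ge> real (m - Suc k) * \<rho>"
        using james_sequence[OF M(3,4) cvx pr(1) d far, where n = n] by blast
      define x where "x j = (1 / d) *\<^sub>R (X j - p)" for j
      have sx: "(\<Sum>j=l..<m. x j) = (1 / d) *\<^sub>R (\<Sum>j=l..<m. X j - p)" for l by (simp add: x_def scaleR_sum_right)
      have norm_d: "norm ((1 / d) *\<^sub>R v) \<ge> real c * (1 - 1 / real (Suc n))" if "norm v \<ge> real c * \<rho>" for v :: 'z and c
      proof -
        have "(real c * (1 - 1 / real (Suc n))) * d \<le> norm v" using that by (simp add: \<rho>_def mult.commute mult.left_commute)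
        then show ?thesis using d by (simp add: pos_le_divide_eq)
      qed
      show ?thesis
      proof (intro exI[of _ x] conjI allI impI)
        show "norm (x j) \<le> 1 + 1 / real (Suc n)" for j
        proof -
          have "norm (X j - p) \<le> (1 + 1 / real (Suc n)) * d" using X(1)[of j] pr(3) by (simp add: algebra_simps)
          then show ?thesis using d by (simp add: x_def pos_divide_le_eq)
        qed
        show "real (m - l) * (1 - 1 / real (Suc n)) \<le> norm (\<Sum>j=l..<m. x j)" if "l < m" for l
          unfolding sx by (rule norm_d[OF X(2)[OF that]])
        fix k s assume k: "Suc k < m" "s \<le> n"
        have "(\<Sum>j=Suc k..<m. x j) - (real (m - Suc k) / real (Suc s)) *\<^sub>R x k
          = (1 / d) *\<^sub>R ((\<Sum>j=Suc k..<m. X j - p) - (real (m - Suc k) / real (Suc s)) *\<^sub>R (X k - p))"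
          unfolding sx by (simp add: x_def scaleR_diff_right mult.commute)
        then show "real (m - Suc k) * (1 - 1 / real (Suc n))
            \<le> norm ((\<Sum>j=Suc k..<m. x j) - (real (m - Suc k) / real (Suc s)) *\<^sub>R x k)"
          using norm_d[OF X(3)[OF k]] by simp
      qed
    qed
    then obtain x :: "nat \<Rightarrow> nat \<Rightarrow> 'z" where x: "\<And>n j. norm (x n j) \<le> 1 + 1 / real (Suc n)"
      "\<And>n l. l < m \<Longrightarrow> norm (\<Sum>j=l..<m. x n j) \<ge> real (m - l) * (1 - 1 / real (Suc n))"
      "\<And>n k s. Suc k < m \<Longrightarrow> s \<le> n \<Longrightarrow> norm ((\<Sum>j=Suc k..<m. x n j) - (real (m - Suc k) / real (Suc s)) *\<^sub>R x n k)
        \<ge> real (m - Suc k) * (1 - 1 / real (Suc n))" by metis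
    show False by (rule no_james_sequences[OF fr m_def x])
  qed
  have "\<exists>f. \<forall>k. cball (f k) (1 / real (Suc k)) \<in> M"
  proof (intro choice allI)
    fix k
    obtain p r where "cball p r \<in> M" "0 \<le> r" "r < 1 / real (Suc k)" using near[of "1 / real (Suc k)"] \<open>d = 0\<close> by auto
    have "A \<inter> cball p (1 / real (Suc k)) \<noteq> {}" if "A \<in> M" for A
    proof -
      have "A \<inter> cball p r \<in> M" by (rule M(4)[OF that \<open>cball p r \<in> M\<close>])
      then have "A \<inter> cball p r \<noteq> {}" using M(3) by metis
      moreover have "cball p r \<subseteq> cball p (1 / real (Suc k))"
        using \<open>r < 1 / real (Suc k)\<close> by (intro subset_cball) simp
      ultimately show ?thesis by blast
    qed
    then have "cball p (1 / real (Suc k)) \<in> M" by (intro ballM ballI)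
    then show "\<exists>p. cball p (1 / real (Suc k)) \<in> M" ..
  qed
  then obtain f where f: "\<And>k. cball (f k) (1 / real (Suc k)) \<in> M" by blast
  have ff: "dist (f j) (f k) \<le> 1 / real (Suc j) + 1 / real (Suc k)" for j k
  proof -
    have "cball (f j) (1 / real (Suc j)) \<inter> cball (f k) (1 / real (Suc k)) \<noteq> {}" using M(3) M(4)[OF f f] by metis
    then obtain z where "dist (f j) z \<le> 1 / real (Suc j)" "dist (f k) z \<le> 1 / real (Suc k)" by auto
    then show ?thesis using dist_triangle2[of "f j" "f k" z] by linarith
  qed
  have "Cauchy f"
  proof (rule metric_CauchyI)
    fix e :: real assume "e > 0"
    then obtain n where n: "1 / real (Suc n) < e / 2" using reals_Archimedean[of "e / 2"] by (auto simp: inverse_eq_divide)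
    have "dist (f j) (f k) < e" if "n \<le> j" "n \<le> k" for j k
    proof -
      have "1 / real (Suc j) \<le> 1 / real (Suc n)" "1 / real (Suc k) \<le> 1 / real (Suc n)"
        using that by (simp_all add: frac_le)
      then show ?thesis using ff[of j k] n by linarith
    qed
    then show "\<exists>n. \<forall>j\<ge>n. \<forall>k\<ge>n. dist (f j) (f k) < e" by blast
  qed
  then obtain z where z: "f \<longlonglongrightarrow> z" by (metis Cauchy_convergent convergent_def)
  have "z \<in> A" if A: "A \<in> M" for A
  proof -
    have "\<forall>k. \<exists>a\<in>A. dist (f k) a \<le> 1 / real (Suc k)"
    proof
      fix k
      have "A \<inter> cball (f k) (1 / real (Suc k)) \<noteq> {}" using M(3) M(4)[OF A f] by metis
      then show "\<exists>a\<in>A. dist (f k) a \<le> 1 / real (Suc k)" by auto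
    qed
    then obtain a where a: "\<And>k. a k \<in> A" "\<And>k. dist (f k) (a k) \<le> 1 / real (Suc k)" by metis
    have "(\<lambda>k. a k - f k) \<longlonglongrightarrow> 0"
    proof (rule Lim_null_comparison)
      show "\<forall>\<^sub>F k in sequentially. norm (a k - f k) \<le> 1 / real (Suc k)"
        using a(2) by (auto simp: dist_norm norm_minus_commute)
      show "(\<lambda>k. 1 / real (Suc k)) \<longlonglongrightarrow> 0"
        using LIMSEQ_inverse_real_of_nat by (simp add: inverse_eq_divide)
    qed
    then have "a \<longlonglongrightarrow> z" by (rule Lim_transform[OF z])
    moreover have "closed A" using A M(2) by (auto simp: \<C>_def)
    ultimately show ?thesis using a(1) closed_sequentially by blast
  qed
  then show ?thesis using M(1) by blast
qed

end

section \<open>Asymptotically equidistant sequences\<close>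

text \<open>Iterated limits take the place of Ramsey's theorem: with \<open>a\<close> the limit of
  the limits of \<open>q\<close>, four indices are picked in turn, each good enough for all the
  earlier ones. The four become the vectors \<open>c\<close>, \<open>e\<close>, \<open>y\<close>,
  \<open>x\<close> of \<open>coordinate_switch\<close>.\<close>

lemma freeuf_iterated_pick:
  fixes q :: "'r::finite \<Rightarrow> nat \<Rightarrow> nat \<Rightarrow> real"
  assumes bd: "\<And>i j k. \<bar>q i j k\<bar> \<le> B"
  shows "\<exists>a. \<forall>n. \<exists>l m j k. n \<le> l \<and> l < m \<and> m < j \<and> j < k \<and>
    (\<forall>i. \<forall>(s, t) \<in> {(l, m), (l, j), (l, k), (m, j), (m, k), (j, k)}. \<bar>q i s t - a i\<bar> \<le> 1 / real (Suc n))"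
proof -
  define L where "L i j = Lim \<U> (q i j)" for i j
  have L: "(q i j \<longlongrightarrow> L i j) \<U>" for i j
    unfolding L_def by (rule freeuf_Lim) (use bd in \<open>auto simp: bounded_iff\<close>)
  have Lb: "\<bar>L i j\<bar> \<le> B" for i j
    by (rule tendsto_upperbound[OF tendsto_rabs[OF L] _ freeuf_bot]) (use bd in auto)
  define a where "a i = Lim \<U> (L i)" for i
  have a: "(L i \<longlongrightarrow> a i) \<U>" for i
    unfolding a_def by (rule freeuf_Lim) (use Lb in \<open>auto simp: bounded_iff\<close>)
  show ?thesis
  proof (intro exI[of _ a] allI)
    fix n
    define \<delta> where "\<delta> = 1 / (2 * real (Suc n))"
    have \<delta>: "\<delta> > 0" "2 * \<delta> = 1 / real (Suc n)" by (simp_all add: \<delta>_def field_simps)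
    have eA: "eventually (\<lambda>j. \<forall>i. \<bar>L i j - a i\<bar> < \<delta>) \<U>"
      using tendstoD[OF a \<delta>(1)] by (simp add: eventually_all_finite dist_real_def)
    have eB: "eventually (\<lambda>k. \<forall>i. \<bar>q i j k - L i j\<bar> < \<delta>) \<U>" for j
      using tendstoD[OF L \<delta>(1)] by (simp add: eventually_all_finite dist_real_def)
    have gt: "eventually (\<lambda>k. j < k) \<U>" for j using freeuf_ge[of "Suc j"] by (simp add: Suc_le_eq)
    obtain l where l: "\<forall>i. \<bar>L i l - a i\<bar> < \<delta>" "n \<le> l"
      using eventually_happens'[OF freeuf_bot eventually_conj[OF eA freeuf_ge]] by blast
    obtain m where m: "\<forall>i. \<bar>L i m - a i\<bar> < \<delta>" "l < m" "\<forall>i. \<bar>q i l m - L i l\<bar> < \<delta>"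
      using eventually_happens'[OF freeuf_bot eventually_conj[OF eA eventually_conj[OF gt eB]]] by blast
    obtain j where j: "\<forall>i. \<bar>L i j - a i\<bar> < \<delta>" "m < j" "\<forall>i. \<bar>q i l j - L i l\<bar> < \<delta>" "\<forall>i. \<bar>q i m j - L i m\<bar> < \<delta>"
      using eventually_happens'[OF freeuf_bot eventually_conj[OF eA eventually_conj[OF gt eventually_conj[OF eB eB]]]] by blast
    obtain k where k: "j < k" "\<forall>i. \<bar>q i l k - L i l\<bar> < \<delta>" "\<forall>i. \<bar>q i m k - L i m\<bar> < \<delta>" "\<forall>i. \<bar>q i j k - L i j\<bar> < \<delta>"
      using eventually_happens'[OF freeuf_bot eventually_conj[OF gt eventually_conj[OF eB eventually_conj[OF eB eB]]]] by blast
    have two: "\<bar>q i s t - a i\<bar> \<le> 1 / real (Suc n)" if "\<bar>L i s - a i\<bar> < \<delta>" "\<bar>q i s t - L i s\<bar> < \<delta>" for i s t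
      using that \<delta>(2) by linarith
    show "\<exists>l m j k. n \<le> l \<and> l < m \<and> m < j \<and> j < k \<and>
      (\<forall>i. \<forall>(s, t) \<in> {(l, m), (l, j), (l, k), (m, j), (m, k), (j, k)}. \<bar>q i s t - a i\<bar> \<le> 1 / real (Suc n))"
      by (intro exI[of _ l] exI[of _ m] exI[of _ j] exI[of _ k]) (use l m j k two in simp)
  qed
qed

section \<open>Rigidity of equidistant quadruples\<close>

context strict_psi
begin

text \<open>A point between \<open>x\<close> and \<open>y\<close> has to agree with one of them in
  every coordinate, so the ratio of its distances takes only finitely many values.\<close>

lemma coordinate_switch:
  fixes W :: "'r \<Rightarrow> 'b::real_normed_vector set"
  assumes nc: "\<And>i. noncreasy_wrt (W i) (\<Phi> i)"
    and mem: "\<And>i. x $ i \<in> W i" "\<And>i. y $ i \<in> W i" "\<And>i. c $ i \<in> W i" "\<And>i. e $ i \<in> W i" "\<And>i. z $ i \<in> W i"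
    and dist: "\<And>i. norm (x $ i - y $ i) = a i" "\<And>i. norm (x $ i - c $ i) = a i" "\<And>i. norm (y $ i - c $ i) = a i"
      "\<And>i. norm (x $ i - e $ i) = a i" "\<And>i. norm (y $ i - e $ i) = a i" "\<And>i. norm (c $ i - e $ i) = a i"
    and d: "\<psi> (\<chi> i. a i) = d"
    and far: "psi_norm \<psi> (x - (1/2) *\<^sub>R (y + c)) \<ge> d" "psi_norm \<psi> (y - (1/2) *\<^sub>R (x + c)) \<ge> d"
      "psi_norm \<psi> (c - (1/3) *\<^sub>R (x + y + e)) \<ge> d" "psi_norm \<psi> (z - (1/2) *\<^sub>R (c + e)) \<ge> d"
    and z: "psi_norm \<psi> (z - x) \<le> \<tau> * d" "psi_norm \<psi> (z - y) \<le> (1 - \<tau>) * d"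
  shows "\<tau> * d \<in> (\<lambda>A. \<psi> (\<chi> i. if i \<in> A then a i else 0)) ` UNIV"
proof -
  have a0: "a i \<ge> 0" for i using dist(1)[of i] norm_ge_zero[of "x $ i - y $ i"] by linarith
  have eqI: "norm (v $ i) = a i" if "\<And>i. norm (v $ i) \<le> a i" "psi_norm \<psi> v \<ge> d" for v :: "'b^'r" and i
  proof -
    have "(\<chi> i. norm (v $ i)) = (\<chi> i. a i)"
      by (rule psi_eqI) (use that d in \<open>simp_all add: psi_norm_def\<close>)
    then show ?thesis by (simp add: vec_eq_iff)
  qed
  have mid: "norm (p - (1/2) *\<^sub>R (q + r)) \<le> s" if "norm (p - q) \<le> s" "norm (p - r) \<le> s" for p q r :: 'b and s
  proof -
    have "p - (1/2) *\<^sub>R (q + r) = (1/2) *\<^sub>R (p - q) + (1/2) *\<^sub>R (p - r)"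
      using scaleR_add_left[of "1/2" "1/2" p] by (simp add: algebra_simps)
    then have "norm (p - (1/2) *\<^sub>R (q + r)) \<le> norm ((1/2) *\<^sub>R (p - q)) + norm ((1/2) *\<^sub>R (p - r))"
      using norm_triangle_ineq by metis
    then show ?thesis using that by simp
  qed
  have tri: "norm (p - (1/3) *\<^sub>R (q + r + t)) \<le> s"
    if "norm (p - q) \<le> s" "norm (p - r) \<le> s" "norm (p - t) \<le> s" for p q r t :: 'b and s
  proof -
    have "(1/3) *\<^sub>R p + ((1/3) *\<^sub>R p + (1/3) *\<^sub>R p) = p" by (simp add: scaleR_add_left[symmetric])
    then have "p - (1/3) *\<^sub>R (q + r + t) = (1/3) *\<^sub>R (p - q) + ((1/3) *\<^sub>R (p - r) + (1/3) *\<^sub>R (p - t))"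
      by (simp add: algebra_simps)
    then have "norm (p - (1/3) *\<^sub>R (q + r + t)) \<le> norm ((1/3) *\<^sub>R (p - q)) + (norm ((1/3) *\<^sub>R (p - r)) + norm ((1/3) *\<^sub>R (p - t)))"
      using order_trans[OF norm_triangle_ineq add_left_mono[OF norm_triangle_ineq]] by metis
    then show ?thesis using that by simp
  qed
  have f1: "norm (x $ i - (1/2) *\<^sub>R (y $ i + c $ i)) = a i" for i
    using eqI[OF _ far(1), of i] mid[of "x $ _" "y $ _" "a _" "c $ _"] dist by simp
  have f2: "norm (y $ i - (1/2) *\<^sub>R (x $ i + c $ i)) = a i" for i
    using eqI[OF _ far(2), of i] mid[of "y $ _" "x $ _" "a _" "c $ _"] dist by (simp add: norm_minus_commute)
  have f3: "norm (c $ i - (1/3) *\<^sub>R (x $ i + y $ i + e $ i)) = a i" for i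
    using eqI[OF _ far(3), of i] tri[of "c $ _" "x $ _" "a _" "y $ _" "e $ _"] dist by (simp add: norm_minus_commute)
  define u where "u = (\<chi> i. norm (z $ i - x $ i))"
  define v where "v = (\<chi> i. norm (z $ i - y $ i))"
  have pu: "\<psi> u \<le> \<tau> * d" and pv: "\<psi> v \<le> (1 - \<tau>) * d" using z by (simp_all add: psi_norm_def u_def v_def)
  have auv: "a i \<le> (u + v) $ i" for i
    using norm_triangle_ineq[of "x $ i - z $ i" "z $ i - y $ i"] dist(1)[of i] by (simp add: u_def v_def norm_minus_commute)
  \<comment> \<open>The \<psi>-distances of \<open>z\<close> to the two end points add up to at most
    \<open>d\<close>, so the triangle inequality through \<open>z\<close> is an equality in every
    coordinate.\<close>
  have "(\<chi> i. a i) = u + v"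
  proof (rule psi_eqI)
    have "\<psi> (u + v) \<le> \<tau> * d + (1 - \<tau>) * d" using psi_tri[of u v] pu pv by linarith
    then show "\<psi> (u + v) \<le> \<psi> (\<chi> i. a i)" using d by (simp add: algebra_simps)
  qed (use a0 auv in auto)
  then have uv: "u $ i + v $ i = a i" for i by (simp add: vec_eq_iff)
  have "d \<le> \<psi> u + \<psi> v" using psi_tri[of u v] \<open>(\<chi> i. a i) = u + v\<close> d by simp
  then have "\<psi> u \<ge> d - (1 - \<tau>) * d" using pv by linarith
  then have psu: "\<psi> u = \<tau> * d" using pu by (simp add: algebra_simps)
  have v0: "v $ i \<ge> 0" "u $ i \<ge> 0" for i by (simp_all add: u_def v_def)
  \<comment> \<open>\<open>metric_segment\<close> turns metrically between into linearly between; in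
    a coordinate with \<open>a i = 0\<close> all the points coincide.\<close>
  have seg: "\<exists>t. 0 \<le> t \<and> t \<le> 1 \<and> z $ i = x $ i + t *\<^sub>R (y $ i - x $ i) \<and> u $ i = t * a i" for i
  proof (cases "a i = 0")
    case True
    then have "u $ i = 0" using uv[of i] v0[of i] by linarith
    then show ?thesis using True by (intro exI[of _ 0]) (simp add: u_def)
  next
    case False
    then have pos: "a i > 0" using a0[of i] by simp
    interpret noncreasy "W i" "\<Phi> i" by standard (rule nc)
    have "z $ i = x $ i + (norm (z $ i - x $ i) / a i) *\<^sub>R (y $ i - x $ i)"
      by (rule metric_segment[OF mem(1,2,3,5)[of i] pos])
         (use dist[of i] f1[of i] f2[of i] uv[of i] in \<open>simp_all add: u_def v_def\<close>)
    then show ?thesis using pos uv[of i] v0[of i]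
      by (intro exI[of _ "u $ i / a i"]) (simp add: u_def divide_le_eq)
  qed
  have comb: "p + t *\<^sub>R (q - p) - m = (1 - t) *\<^sub>R (p - m) + t *\<^sub>R (q - m)" for p q m :: 'b and t
    by (simp add: algebra_simps)
  have zc: "norm (z $ i - (1/2) *\<^sub>R (c $ i + e $ i)) \<le> a i" for i
  proof -
    obtain t where t: "0 \<le> t" "t \<le> 1" "z $ i = x $ i + t *\<^sub>R (y $ i - x $ i)" using seg by blast
    let ?m = "(1/2) *\<^sub>R (c $ i + e $ i)"
    have "z $ i - ?m = (1 - t) *\<^sub>R (x $ i - ?m) + t *\<^sub>R (y $ i - ?m)"
      unfolding t(3) by (rule comb)
    then have "norm (z $ i - ?m) \<le> norm ((1 - t) *\<^sub>R (x $ i - ?m)) + norm (t *\<^sub>R (y $ i - ?m))"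
      using norm_triangle_ineq by metis
    also have "\<dots> = (1 - t) * norm (x $ i - ?m) + t * norm (y $ i - ?m)" using t by simp
    also have "\<dots> \<le> (1 - t) * a i + t * a i"
      using t dist[of i] by (intro add_mono mult_left_mono mid) auto
    finally show ?thesis by (simp add: algebra_simps)
  qed
  have f4: "norm (z $ i - (1/2) *\<^sub>R (c $ i + e $ i)) = a i" for i
    using eqI[OF _ far(4), of i] zc by simp
  have sw: "u $ i = 0 \<or> u $ i = a i" for i
  proof (rule ccontr)
    assume no: "\<not> ?thesis"
    obtain t where t: "0 \<le> t" "t \<le> 1" "z $ i = x $ i + t *\<^sub>R (y $ i - x $ i)" "u $ i = t * a i" using seg by blast
    have "a i \<noteq> 0" "t \<noteq> 0" "t \<noteq> 1" using no t(4) by auto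
    then have pos: "a i > 0" "0 < t" "t < 1" using a0[of i] t by auto
    interpret noncreasy "W i" "\<Phi> i" by standard (rule nc)
    show False
      by (rule segment_interior_false[OF mem(1-4)[of i] pos(1) dist(1) _ _ _ _ _ pos(2,3) t(3)])
         (use dist[of i] f4[of i] f3[of i] in simp_all)
  qed
  \<comment> \<open>The norm of \<open>u\<close> is now determined by the set of coordinates where
    \<open>u\<close> is nonzero, and a finite index type has finitely many subsets.\<close>
  have "u = (\<chi> i. if i \<in> {i. u $ i \<noteq> 0} then a i else 0)" using sw by (auto simp: vec_eq_iff)
  then have "\<tau> * d = \<psi> (\<chi> i. if i \<in> {i. u $ i \<noteq> 0} then a i else 0)" using psu by simp
  then show ?thesis by (rule image_eqI) simp
qed

end

lemma freeuf_shift_le: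
  assumes "(\<epsilon> \<longlongrightarrow> 0) sequentially" "\<And>n. n \<le> g n"
  shows "((\<lambda>n. \<epsilon> (g n) :: real) \<longlongrightarrow> 0) \<U>"
proof (rule tendsto_freeufI)
  have "filterlim g at_top sequentially"
    by (rule filterlim_at_top_mono[OF filterlim_ident]) (use assms(2) in auto)
  then show "(\<lambda>n. \<epsilon> (g n)) \<longlonglongrightarrow> 0" by (rule filterlim_compose[OF assms(1)])
qed

context unc_sum
begin

text \<open>Four late indices with almost equal coordinate distances become in the limit an exactly
  equidistant quadruple with coordinate distances \<open>a\<close>, and
  \<open>Z (j n) (k n) s\<close> becomes a point dividing its last segment in the ratio
  \<open>\<Lambda> s : 1 - \<Lambda> s\<close>. Since \<open>a\<close> does not depend on
  \<open>s\<close>, finitely many values would have to include every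
  \<open>\<Lambda> s * d\<close>.\<close>

lemma no_equidistant_sequence:
  fixes y :: "nat \<Rightarrow> 'z::real_normed_vector"
  assumes fr: "fin_rep TYPE('z) (psi_sum S) (psi_norm \<psi>)" and d: "d > 0"
    and \<epsilon>: "\<epsilon> \<longlonglongrightarrow> 0" and By: "\<And>k. norm (y k) \<le> B"
    and le: "\<And>j k. j < k \<Longrightarrow> norm (y k - y j) \<le> d + \<epsilon> j"
    and f: "\<And>k. \<exists>f. linear f \<and> (\<forall>v. f v \<le> norm v) \<and> (\<forall>j. j \<noteq> k \<longrightarrow> f (y k) - f (y j) \<ge> d - \<epsilon> k)"
    and z: "\<And>j k \<tau>. j < k \<Longrightarrow> 0 \<le> \<tau> \<Longrightarrow> \<tau> \<le> 1 \<Longrightarrow> \<exists>z. norm z \<le> B \<and> norm (z - y k) \<le> \<tau> * d + \<epsilon> j \<and>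
      norm (z - y j) \<le> (1 - \<tau>) * d + \<epsilon> j \<and> (\<forall>a<j. \<forall>b<j. norm (z - (1/2) *\<^sub>R (y a + y b)) \<ge> d - \<epsilon> j)"
  shows False
proof -
  define \<Lambda> where "\<Lambda> m = 1 / (real m + 2)" for m
  have "\<forall>j k m. \<exists>z. j < k \<longrightarrow> norm z \<le> B \<and> norm (z - y k) \<le> \<Lambda> m * d + \<epsilon> j \<and>
      norm (z - y j) \<le> (1 - \<Lambda> m) * d + \<epsilon> j \<and> (\<forall>a<j. \<forall>b<j. norm (z - (1/2) *\<^sub>R (y a + y b)) \<ge> d - \<epsilon> j)"
    using z[of _ _ "\<Lambda> _"] by (simp add: \<Lambda>_def)
  then obtain Z where Z0: "\<forall>j k m. j < k \<longrightarrow> norm (Z j k m) \<le> B \<and> norm (Z j k m - y k) \<le> \<Lambda> m * d + \<epsilon> j \<and>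
      norm (Z j k m - y j) \<le> (1 - \<Lambda> m) * d + \<epsilon> j \<and>
      (\<forall>a<j. \<forall>b<j. norm (Z j k m - (1/2) *\<^sub>R (y a + y b)) \<ge> d - \<epsilon> j)" by metis
  then have Z: "\<And>j k m. j < k \<Longrightarrow> norm (Z j k m) \<le> B"
    "\<And>j k m. j < k \<Longrightarrow> norm (Z j k m - y k) \<le> \<Lambda> m * d + \<epsilon> j"
    "\<And>j k m. j < k \<Longrightarrow> norm (Z j k m - y j) \<le> (1 - \<Lambda> m) * d + \<epsilon> j"
    "\<And>j k m a b. j < k \<Longrightarrow> a < j \<Longrightarrow> b < j \<Longrightarrow> norm (Z j k m - (1/2) *\<^sub>R (y a + y b)) \<ge> d - \<epsilon> j"
    by simp_all
  have "countable (range y \<union> (\<lambda>(j, k, m). Z j k m) ` UNIV)" by (intro countable_Un countable_image) auto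
  then have "range (from_nat_into (range y \<union> (\<lambda>(j, k, m). Z j k m) ` UNIV)) = range y \<union> (\<lambda>(j, k, m). Z j k m) ` UNIV"
    by (intro range_from_nat_into) auto
  \<comment> \<open>The dividing points are enumerated as well, since the embedding sees only the
    span of \<open>range b\<close>.\<close>
  then obtain b :: "nat \<Rightarrow> 'z" where b: "range b = range y \<union> (\<lambda>(j, k, m). Z j k m) ` UNIV" by (rule that)
  obtain N :: "'r \<Rightarrow> 'z \<Rightarrow> real" and K :: "(nat \<Rightarrow> 'z) \<Rightarrow> ('a ultra ultra)^'r"
    where NK: "seq_embedding \<psi> S b N K"
    using ex_embed_sequences[OF fr, of b] unc_sum_axioms
    unfolding seq_embedding_def seq_embedding_axioms_def by blast
  interpret E: seq_embedding \<psi> S b N K by (rule NK)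
  have yin: "y k \<in> span (range b)" for k by (rule span_base) (simp add: b)
  have zin: "Z j k m \<in> span (range b)" for j k m 
  proof (rule span_base)
    have "(case (j, k, m) of (j, k, m) \<Rightarrow> Z j k m) \<in> range b" unfolding b by blast
    then show "Z j k m \<in> range b" by simp
  qed
  have "\<bar>N i (y k - y j)\<bar> \<le> 2 * B" for i j k
  proof -
    have "y k - y j \<in> span (range b)" by (intro span_diff yin)
    from E.N_bounds[OF this, of i] show ?thesis using norm_triangle_ineq4[of "y k" "y j"] By[of k] By[of j] by simp
  qed
  then have "\<exists>a. \<forall>n. \<exists>l m j k. n \<le> l \<and> l < m \<and> m < j \<and> j < k \<and>
    (\<forall>i. \<forall>(s, t) \<in> {(l, m), (l, j), (l, k), (m, j), (m, k), (j, k)}. \<bar>N i (y t - y s) - a i\<bar> \<le> 1 / real (Suc n))"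
    by (rule freeuf_iterated_pick[of "\<lambda>i j k. N i (y k - y j)"])
  then obtain a where "\<forall>n. \<exists>l m j k. n \<le> l \<and> l < m \<and> m < j \<and> j < k \<and>
    (\<forall>i. \<forall>(s, t) \<in> {(l, m), (l, j), (l, k), (m, j), (m, k), (j, k)}. \<bar>N i (y t - y s) - a i\<bar> \<le> 1 / real (Suc n))" ..
  then obtain l m j k where ord: "\<And>n. n \<le> l n" "\<And>n. l n < m n" "\<And>n. m n < j n" "\<And>n. j n < k n"
    and app: "\<And>n i. \<forall>(s, t) \<in> {(l n, m n), (l n, j n), (l n, k n), (m n, j n), (m n, k n), (j n, k n)}.
      \<bar>N i (y t - y s) - a i\<bar> \<le> 1 / real (Suc n)" by metis
  have ge: "n \<le> l n" "n \<le> m n" "n \<le> j n" "n \<le> k n" for n using ord[of n] by auto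
  note e0 = freeuf_shift_le[OF \<epsilon> ge(1)] freeuf_shift_le[OF \<epsilon> ge(2)] freeuf_shift_le[OF \<epsilon> ge(3)] freeuf_shift_le[OF \<epsilon> ge(4)]
  have limd: "((\<lambda>n. c - \<epsilon> (g n)) \<longlongrightarrow> c) \<U>" "((\<lambda>n. c + \<epsilon> (g n)) \<longlongrightarrow> c) \<U>" if "\<And>n. n \<le> g n" for g c
    using tendsto_diff[OF tendsto_const[of c] freeuf_shift_le[OF \<epsilon> that]]
      tendsto_add[OF tendsto_const[of c] freeuf_shift_le[OF \<epsilon> that]] by simp_all
  have Dy: "E.D (\<lambda>n. y (g n))" for g by (rule bdd_inI[OF By yin])
  define c where "c = K (\<lambda>n. y (l n))"
  define e where "e = K (\<lambda>n. y (m n))"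
  define p where "p = K (\<lambda>n. y (j n))"
  define x where "x = K (\<lambda>n. y (k n))"
  have diff: "norm (K (\<lambda>n. y (t n)) $ i - K (\<lambda>n. y (s n)) $ i) = a i"
    if st: "\<And>n. (s n, t n) \<in> {(l n, m n), (l n, j n), (l n, k n), (m n, j n), (m n, k n), (j n, k n)}" for s t i
  proof -
    have "((\<lambda>n. N i (y (t n) - y (s n))) \<longlongrightarrow> norm (K (\<lambda>n. y (t n) - y (s n)) $ i)) \<U>"
      by (rule E.K_N[OF E.D_lin(2)[OF Dy Dy]])
    moreover have "((\<lambda>n. N i (y (t n) - y (s n)) - a i) \<longlongrightarrow> 0) \<U>"
      by (rule Lim_null_comparison[OF _ freeuf_inverse_Suc], intro always_eventually allI)
         (use app st in fastforce)
    then have "((\<lambda>n. N i (y (t n) - y (s n))) \<longlongrightarrow> a i) \<U>" by (simp add: LIM_zero_iff)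
    ultimately show ?thesis using tendsto_unique[OF freeuf_bot] by (simp add: E.K_minus[OF Dy Dy]) blast
  qed
  have dist: "norm (x $ i - p $ i) = a i" "norm (x $ i - c $ i) = a i" "norm (p $ i - c $ i) = a i"
      "norm (x $ i - e $ i) = a i" "norm (p $ i - e $ i) = a i" "norm (e $ i - c $ i) = a i" for i
    unfolding x_def p_def c_def e_def by (rule diff, simp)+
  have ce: "norm (c $ i - e $ i) = a i" for i using dist(6)[of i] by (simp add: norm_minus_commute)
  have f': "\<exists>f. linear f \<and> (\<forall>v. f v \<le> norm v) \<and> (\<forall>j. j \<noteq> k \<longrightarrow> f (y k) - f (y j) \<ge> d - \<epsilon> k)" for k by (rule f)
  have far1: "norm (y s - y t) \<ge> d - \<epsilon> s" if "s \<noteq> t" for s t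
  proof -
    obtain f where f: "linear f" "\<And>v. f v \<le> norm v" "\<And>j. j \<noteq> s \<Longrightarrow> f (y s) - f (y j) \<ge> d - \<epsilon> s" using f' by metis
    have "f (y s) - f (y t) \<le> norm (y s - y t)" using f(2)[of "y s - y t"] by (simp add: linear_diff[OF f(1)])
    then show ?thesis using f(3)[of t] that by simp
  qed
  \<comment> \<open>Here functionals are essential: lower bounds for the distances from
    \<open>y s\<close> to \<open>y t\<close> and to \<open>y w\<close> would not pass to the
    midpoint, whereas bounds for one linear functional do.\<close>
  have far2: "norm (y s - (1/2) *\<^sub>R (y t + y w)) \<ge> d - \<epsilon> s" if "t \<noteq> s" "w \<noteq> s" for s t w
  proof -
    obtain f where f: "linear f" "\<And>v. f v \<le> norm v" "\<And>j. j \<noteq> s \<Longrightarrow> f (y s) - f (y j) \<ge> d - \<epsilon> s" using f' by metis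
    have "f (y s) - (f (y t) + f (y w)) / 2 \<le> norm (y s - (1/2) *\<^sub>R (y t + y w))"
      using f(2)[of "y s - (1/2) *\<^sub>R (y t + y w)"] by (simp add: linear_diff[OF f(1)] linear_scale[OF f(1)] linear_add[OF f(1)])
    then show ?thesis using f(3)[OF that(1)] f(3)[OF that(2)] by argo
  qed
  have far3: "norm (y s - (1/3) *\<^sub>R (y t + y w + y v)) \<ge> d - \<epsilon> s" if "t \<noteq> s" "w \<noteq> s" "v \<noteq> s" for s t w v
  proof -
    obtain f where f: "linear f" "\<And>v. f v \<le> norm v" "\<And>j. j \<noteq> s \<Longrightarrow> f (y s) - f (y j) \<ge> d - \<epsilon> s" using f' by metis
    have "f (y s) - (f (y t) + f (y w) + f (y v)) / 3 \<le> norm (y s - (1/3) *\<^sub>R (y t + y w + y v))"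
      using f(2)[of "y s - (1/3) *\<^sub>R (y t + y w + y v)"] by (simp add: linear_diff[OF f(1)] linear_scale[OF f(1)] linear_add[OF f(1)])
    then show ?thesis using f(3)[OF that(1)] f(3)[OF that(2)] f(3)[OF that(3)] by argo
  qed
  have dd: "\<psi> (\<chi> i. a i) = d"
  proof (rule antisym)
    have eq: "\<psi> (\<chi> i. a i) = psi_norm \<psi> (K (\<lambda>n. y (k n) - y (j n)))"
      using dist(1) unfolding psi_norm_def E.K_minus[OF Dy Dy] by (simp add: x_def p_def)
    show "\<psi> (\<chi> i. a i) \<le> d" unfolding eq
      by (rule E.K_norm_le[OF E.D_lin(2)[OF Dy Dy] _ limd(2)[OF ge(3)]]) (use le ord in simp)
    show "d \<le> \<psi> (\<chi> i. a i)" unfolding eq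
      by (rule E.K_norm_ge[OF E.D_lin(2)[OF Dy Dy] _ limd(1)[OF ge(4)]]) (use far1 ord(4) in \<open>simp add: less_imp_neq[symmetric]\<close>)
  qed
  have combo2: "K (\<lambda>n. u n - (1/2) *\<^sub>R (v n + w n)) = K u - (1/2) *\<^sub>R (K v + K w)"
    and Dcombo2: "E.D (\<lambda>n. u n - (1/2) *\<^sub>R (v n + w n))"
    if D: "E.D u" "E.D v" "E.D w" for u v w
    using E.K_minus[OF D(1) E.D_lin(3)[OF E.D_lin(1)[OF D(2,3)] D(1)], of "1/2"] E.K_scale[OF E.D_lin(1)[OF D(2,3)], of "1/2"]
      E.K_plus[OF D(2,3)] E.D_lin(2)[OF D(1) E.D_lin(3)[OF E.D_lin(1)[OF D(2,3)] D(1)], of "1/2"] by simp_all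
  have combo3: "K (\<lambda>n. u n - (1/3) *\<^sub>R (v n + w n + t n)) = K u - (1/3) *\<^sub>R (K v + K w + K t)"
    and Dcombo3: "E.D (\<lambda>n. u n - (1/3) *\<^sub>R (v n + w n + t n))"
    if D: "E.D u" "E.D v" "E.D w" "E.D t" for u v w t
    using E.K_minus[OF D(1) E.D_lin(3)[OF E.D_lin(1)[OF E.D_lin(1)[OF D(2,3)] D(4)] D(1)], of "1/3"]
      E.K_scale[OF E.D_lin(1)[OF E.D_lin(1)[OF D(2,3)] D(4)], of "1/3"]
      E.K_plus[OF E.D_lin(1)[OF D(2,3)] D(4)] E.K_plus[OF D(2,3)]
      E.D_lin(2)[OF D(1) E.D_lin(3)[OF E.D_lin(1)[OF E.D_lin(1)[OF D(2,3)] D(4)] D(1)], of "1/3"] by simp_all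
  have neq: "l n \<noteq> k n" "l n \<noteq> j n" "l n \<noteq> m n" "j n \<noteq> k n" for n using ord[of n] by auto
  have F: "d \<le> psi_norm \<psi> (x - (1/2) *\<^sub>R (p + c))" "d \<le> psi_norm \<psi> (p - (1/2) *\<^sub>R (x + c))"
    "d \<le> psi_norm \<psi> (c - (1/3) *\<^sub>R (x + p + e))"
    unfolding x_def p_def c_def e_def combo2[OF Dy Dy Dy, symmetric] combo3[OF Dy Dy Dy Dy, symmetric]
    by (rule E.K_norm_ge[OF Dcombo2[OF Dy Dy Dy] _ limd(1)[OF ge(4)]], simp add: far2 neq neq[symmetric])
       (rule E.K_norm_ge[OF Dcombo2[OF Dy Dy Dy] _ limd(1)[OF ge(3)]], simp add: far2 neq neq[symmetric],
        rule E.K_norm_ge[OF Dcombo3[OF Dy Dy Dy Dy] _ limd(1)[OF ge(1)]], simp add: far3 neq neq[symmetric])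
  have fin: "\<Lambda> s * d \<in> (\<lambda>A. \<psi> (\<chi> i. if i \<in> A then a i else 0)) ` UNIV" for s
  proof -
    define zz where "zz n = Z (j n) (k n) s" for n
    have Dz: "E.D zz" unfolding zz_def by (rule bdd_inI[OF Z(1)[OF ord(4)] zin])
    show ?thesis
    proof (rule coordinate_switch[OF ncW _ _ _ _ _ dist(1-5) ce dd F])
      show "x $ i \<in> W i" "p $ i \<in> W i" "c $ i \<in> W i" "e $ i \<in> W i" "K zz $ i \<in> W i" for i
        unfolding x_def p_def c_def e_def by (rule E.K_in[OF Dy], rule E.K_in[OF Dy], rule E.K_in[OF Dy], rule E.K_in[OF Dy], rule E.K_in[OF Dz])
      show "d \<le> psi_norm \<psi> (K zz - (1/2) *\<^sub>R (c + e))"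
        unfolding c_def e_def combo2[OF Dz Dy Dy, symmetric]
        by (rule E.K_norm_ge[OF Dcombo2[OF Dz Dy Dy] _ limd(1)[OF ge(3)]], rule always_eventually)
           (simp add: zz_def Z(4)[OF ord(4) less_trans[OF ord(2,3)] ord(3)])
      show "psi_norm \<psi> (K zz - x) \<le> \<Lambda> s * d"
        unfolding x_def E.K_minus[OF Dz Dy, symmetric]
        by (rule E.K_norm_le[OF E.D_lin(2)[OF Dz Dy] _ limd(2)[OF ge(3)]], rule always_eventually)
           (use Z(2)[OF ord(4)] in \<open>simp add: zz_def\<close>)
      show "psi_norm \<psi> (K zz - p) \<le> (1 - \<Lambda> s) * d"
        unfolding p_def E.K_minus[OF Dz Dy, symmetric]
        by (rule E.K_norm_le[OF E.D_lin(2)[OF Dz Dy] _ limd(2)[OF ge(3)]], rule always_eventually)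
           (use Z(3)[OF ord(4)] in \<open>simp add: zz_def\<close>)
    qed
  qed
  have "inj (\<lambda>s. \<Lambda> s * d)" using d by (auto simp: inj_def \<Lambda>_def)
  then have "infinite (range (\<lambda>s. \<Lambda> s * d))" by (rule range_inj_infinite)
  moreover have "finite ((\<lambda>A. \<psi> (\<chi> i. if i \<in> A then a i else 0)) ` UNIV)" by simp
  moreover have "range (\<lambda>s. \<Lambda> s * d) \<subseteq> (\<lambda>A. \<psi> (\<chi> i. if i \<in> A then a i else 0)) ` UNIV"
    by (rule image_subsetI) (rule fin)
  ultimately show False using finite_subset by blast
qed

end

lemma geometric_half_less: "(\<Sum>l<k. (1/2::real) ^ l) < 2"
proof -
  have "(\<Sum>l<k. (1/2::real) ^ l) = 2 - 2 * (1/2) ^ k" by (induction k) auto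
  then show ?thesis by simp
qed

lemma directed_finite:
  assumes "\<G> \<noteq> {}" "\<And>G H. G \<in> \<G> \<Longrightarrow> H \<in> \<G> \<Longrightarrow> \<exists>L\<in>\<G>. L \<subseteq> G \<inter> H" "finite F" "F \<subseteq> \<G>"
  shows "\<exists>L\<in>\<G>. \<forall>G\<in>F. L \<subseteq> G"
  using assms(3,4)
proof (induction F)
  case (insert G F)
  then obtain L where "L \<in> \<G>" "\<forall>G\<in>F. L \<subseteq> G" by blast
  moreover then obtain L' where "L' \<in> \<G>" "L' \<subseteq> L \<inter> G" using assms(2)[of L G] insert.prems by blast
  ultimately show ?case by (intro bexI[of _ L']) auto
qed (use assms(1) in auto)

section \<open>Extracting an equidistant sequence from a directed family\<close>

context unc_sum
begin

text \<open>A common point \<open>c\<close> of the closed convex hulls acts as a weak limit of the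
  family. Each new point gets a functional nearly norming its difference to \<open>c\<close> and to
  all earlier points, and later points are chosen so that earlier functionals exceed their values at
  \<open>c\<close> by little. Together this separates a point from those before and after it by one
  functional.\<close>

lemma no_equidistant_family:
  fixes \<G> :: "'z::banach set set"
  assumes fr: "fin_rep TYPE('z) (psi_sum S) (psi_norm \<psi>)"
    and K: "closed K" "convex K" "bounded K" and d: "d > 0"
    and G: "\<G> \<noteq> {}" and dir: "\<And>G H. G \<in> \<G> \<Longrightarrow> H \<in> \<G> \<Longrightarrow> \<exists>L\<in>\<G>. L \<subseteq> G \<inter> H"
    and sub: "\<And>G. G \<in> \<G> \<Longrightarrow> G \<subseteq> K" and ne: "\<And>G. G \<in> \<G> \<Longrightarrow> G \<noteq> {}"
    and eq: "\<And>w \<epsilon>. w \<in> K \<Longrightarrow> \<epsilon> > 0 \<Longrightarrow> \<exists>G\<in>\<G>. \<forall>x\<in>G. d - \<epsilon> \<le> norm (x - w) \<and> norm (x - w) \<le> d + \<epsilon>"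
    and seg: "\<And>G \<epsilon>. G \<in> \<G> \<Longrightarrow> \<epsilon> > 0 \<Longrightarrow> \<exists>H\<in>\<G>. \<forall>x\<in>H. \<forall>y\<in>H. \<forall>\<tau>. 0 \<le> \<tau> \<longrightarrow> \<tau> \<le> 1 \<longrightarrow>
      (\<exists>z\<in>G. norm (z - x) \<le> \<tau> * norm (x - y) + \<epsilon> \<and> norm (z - y) \<le> (1 - \<tau>) * norm (x - y) + \<epsilon>)"
  shows False
proof -
  have dirF: "\<exists>L\<in>\<G>. \<forall>G\<in>F. L \<subseteq> G" if "finite F" "F \<subseteq> \<G>" for F
    by (rule directed_finite[OF G dir that])
  have eqF: "\<exists>G\<in>\<G>. \<forall>x\<in>G. \<forall>w\<in>V. d - \<epsilon> \<le> norm (x - w) \<and> norm (x - w) \<le> d + \<epsilon>"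
    if V: "finite V" "V \<subseteq> K" and \<epsilon>: "\<epsilon> > 0" for V \<epsilon>
  proof -
    have "\<forall>w\<in>V. \<exists>G. G \<in> \<G> \<and> (\<forall>x\<in>G. d - \<epsilon> \<le> norm (x - w) \<and> norm (x - w) \<le> d + \<epsilon>)"
      using eq[OF _ \<epsilon>] V(2) by blast
    then obtain h where h: "\<And>w. w \<in> V \<Longrightarrow> h w \<in> \<G>"
      "\<And>w x. w \<in> V \<Longrightarrow> x \<in> h w \<Longrightarrow> d - \<epsilon> \<le> norm (x - w) \<and> norm (x - w) \<le> d + \<epsilon>" by metis
    obtain L where "L \<in> \<G>" "\<forall>G\<in>h ` V. L \<subseteq> G" using dirF[of "h ` V"] V(1) h(1) by blast
    then show ?thesis using h(2) by (intro bexI[of _ L]) blast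
  qed
  obtain G0 where G0: "G0 \<in> \<G>" using G by blast
  have "\<Inter>((\<lambda>G. closure (convex hull G)) ` \<G>) \<noteq> {}"
  proof (rule closed_convex_fip[OF fr])
    show "closure (convex hull G0) \<in> (\<lambda>G. closure (convex hull G)) ` \<G>" using G0 by blast
    show "bounded (closure (convex hull G0))"
      by (intro bounded_closure bounded_convex_hull bounded_subset[OF K(3) sub[OF G0]])
    fix F assume F: "finite F" "F \<subseteq> (\<lambda>G. closure (convex hull G)) ` \<G>"
    obtain F' where F': "F' \<subseteq> \<G>" "finite F'" "F = (\<lambda>G. closure (convex hull G)) ` F'"
      using finite_subset_image[OF F] by blast
    obtain L where L: "L \<in> \<G>" "\<forall>G\<in>F'. L \<subseteq> G" using dirF[OF F'(2,1)] by blast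
    obtain x where "x \<in> L" using ne[OF L(1)] by blast
    then have "x \<in> \<Inter>F" unfolding F'(3) using L(2) by (auto intro!: closure_subset[THEN subsetD] hull_inc)
    then show "\<Inter>F \<noteq> {}" by blast
  qed (auto simp: convex_closure)
  then obtain c where c: "\<And>G. G \<in> \<G> \<Longrightarrow> c \<in> closure (convex hull G)" by blast
  have cK: "c \<in> K"
  proof -
    have "closure (convex hull G0) \<subseteq> K" using sub[OF G0] K by (intro closure_minimal hull_minimal)
    then show ?thesis using c[OF G0] by blast
  qed
  \<comment> \<open>\<open>\<epsilon>\<close> is the tolerance of the final sequence and stays below
    \<open>d\<close>. \<open>\<eta>\<close> is the accuracy of the functionals; its factor
    \<open>2 ^ (k + 2)\<close> is matched to the weights \<open>w\<close> used below against
    \<open>c\<close>. \<open>\<theta>\<close> is the accuracy of the distances, smaller by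
    \<open>2 * (real k + 1)\<close> because the whole deficit at an average of \<open>k + 1\<close>
    points may fall on one of them.\<close>
  define \<epsilon> where "\<epsilon> k = d / (real k + 2)" for k :: nat
  define \<eta> where "\<eta> k = \<epsilon> k / 2 ^ (k + 2)" for k
  define \<theta> where "\<theta> k = \<eta> k / (2 * (real k + 1))" for k
  have \<epsilon>0: "\<epsilon> k > 0" "\<epsilon> k < d" for k using d by (simp_all add: \<epsilon>_def divide_less_eq) 
  have \<eta>0: "\<eta> k > 0" "\<eta> k \<le> \<epsilon> k" for k
    using \<epsilon>0[of k] one_le_power[of "2::real" "k + 2"] by (simp_all add: \<eta>_def divide_le_eq mult_le_cancel_left1 del: power_Suc)
  have \<theta>0: "\<theta> k > 0" "\<theta> k \<le> \<eta> k" for k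
    using \<eta>0[of k] by (simp_all add: \<theta>_def divide_le_eq algebra_simps) 
  have \<eta>mono: "\<eta> k \<le> \<eta> j" "\<epsilon> k \<le> \<epsilon> j" if "j \<le> k" for j k
  proof -
    show *: "\<epsilon> k \<le> \<epsilon> j" using that d by (simp add: \<epsilon>_def frac_le)
    have "(2::real) ^ (j + 2) \<le> 2 ^ (k + 2)" using that by (intro power_increasing) auto
    then show "\<eta> k \<le> \<eta> j" unfolding \<eta>_def using * \<epsilon>0(1)[of j] by (intro frac_le) auto
  qed
  define Y where "Y r = fst r" for r :: "'z \<times> ('z \<Rightarrow> real) \<times> 'z set"
  define f where "f r = fst (snd r)" for r :: "'z \<times> ('z \<Rightarrow> real) \<times> 'z set"
  define H where "H r = snd (snd r)" for r :: "'z \<times> ('z \<Rightarrow> real) \<times> 'z set"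
  define P where "P g k r \<longleftrightarrow> Y r \<in> H r \<and> H r \<in> \<G> \<and> (\<forall>j<k. H r \<subseteq> H (g j)) \<and>
    linear (f r) \<and> (\<forall>v. \<bar>f r v\<bar> \<le> norm v) \<and> (\<forall>j<k. norm (Y r - Y (g j)) \<le> d + \<eta> k) \<and>
    (\<forall>j<k. f r (Y r) - f r (Y (g j)) \<ge> d - \<eta> k) \<and> f r (Y r) - f r c \<ge> d - \<eta> k \<and>
    (\<forall>j<k. f (g j) (Y r) \<le> f (g j) c + \<epsilon> j) \<and>
    (\<forall>x\<in>H r. \<forall>y\<in>H r. \<forall>\<tau>. 0 \<le> \<tau> \<longrightarrow> \<tau> \<le> 1 \<longrightarrow>
      (\<exists>z\<in>K. norm (z - x) \<le> \<tau> * norm (x - y) + \<epsilon> k \<and> norm (z - y) \<le> (1 - \<tau>) * norm (x - y) + \<epsilon> k \<and>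
         (\<forall>a<k. \<forall>b<k. norm (z - (1/2) *\<^sub>R (Y (g a) + Y (g b))) \<ge> d - \<epsilon> k)))" for g k r
  have "\<exists>g. \<forall>k. P g k (g k)"
  proof (rule dependent_wellorder_choice)
    fix r and g g' :: "nat \<Rightarrow> 'z \<times> ('z \<Rightarrow> real) \<times> 'z set" and k :: nat assume gg: "\<And>y. y < k \<Longrightarrow> g y = g' y"
    then show "P g k r = P g' k r" unfolding P_def by simp
  next
    fix k :: nat and g :: "nat \<Rightarrow> 'z \<times> ('z \<Rightarrow> real) \<times> 'z set" assume IH: "\<And>j. j < k \<Longrightarrow> P g j (g j)"
    have YK: "Y (g j) \<in> K" "H (g j) \<in> \<G>" if "j < k" for j using IH[OF that] sub by (auto simp: P_def)
    \<comment> \<open>A functional that norms the difference of \<open>y\<close> and an average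
      nearly norms the difference of \<open>y\<close> and each averaged point, as long as no such
      difference exceeds \<open>d\<close> by much.\<close>
    define u where "u = (1 / (real k + 1)) *\<^sub>R (c + (\<Sum>j<k. Y (g j)))"
    have uK: "u \<in> K"
    proof -
      have "(\<Sum>j\<in>{..k}. (1 / (real k + 1)) *\<^sub>R (if j = k then c else Y (g j))) \<in> K"
      proof (rule convex_sum[OF _ K(2)])
        show "(if j = k then c else Y (g j)) \<in> K" if "j \<in> {..k}" for j using that cK YK by auto
      qed (auto simp: field_simps)
      also have "(\<Sum>j\<in>{..k}. (1 / (real k + 1)) *\<^sub>R (if j = k then c else Y (g j))) = u"
        unfolding u_def scaleR_sum_right[symmetric]
        by (simp add: lessThan_Suc_atMost[symmetric] add.commute)
      finally show ?thesis .
    qed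
    define V where "V = {u, c} \<union> (\<lambda>j. Y (g j)) ` {..<k} \<union> (\<lambda>(a, b). (1/2) *\<^sub>R (Y (g a) + Y (g b))) ` ({..<k} \<times> {..<k})"
    have mK: "(1/2) *\<^sub>R (Y (g a) + Y (g b)) \<in> K" if "a < k" "b < k" for a b
      using convexD[OF K(2) YK(1)[OF that(1)] YK(1)[OF that(2)], of "1/2" "1/2"] by (simp add: scaleR_add_right)
    have V: "finite V" "V \<subseteq> K" using uK cK YK(1) mK by (auto simp: V_def)
    obtain G1 where G1_in: "G1 \<in> \<G>"
      and G1_all: "\<forall>x\<in>G1. \<forall>w\<in>V. d - \<theta> k \<le> norm (x - w) \<and> norm (x - w) \<le> d + \<theta> k"
      using eqF[OF V \<theta>0(1)[of k]] ..
    note G1 = G1_in G1_all[rule_format]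
    obtain H1 where H1: "H1 \<in> \<G>" "\<forall>x\<in>H1. \<forall>y\<in>H1. \<forall>\<tau>. 0 \<le> \<tau> \<longrightarrow> \<tau> \<le> 1 \<longrightarrow>
      (\<exists>z\<in>G1. norm (z - x) \<le> \<tau> * norm (x - y) + \<epsilon> k \<and> norm (z - y) \<le> (1 - \<tau>) * norm (x - y) + \<epsilon> k)"
      using seg[OF G1(1) \<epsilon>0(1)[of k]] ..
    have "finite ({G1, H1} \<union> (\<lambda>j. H (g j)) ` {..<k})" "{G1, H1} \<union> (\<lambda>j. H (g j)) ` {..<k} \<subseteq> \<G>"
      using G1(1) H1(1) YK(2) by auto
    from dirF[OF this] obtain L where L: "L \<in> \<G>" "\<forall>G\<in>{G1, H1} \<union> (\<lambda>j. H (g j)) ` {..<k}. L \<subseteq> G" ..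
    then have LL: "L \<subseteq> G1" "L \<subseteq> H1" "\<And>j. j < k \<Longrightarrow> L \<subseteq> H (g j)" by auto
    have inV: "u \<in> V" "c \<in> V" "\<And>j. j < k \<Longrightarrow> Y (g j) \<in> V"
      "\<And>a b. a < k \<Longrightarrow> b < k \<Longrightarrow> (1/2) *\<^sub>R (Y (g a) + Y (g b)) \<in> V" by (auto simp: V_def)
    define h where "h l = f (g l)" for l
    have h: "linear (h l)" "\<And>v. \<bar>h l v\<bar> \<le> norm v" "h l (Y (g l)) - h l c \<ge> d - \<eta> l" if "l < k" for l
      using IH[OF that] by (simp_all add: P_def h_def)
    have hbl: "bounded_linear (h l)" if "l < k" for l
      using h(1)[OF that] h(2)[OF that] by (intro bounded_linear_intro[where K = 1]) (simp_all add: linear_add linear_scale)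
    \<comment> \<open>On \<open>L\<close> an earlier functional cannot fall far below its value at
      \<open>c\<close>: it is within \<open>d + \<theta> k\<close> of its value at
      \<open>Y (g l)\<close>, which exceeds that at \<open>c\<close> by at least
      \<open>d - \<eta> l\<close>. This makes the weighted terms below nonnegative.\<close>
    have hlow: "h l x - h l c + 2 * \<eta> l \<ge> 0" if "l < k" "x \<in> L" for l x
    proof -
      have "x \<in> G1" using LL(1) that(2) by blast
      then have "norm (x - Y (g l)) \<le> d + \<theta> k" using G1(2) inV(3)[OF that(1)] by blast
      moreover have "\<bar>h l (x - Y (g l))\<bar> \<le> norm (x - Y (g l))" by (rule h(2)[OF that(1)])
      moreover have "h l (x - Y (g l)) = h l x - h l (Y (g l))" by (rule linear_diff[OF h(1)[OF that(1)]])
      moreover have "\<theta> k \<le> \<eta> l" using \<theta>0(2)[of k] \<eta>mono(1)[of l k] that(1) by simp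
      ultimately show ?thesis using h(3)[OF that(1)] by linarith
    qed
    \<comment> \<open>Otherwise every point of \<open>L\<close> violates some bound, and by the
      choice of \<open>w\<close> the violated term alone exceeds 2. So \<open>\<Psi> \<ge> t\<close>
      on \<open>L\<close>, hence on its closed convex hull and at \<open>c\<close>; but there the
      sum of the terms is a finite geometric sum below 2.\<close>
    have "\<exists>y\<in>L. \<forall>l<k. h l y \<le> h l c + \<epsilon> l"
    proof (rule ccontr)
      assume neg: "\<not> ?thesis"
      define w where "w l = 1 / (2 * 2 ^ l * \<eta> l)" for l
      have w0: "w l > 0" for l using \<eta>0(1)[of l] by (simp add: w_def)
      define \<Psi> where "\<Psi> x = (\<Sum>l<k. w l * h l x)" for x
      define t where "t = 2 + (\<Sum>l<k. w l * (h l c - 2 * \<eta> l))"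
      have bl: "bounded_linear \<Psi>"
        unfolding \<Psi>_def by (intro bounded_linear_sum bounded_linear_const_mult hbl) simp
      have "L \<subseteq> \<Psi> -` {t..}"
      proof
        fix x assume x: "x \<in> L"
        then obtain l where l: "l < k" "h l x > h l c + \<epsilon> l" using neg by (meson not_le)
        have "2 < w l * (h l x - h l c + 2 * \<eta> l)"
        proof -
          have "2 * (2 * 2 ^ l * \<eta> l) = \<epsilon> l" by (simp add: \<eta>_def power_add)
          then have "2 * (2 * 2 ^ l * \<eta> l) < h l x - h l c + 2 * \<eta> l" using l(2) \<eta>0(1)[of l] by linarith
          then show ?thesis using \<eta>0(1)[of l] by (simp add: w_def field_simps)
        qed
        also have "\<dots> \<le> (\<Sum>l<k. w l * (h l x - h l c + 2 * \<eta> l))"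
          using l(1) hlow[OF _ x] w0
          by (intro member_le_sum[of l "{..<k}" "\<lambda>l. w l * (h l x - h l c + 2 * \<eta> l)"])
             (auto intro!: mult_nonneg_nonneg less_imp_le[OF w0])
        also have "\<dots> = \<Psi> x - (\<Sum>l<k. w l * (h l c - 2 * \<eta> l))"
          by (simp add: \<Psi>_def sum_subtractf[symmetric] algebra_simps)
        finally show "x \<in> \<Psi> -` {t..}" by (simp add: t_def)
      qed
      moreover have "closed (\<Psi> -` {t..})"
        by (rule closed_vimage[OF closed_atLeast linear_continuous_on[OF bl]])
      moreover have "convex (\<Psi> -` {t..})"
        by (rule convex_linear_vimage[OF bounded_linear.linear[OF bl]]) simp
      ultimately have "closure (convex hull L) \<subseteq> \<Psi> -` {t..}" by (intro closure_minimal hull_minimal)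
      then have "t \<le> \<Psi> c" using c[OF L(1)] by auto
      then have "2 \<le> (\<Sum>l<k. w l * (2 * \<eta> l))"
        by (simp add: t_def \<Psi>_def right_diff_distrib sum_subtractf)
      also have "\<dots> = (\<Sum>l<k. (1/2) ^ l)"
        using \<eta>0(1) by (intro sum.cong refl) (simp add: w_def power_divide less_imp_neq[symmetric])
      finally show False using geometric_half_less[of k] by simp
    qed
    then obtain y where y_in: "y \<in> L" and y_all: "\<forall>l<k. h l y \<le> h l c + \<epsilon> l" ..
    note y = y_in y_all[rule_format]
    have yG: "y \<in> G1" using y(1) LL(1) by blast
    have "d - \<theta> k \<le> norm (y - u)" using G1(2)[OF yG inV(1)] by simp
    moreover have "\<theta> k < d" using \<theta>0(2)[of k] \<eta>0(2)[of k] \<epsilon>0(2)[of k] by linarith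
    ultimately have yu: "y - u \<noteq> 0" "d - \<theta> k \<le> norm (y - u)" by auto
    obtain \<phi> where \<phi>: "\<phi> \<in> dual_sphere UNIV" "\<phi> (y - u) = norm (y - u)"
      using norming_functional[OF subspace_UNIV UNIV_I yu(1)] by blast
    have lin: "linear \<phi>" using \<phi>(1) by (intro linearI) (simp_all add: dual_sphere_def lin_on_def)
    have ab: "\<bar>\<phi> v\<bar> \<le> norm v" for v by (rule dual_sphere_abs_le[OF subspace_UNIV \<phi>(1) UNIV_I])
    have up: "\<phi> y - \<phi> v \<le> d + \<theta> k" if "v \<in> V" for v
      using ab[of "y - v"] G1(2)[OF yG that] unfolding linear_diff[OF lin] by linarith
    have "\<phi> u = (1 / (real k + 1)) * (\<phi> c + (\<Sum>j<k. \<phi> (Y (g j))))"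
      unfolding u_def linear_scale[OF lin] linear_add[OF lin] linear_sum[OF lin] by simp
    then have "(real k + 1) * \<phi> u = \<phi> c + (\<Sum>j<k. \<phi> (Y (g j)))"
      by simp
    \<comment> \<open>The deficits \<open>d + \<theta> k - (\<phi> y - \<phi> v)\<close> at the
      averaged points are nonnegative and add up to \<open>real k + 1\<close> times the deficit at
      \<open>u\<close>, which is at most \<open>2 * \<theta> k\<close>; so each of them is at most
      \<open>\<eta> k\<close>.\<close>
    then have tot: "(d + \<theta> k - (\<phi> y - \<phi> c)) + (\<Sum>j<k. d + \<theta> k - (\<phi> y - \<phi> (Y (g j)))) = (real k + 1) * (d + \<theta> k - (\<phi> y - \<phi> u))"
      by (simp add: sum.distrib sum_subtractf algebra_simps)
    also have "\<dots> \<le> (real k + 1) * (2 * \<theta> k)"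
      using yu(2) \<phi>(2) by (intro mult_left_mono) (simp_all add: linear_diff[OF lin])
    also have "\<dots> = \<theta> k * (2 * (real k + 1))" by (simp only: ac_simps)
    also have "\<dots> = \<eta> k"
    proof -
      have "0 < 2 * (real k + 1)" by (intro mult_pos_pos add_nonneg_pos) simp_all
      then have "2 * (real k + 1) \<noteq> 0" by (rule less_imp_neq[symmetric])
      then show ?thesis unfolding \<theta>_def by (rule nonzero_divide_eq_eq[THEN iffD1, OF _ refl, symmetric])
    qed
    finally have tot: "(d + \<theta> k - (\<phi> y - \<phi> c)) + (\<Sum>j<k. d + \<theta> k - (\<phi> y - \<phi> (Y (g j)))) \<le> \<eta> k" .
    have nn: "0 \<le> d + \<theta> k - (\<phi> y - \<phi> c)" "\<And>j. j < k \<Longrightarrow> 0 \<le> d + \<theta> k - (\<phi> y - \<phi> (Y (g j)))"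
      using up[OF inV(2)] up[OF inV(3)] by (simp_all add: algebra_simps)
    have "0 \<le> (\<Sum>j<k. d + \<theta> k - (\<phi> y - \<phi> (Y (g j))))" by (rule sum_nonneg, rule nn(2)) simp
    then have fc: "\<phi> y - \<phi> c \<ge> d - \<eta> k" using tot \<theta>0(1)[of k] by linarith
    have fy: "\<phi> y - \<phi> (Y (g j)) \<ge> d - \<eta> k" if "j < k" for j
    proof -
      have "d + \<theta> k - (\<phi> y - \<phi> (Y (g j))) \<le> (\<Sum>j<k. d + \<theta> k - (\<phi> y - \<phi> (Y (g j))))"
        using that nn(2) by (intro member_le_sum[of j "{..<k}" "\<lambda>j. d + \<theta> k - (\<phi> y - \<phi> (Y (g j)))"]) auto
      then show ?thesis using tot nn(1) \<theta>0(1)[of k] by linarith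
    qed
    have "P g k (y, \<phi>, L)"
      unfolding P_def
    proof (intro conjI allI impI ballI)
      show "norm (Y (y, \<phi>, L) - Y (g j)) \<le> d + \<eta> k" if "j < k" for j
        using G1(2)[OF yG inV(3)[OF that]] \<theta>0(2)[of k] by (simp add: Y_def)
      fix x x' \<tau> assume xx: "x \<in> H (y, \<phi>, L)" "x' \<in> H (y, \<phi>, L)" and \<tau>: "0 \<le> (\<tau>::real)" "\<tau> \<le> 1"
      then have "x \<in> H1" "x' \<in> H1" using LL(2) by (auto simp: H_def)
      then obtain z where z: "z \<in> G1" "norm (z - x) \<le> \<tau> * norm (x - x') + \<epsilon> k"
        "norm (z - x') \<le> (1 - \<tau>) * norm (x - x') + \<epsilon> k" using H1(2) \<tau> by blast
      have "norm (z - (1/2) *\<^sub>R (Y (g a) + Y (g b))) \<ge> d - \<epsilon> k" if "a < k" "b < k" for a b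
        using G1(2)[OF z(1) inV(4)[OF that]] \<theta>0(2)[of k] \<eta>0(2)[of k] by linarith
      then show "\<exists>z\<in>K. norm (z - x) \<le> \<tau> * norm (x - x') + \<epsilon> k \<and> norm (z - x') \<le> (1 - \<tau>) * norm (x - x') + \<epsilon> k \<and>
         (\<forall>a<k. \<forall>b<k. norm (z - (1/2) *\<^sub>R (Y (g a) + Y (g b))) \<ge> d - \<epsilon> k)"
        using z sub[OF G1(1)] by blast
    qed (use y L(1) LL(3) lin ab fc fy in \<open>auto simp: Y_def f_def H_def h_def\<close>)
    then show "\<exists>r. P g k r" by blast
  qed
  then obtain g where g: "\<And>k. P g k (g k)" by blast
  obtain B where B: "\<And>x. x \<in> K \<Longrightarrow> norm x \<le> B" using K(3) by (auto simp: bounded_iff)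
  have YH: "Y (g k) \<in> H (g k)" "H (g k) \<in> \<G>" for k using g[of k] by (auto simp: P_def)
  have HH: "H (g k) \<subseteq> H (g j)" if "j < k" for j k using g[of k] that by (simp add: P_def)
  have YK: "Y (g k) \<in> K" for k using YH sub by blast
  have near: "norm (Y (g k) - Y (g j)) \<le> d + \<epsilon> j" if "j < k" for j k
  proof -
    have "norm (Y (g k) - Y (g j)) \<le> d + \<eta> k" using g[of k] that by (simp add: P_def)
    then show ?thesis using \<eta>0(2)[of k] \<eta>mono(2)[of j k] that by linarith
  qed
  show False
  \<comment> \<open>The tolerance is doubled because errors accumulate: the bounds for
    \<open>z\<close> refer to \<open>norm (Y (g k) - Y (g j))\<close>, which may itself exceed
    \<open>d\<close> by \<open>\<epsilon> j\<close>.\<close>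
  proof (rule no_equidistant_sequence[OF fr d _ B[OF YK], where \<epsilon> = "\<lambda>k. 2 * \<epsilon> k"])
    have "(\<lambda>k. d / real (k + 2)) \<longlonglongrightarrow> 0" by (rule LIMSEQ_ignore_initial_segment[OF lim_const_over_n])
    from tendsto_mult[OF tendsto_const[of 2] this] have "(\<lambda>k. 2 * (d / (real k + 2))) \<longlonglongrightarrow> 0" by (simp add: add.commute)
    then show "(\<lambda>k. 2 * \<epsilon> k) \<longlonglongrightarrow> 0" by (simp add: \<epsilon>_def)
    show "norm (Y (g k) - Y (g j)) \<le> d + 2 * \<epsilon> j" if "j < k" for j k
      using near[OF that] \<epsilon>0(1)[of j] by linarith
    show "\<exists>h. linear h \<and> (\<forall>v. h v \<le> norm v) \<and> (\<forall>j. j \<noteq> k \<longrightarrow> h (Y (g k)) - h (Y (g j)) \<ge> d - 2 * \<epsilon> k)" for k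
    proof (intro exI[of _ "f (g k)"] conjI allI impI)
      show "linear (f (g k))" using g[of k] by (simp add: P_def)
      show "f (g k) v \<le> norm v" for v using g[of k] by (simp add: P_def abs_le_iff)
      have ck: "f (g k) (Y (g k)) - f (g k) c \<ge> d - \<eta> k" using g[of k] by (simp add: P_def)
      fix j assume "j \<noteq> k"
      then consider "j < k" | "k < j" by linarith
      then show "f (g k) (Y (g k)) - f (g k) (Y (g j)) \<ge> d - 2 * \<epsilon> k"
      proof cases
        case 1
        then have "f (g k) (Y (g k)) - f (g k) (Y (g j)) \<ge> d - \<eta> k" using g[of k] by (simp add: P_def)
        then show ?thesis using \<eta>0(2)[of k] \<epsilon>0(1)[of k] by linarith
      next
        case 2
        then have "f (g k) (Y (g j)) \<le> f (g k) c + \<epsilon> k" using g[of j] by (simp add: P_def)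
        then show ?thesis using ck \<eta>0(2)[of k] by linarith
      qed
    qed
    fix j k :: nat and \<tau> :: real assume jk: "j < k" and \<tau>: "0 \<le> \<tau>" "\<tau> \<le> 1"
    have "Y (g k) \<in> H (g j)" using YH(1)[of k] HH[OF jk] by blast
    then obtain z where z: "z \<in> K" "norm (z - Y (g k)) \<le> \<tau> * norm (Y (g k) - Y (g j)) + \<epsilon> j"
      "norm (z - Y (g j)) \<le> (1 - \<tau>) * norm (Y (g k) - Y (g j)) + \<epsilon> j"
      "\<forall>a<j. \<forall>b<j. norm (z - (1/2) *\<^sub>R (Y (g a) + Y (g b))) \<ge> d - \<epsilon> j"
      using g[of j] YH(1)[of j] \<tau> unfolding P_def by blast
    have sc: "t * norm (Y (g k) - Y (g j)) + \<epsilon> j \<le> t * d + 2 * \<epsilon> j" if "0 \<le> t" "t \<le> 1" for t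
    proof -
      have "t * norm (Y (g k) - Y (g j)) \<le> t * (d + \<epsilon> j)" by (rule mult_left_mono[OF near[OF jk] that(1)])
      moreover have "t * \<epsilon> j \<le> 1 * \<epsilon> j" using that \<epsilon>0(1)[of j] by (intro mult_right_mono) auto
      ultimately show ?thesis by (simp add: distrib_left)
    qed
    have "norm (z - Y (g k)) \<le> \<tau> * d + 2 * \<epsilon> j" using z(2) sc[OF \<tau>] by linarith
    moreover have "norm (z - Y (g j)) \<le> (1 - \<tau>) * d + 2 * \<epsilon> j" using z(3) sc[of "1 - \<tau>"] \<tau> by linarith
    moreover have "\<forall>a<j. \<forall>b<j. norm (z - (1/2) *\<^sub>R (Y (g a) + Y (g b))) \<ge> d - 2 * \<epsilon> j"
      using z(4) \<epsilon>0(1)[of j] by force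
    ultimately show "\<exists>z. norm z \<le> B \<and> norm (z - Y (g k)) \<le> \<tau> * d + 2 * \<epsilon> j \<and>
      norm (z - Y (g j)) \<le> (1 - \<tau>) * d + 2 * \<epsilon> j \<and> (\<forall>a<j. \<forall>b<j. norm (z - (1/2) *\<^sub>R (Y (g a) + Y (g b))) \<ge> d - 2 * \<epsilon> j)"
      using B[OF z(1)] by blast
  qed
qed

end

section \<open>Common fixed points of commuting nonexpansive maps\<close>

definition invariant_set :: "('z::real_normed_vector \<Rightarrow> 'z) set \<Rightarrow> 'z set \<Rightarrow> bool" where
  "invariant_set \<Sigma> K \<longleftrightarrow> K \<noteq> {} \<and> closed K \<and> bounded K \<and> convex K \<and> (\<forall>\<sigma>\<in>\<Sigma>. \<forall>x\<in>K. \<sigma> x \<in> K)"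

definition nonexpansive_on :: "'z::real_normed_vector set \<Rightarrow> ('z \<Rightarrow> 'z) set \<Rightarrow> bool" where
  "nonexpansive_on K \<Sigma> \<longleftrightarrow> (\<forall>\<sigma>\<in>\<Sigma>. \<forall>x\<in>K. \<forall>y\<in>K. norm (\<sigma> x - \<sigma> y) \<le> norm (x - y))"

definition commute_on :: "'z set \<Rightarrow> ('z \<Rightarrow> 'z) set \<Rightarrow> bool" where
  "commute_on K \<Sigma> \<longleftrightarrow> (\<forall>\<sigma>\<in>\<Sigma>. \<forall>\<tau>\<in>\<Sigma>. \<forall>x\<in>K. \<sigma> (\<tau> x) = \<tau> (\<sigma> x))"

lemma nonexpansive_on_mono: "nonexpansive_on K \<Sigma> \<Longrightarrow> K' \<subseteq> K \<Longrightarrow> \<Sigma>' \<subseteq> \<Sigma> \<Longrightarrow> nonexpansive_on K' \<Sigma>'"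
  unfolding nonexpansive_on_def by blast

lemma commute_on_mono: "commute_on K \<Sigma> \<Longrightarrow> K' \<subseteq> K \<Longrightarrow> \<Sigma>' \<subseteq> \<Sigma> \<Longrightarrow> commute_on K' \<Sigma>'"
  unfolding commute_on_def by blast

lemma chain_finite_Inter:
  assumes "finite F" "F \<noteq> {}" "\<And>A B. A \<in> F \<Longrightarrow> B \<in> F \<Longrightarrow> A \<subseteq> B \<or> B \<subseteq> A"
  shows "\<Inter>F \<in> F"
  using assms
proof (induction F rule: finite_ne_induct)
  case (insert A F)
  then have "\<Inter>F \<in> F" by simp
  moreover have "A \<subseteq> \<Inter>F \<or> \<Inter>F \<subseteq> A" using insert.prems \<open>\<Inter>F \<in> F\<close> by blast
  ultimately show ?case by (auto simp: Int_absorb1 Int_absorb2)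
qed simp

lemma convex_norm_le:
  "convex {w :: 'z::real_normed_vector. norm (w - p) \<le> r}" "closed {w :: 'z::real_normed_vector. norm (w - p) \<le> r}"
proof -
  have "{w. norm (w - p) \<le> r} = cball p r" by (auto simp: dist_norm norm_minus_commute)
  then show "convex {w. norm (w - p) \<le> r}" "closed {w. norm (w - p) \<le> r}" by simp_all
qed

section \<open>Minimal invariant sets and approximate common fixed points\<close>

context unc_sum
begin

lemma ex_minimal_invariant:
  fixes K0 :: "'z::banach set"
  assumes fr: "fin_rep TYPE('z) (psi_sum S) (psi_norm \<psi>)" and inv: "invariant_set \<Sigma> K0"
  shows "\<exists>K\<subseteq>K0. invariant_set \<Sigma> K \<and> (\<forall>K'\<subseteq>K. invariant_set \<Sigma> K' \<longrightarrow> K' = K)"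
proof -
  \<comment> \<open>Complements turn the search for a minimal set into one for a maximal set;
    \<open>closed_convex_fip\<close> keeps the intersection of a chain of invariant sets
    nonempty.\<close>
  define \<P> where "\<P> = {C. invariant_set \<Sigma> (- C) \<and> - C \<subseteq> K0}"
  have "\<exists>M\<in>\<P>. \<forall>X\<in>\<P>. M \<subseteq> X \<longrightarrow> X = M"
  proof (rule subset_Zorn_nonempty)
    have "- K0 \<in> \<P>" using inv by (simp add: \<P>_def)
    then show "\<P> \<noteq> {}" by blast
    fix C assume C: "C \<noteq> {}" "subset.chain \<P> C"
    have CP: "invariant_set \<Sigma> (- A) \<and> - A \<subseteq> K0" if "A \<in> C" for A
      using C(2) that by (auto simp: subset.chain_def \<P>_def)
    have ch: "A \<subseteq> B \<or> B \<subseteq> A" if "A \<in> C" "B \<in> C" for A B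
      using C(2) that by (auto simp: subset.chain_def)
    obtain A0 where A0: "A0 \<in> C" using C(1) by blast
    have "\<Inter>(uminus ` C) \<noteq> {}"
    proof (rule closed_convex_fip[OF fr, of _ "- A0"])
      show "closed A \<and> convex A" if "A \<in> uminus ` C" for A using that CP by (auto simp: invariant_set_def)
      show "bounded (- A0)" using CP[OF A0] by (simp add: invariant_set_def)
      fix F assume F: "finite F" "F \<subseteq> uminus ` C"
      show "\<Inter>F \<noteq> {}"
      proof (cases "F = {}")
        case False
        have "\<Inter>F \<in> F"
        proof (rule chain_finite_Inter[OF F(1) False])
          fix A B assume "A \<in> F" "B \<in> F"
          then obtain A' B' where "A' \<in> C" "B' \<in> C" "A = - A'" "B = - B'" using F(2) by blast
          then show "A \<subseteq> B \<or> B \<subseteq> A" using ch[of A' B'] by auto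
        qed
        then obtain A where "A \<in> C" "\<Inter>F = - A" using F(2) by blast
        then show ?thesis using CP[of A] by (simp add: invariant_set_def)
      qed simp
    qed (use A0 in blast)
    moreover have eq: "- \<Union>C = \<Inter>(uminus ` C)" by auto
    moreover have "closed (\<Inter>(uminus ` C))" "convex (\<Inter>(uminus ` C))"
      using CP by (auto intro!: closed_Inter convex_Inter simp: invariant_set_def)
    moreover have "bounded (\<Inter>(uminus ` C))"
      using CP[OF A0] A0 by (auto simp: invariant_set_def intro: bounded_subset[of "- A0"])
    moreover have "\<forall>\<sigma>\<in>\<Sigma>. \<forall>x\<in>\<Inter>(uminus ` C). \<sigma> x \<in> \<Inter>(uminus ` C)"
      using CP unfolding invariant_set_def by blast
    moreover have "\<Inter>(uminus ` C) \<subseteq> K0" using CP[OF A0] A0 by blast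
    ultimately show "\<Union>C \<in> \<P>" unfolding \<P>_def invariant_set_def mem_Collect_eq eq by blast
  qed
  then obtain M where M: "M \<in> \<P>" "\<And>X. X \<in> \<P> \<Longrightarrow> M \<subseteq> X \<Longrightarrow> X = M" by blast
  show ?thesis
  proof (intro exI[of _ "- M"] conjI allI impI)
    show "- M \<subseteq> K0" "invariant_set \<Sigma> (- M)" using M(1) by (auto simp: \<P>_def)
    fix K' assume K': "K' \<subseteq> - M" "invariant_set \<Sigma> K'"
    then have "- K' \<in> \<P>" using \<open>- M \<subseteq> K0\<close> by (auto simp: \<P>_def)
    moreover have "M \<subseteq> - K'" using K'(1) by blast
    ultimately have "- K' = M" by (rule M(2))
    then show "K' = - M" by auto
  qed
qed

text \<open>A Goebel-Karlovitz argument with a directed family \<open>\<G>\<close> in place of a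
  sequence of approximate fixed points. It is used twice: with approximate fixed points of one map
  among the exact fixed points of others, and with exact fixed points of finite subfamilies. The
  hypothesis \<open>seg\<close> stands in for convexity, which fixed point sets may lack.\<close>

theorem common_fixed_point_of_approximations:
  fixes K0 :: "'z::banach set"
  assumes fr: "fin_rep TYPE('z) (psi_sum S) (psi_norm \<psi>)"
    and inv: "invariant_set \<Sigma> K0" and ne: "nonexpansive_on K0 \<Sigma>"
    and G: "\<G> \<noteq> {}" and dir: "\<And>G H. G \<in> \<G> \<Longrightarrow> H \<in> \<G> \<Longrightarrow> \<exists>L\<in>\<G>. L \<subseteq> G \<inter> H"
    and app: "\<And>\<sigma> \<epsilon>. \<sigma> \<in> \<Sigma> \<Longrightarrow> \<epsilon> > 0 \<Longrightarrow> \<exists>G\<in>\<G>. \<forall>x\<in>G \<inter> K0. norm (\<sigma> x - x) \<le> \<epsilon>"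
    and meet: "\<And>G K. G \<in> \<G> \<Longrightarrow> invariant_set \<Sigma> K \<Longrightarrow> K \<subseteq> K0 \<Longrightarrow> G \<inter> K \<noteq> {}"
    and seg: "\<And>G K \<epsilon>. G \<in> \<G> \<Longrightarrow> invariant_set \<Sigma> K \<Longrightarrow> K \<subseteq> K0 \<Longrightarrow> \<epsilon> > 0 \<Longrightarrow>
      \<exists>H\<in>\<G>. \<forall>x\<in>H \<inter> K. \<forall>y\<in>H \<inter> K. \<forall>\<tau>. 0 \<le> \<tau> \<longrightarrow> \<tau> \<le> 1 \<longrightarrow>
      (\<exists>z\<in>G \<inter> K. norm (z - x) \<le> \<tau> * norm (x - y) + \<epsilon> \<and> norm (z - y) \<le> (1 - \<tau>) * norm (x - y) + \<epsilon>)"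
  shows "\<exists>x\<in>K0. \<forall>\<sigma>\<in>\<Sigma>. \<sigma> x = x"
proof -
  obtain K where K: "K \<subseteq> K0" "invariant_set \<Sigma> K" and min: "\<And>K'. K' \<subseteq> K \<Longrightarrow> invariant_set \<Sigma> K' \<Longrightarrow> K' = K"
    using ex_minimal_invariant[OF fr inv] by blast
  have Kp: "K \<noteq> {}" "closed K" "bounded K" "convex K" "\<And>\<sigma> x. \<sigma> \<in> \<Sigma> \<Longrightarrow> x \<in> K \<Longrightarrow> \<sigma> x \<in> K"
    using K(2) by (auto simp: invariant_set_def)
  have dirF: "\<exists>L\<in>\<G>. \<forall>G\<in>F. L \<subseteq> G" if "finite F" "F \<subseteq> \<G>" for F
    by (rule directed_finite[OF G dir that])
  text \<open>Asymptotic sublevel sets along a directed family of points are invariant, hence trivial.\<close>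
  have sublevel: "{w \<in> K. \<forall>\<epsilon>>0. \<exists>G\<in>\<G>. \<forall>H\<in>\<G>. H \<subseteq> G \<longrightarrow> (\<forall>x\<in>Q H. norm (x - w) \<le> r + \<epsilon>)} = K"
    if Q: "\<And>H. H \<in> \<G> \<Longrightarrow> Q H \<subseteq> H \<inter> K"
      and w0: "w0 \<in> K" "\<And>\<epsilon>. \<epsilon> > 0 \<Longrightarrow> \<exists>G\<in>\<G>. \<forall>H\<in>\<G>. H \<subseteq> G \<longrightarrow> (\<forall>x\<in>Q H. norm (x - w0) \<le> r + \<epsilon>)" for Q r w0
  proof (rule min)
    let ?D = "{w \<in> K. \<forall>\<epsilon>>0. \<exists>G\<in>\<G>. \<forall>H\<in>\<G>. H \<subseteq> G \<longrightarrow> (\<forall>x\<in>Q H. norm (x - w) \<le> r + \<epsilon>)}"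
    show "?D \<subseteq> K" by blast
    show "invariant_set \<Sigma> ?D"
      unfolding invariant_set_def
    proof (intro conjI ballI)
      show "?D \<noteq> {}" using w0 by blast
      show "bounded ?D" by (rule bounded_subset[OF Kp(3)]) blast
      show "closed ?D"
        unfolding closed_sequential_limits
      proof (intro allI impI)
        fix u w assume "(\<forall>n. u n \<in> ?D) \<and> u \<longlonglongrightarrow> w"
        then have u: "\<And>n. u n \<in> K" "\<And>n \<epsilon>. \<epsilon> > 0 \<Longrightarrow> \<exists>G\<in>\<G>. \<forall>H\<in>\<G>. H \<subseteq> G \<longrightarrow> (\<forall>x\<in>Q H. norm (x - u n) \<le> r + \<epsilon>)"
          and lim: "u \<longlonglongrightarrow> w" by auto
        have wK: "w \<in> K" using closed_sequentially[OF Kp(2) _ lim] u(1) by blast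
        have "\<exists>G\<in>\<G>. \<forall>H\<in>\<G>. H \<subseteq> G \<longrightarrow> (\<forall>x\<in>Q H. norm (x - w) \<le> r + \<epsilon>)" if \<epsilon>: "\<epsilon> > 0" for \<epsilon>
        proof -
          have "\<epsilon> / 2 > 0" using \<epsilon> by simp
          from LIMSEQ_D[OF lim this] obtain n where n: "norm (u n - w) < \<epsilon> / 2" by blast
          obtain G where GG: "G \<in> \<G>" "\<forall>H\<in>\<G>. H \<subseteq> G \<longrightarrow> (\<forall>x\<in>Q H. norm (x - u n) \<le> r + \<epsilon> / 2)"
            using u(2)[OF \<open>\<epsilon> / 2 > 0\<close>, of n] by blast
          have "norm (x - w) \<le> r + \<epsilon>" if "norm (x - u n) \<le> r + \<epsilon> / 2" for x
            using norm_triangle_ineq[of "x - u n" "u n - w"] that n by simp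
          then show ?thesis using GG by (intro bexI[of _ G]) blast
        qed
        then show "w \<in> ?D" using wK by simp
      qed
      show "convex ?D"
        unfolding convex_def
      proof (intro ballI allI impI)
        fix w1 w2 and s t :: real assume w: "w1 \<in> ?D" "w2 \<in> ?D" and st: "0 \<le> s" "0 \<le> t" "s + t = 1"
        have "\<exists>G\<in>\<G>. \<forall>H\<in>\<G>. H \<subseteq> G \<longrightarrow> (\<forall>x\<in>Q H. norm (x - (s *\<^sub>R w1 + t *\<^sub>R w2)) \<le> r + \<epsilon>)" if \<epsilon>: "\<epsilon> > 0" for \<epsilon>
        proof -
          obtain G1 where G1: "G1 \<in> \<G>" "\<forall>H\<in>\<G>. H \<subseteq> G1 \<longrightarrow> (\<forall>x\<in>Q H. norm (x - w1) \<le> r + \<epsilon>)" using w(1) \<epsilon> by blast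
          obtain G2 where G2: "G2 \<in> \<G>" "\<forall>H\<in>\<G>. H \<subseteq> G2 \<longrightarrow> (\<forall>x\<in>Q H. norm (x - w2) \<le> r + \<epsilon>)" using w(2) \<epsilon> by blast
          obtain L where L: "L \<in> \<G>" "L \<subseteq> G1 \<inter> G2" using dir[OF G1(1) G2(1)] by blast
          have "norm (x - (s *\<^sub>R w1 + t *\<^sub>R w2)) \<le> r + \<epsilon>"
            if "norm (x - w1) \<le> r + \<epsilon>" "norm (x - w2) \<le> r + \<epsilon>" for x
            using convexD[OF convex_norm_le(1)[of x "r + \<epsilon>"], of w1 w2 s t] that st
            by (simp add: norm_minus_commute)
          then show ?thesis using G1(2) G2(2) L by (intro bexI[of _ L]) blast+
        qed
        moreover have "s *\<^sub>R w1 + t *\<^sub>R w2 \<in> K" using convexD[OF Kp(4) _ _ st] w by blast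
        ultimately show "s *\<^sub>R w1 + t *\<^sub>R w2 \<in> ?D" by simp
      qed
      fix \<sigma> w assume \<sigma>: "\<sigma> \<in> \<Sigma>" and w: "w \<in> ?D"
      have "\<exists>G\<in>\<G>. \<forall>H\<in>\<G>. H \<subseteq> G \<longrightarrow> (\<forall>x\<in>Q H. norm (x - \<sigma> w) \<le> r + \<epsilon>)" if \<epsilon>: "\<epsilon> > 0" for \<epsilon>
      proof -
        have e2: "\<epsilon> / 2 > 0" using \<epsilon> by simp
        obtain G1 where G1: "G1 \<in> \<G>" "\<forall>H\<in>\<G>. H \<subseteq> G1 \<longrightarrow> (\<forall>x\<in>Q H. norm (x - w) \<le> r + \<epsilon> / 2)" using w e2 by blast
        obtain G2 where G2: "G2 \<in> \<G>" "\<forall>x\<in>G2 \<inter> K0. norm (\<sigma> x - x) \<le> \<epsilon> / 2" using app[OF \<sigma> e2] by blast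
        obtain L where L: "L \<in> \<G>" "L \<subseteq> G1 \<inter> G2" using dir[OF G1(1) G2(1)] by blast
        show ?thesis
        proof (intro bexI[OF _ L(1)] ballI impI)
          fix H x assume H: "H \<in> \<G>" "H \<subseteq> L" and x: "x \<in> Q H"
          have "H \<subseteq> G1" "H \<subseteq> G2" using H(2) L(2) by auto
          then have "norm (x - w) \<le> r + \<epsilon> / 2" using G1(2) H(1) x by blast
          moreover have xK: "x \<in> G2 \<inter> K0" "x \<in> K" using Q[OF H(1)] x \<open>H \<subseteq> G2\<close> K(1) by auto
          then have "norm (\<sigma> x - x) \<le> \<epsilon> / 2" using G2(2) by blast
          moreover have "norm (\<sigma> x - \<sigma> w) \<le> norm (x - w)"
            using ne \<sigma> xK(1) w K(1) unfolding nonexpansive_on_def by blast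
          moreover have "norm (x - \<sigma> w) \<le> norm (\<sigma> x - x) + norm (\<sigma> x - \<sigma> w)"
            using norm_triangle_ineq[of "x - \<sigma> x" "\<sigma> x - \<sigma> w"] by (simp add: norm_minus_commute)
          ultimately show "norm (x - \<sigma> w) \<le> r + \<epsilon>" by argo
        qed
      qed
      then show "\<sigma> w \<in> ?D" using Kp(5)[OF \<sigma>] w by simp
    qed
  qed
  \<comment> \<open>\<open>up r w\<close> bounds the asymptotic distance from \<open>w\<close> to
    the points of \<open>K\<close> along \<open>\<G>\<close>. By minimality the choice of
    \<open>w\<close> in \<open>K\<close> does not matter, so the infimum \<open>d\<close> of such
    \<open>r\<close> is a constant of \<open>K\<close>.\<close>
  define up where "up r w \<longleftrightarrow> (\<forall>\<epsilon>>0. \<exists>G\<in>\<G>. \<forall>x\<in>G \<inter> K. norm (x - w) \<le> r + \<epsilon>)" for r w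
  have up_D: "\<exists>G\<in>\<G>. \<forall>x\<in>G \<inter> K. norm (x - w) \<le> r + \<epsilon>" if "up r w" "\<epsilon> > 0" for r w \<epsilon>
    using that by (simp add: up_def)
  have up_all: "up r w" if "up r w0" "w0 \<in> K" "w \<in> K" for r w w0
  proof -
    have "\<exists>G\<in>\<G>. \<forall>H\<in>\<G>. H \<subseteq> G \<longrightarrow> (\<forall>x\<in>H \<inter> K. norm (x - w0) \<le> r + \<epsilon>)" if e: "\<epsilon> > 0" for \<epsilon>
    proof -
      obtain G where "G \<in> \<G>" and GK: "\<forall>x\<in>G \<inter> K. norm (x - w0) \<le> r + \<epsilon>"
        using up_D[OF \<open>up r w0\<close> e] ..
      then show ?thesis by (intro bexI[of _ G]) auto
    qed
    from sublevel[of "\<lambda>H. H \<inter> K", OF _ that(2) this]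
    have "w \<in> {w \<in> K. \<forall>\<epsilon>>0. \<exists>G\<in>\<G>. \<forall>H\<in>\<G>. H \<subseteq> G \<longrightarrow> (\<forall>x\<in>H \<inter> K. norm (x - w) \<le> r + \<epsilon>)}" using that(3) by simp
    then have w: "\<forall>\<epsilon>>0. \<exists>G\<in>\<G>. \<forall>H\<in>\<G>. H \<subseteq> G \<longrightarrow> (\<forall>x\<in>H \<inter> K. norm (x - w) \<le> r + \<epsilon>)" by simp
    show ?thesis
      unfolding up_def
    proof (intro allI impI)
      fix \<epsilon> :: real assume "\<epsilon> > 0"
      with w obtain G where "G \<in> \<G>" "\<forall>H\<in>\<G>. H \<subseteq> G \<longrightarrow> (\<forall>x\<in>H \<inter> K. norm (x - w) \<le> r + \<epsilon>)" by auto
      then show "\<exists>G\<in>\<G>. \<forall>x\<in>G \<inter> K. norm (x - w) \<le> r + \<epsilon>" by (intro bexI[of _ G]) auto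
    qed
  qed
  obtain B where B: "\<And>x. x \<in> K \<Longrightarrow> norm x \<le> B" using Kp(3) by (auto simp: bounded_iff)
  obtain w0 where w0: "w0 \<in> K" using Kp(1) by blast
  define R where "R = {r. up r w0}"
  have R0: "0 \<le> r" if "r \<in> R" for r
  proof (rule field_le_epsilon)
    fix e :: real assume "e > 0"
    have "up r w0" using \<open>r \<in> R\<close> by (simp add: R_def)
    from up_D[OF this \<open>e > 0\<close>] obtain G where G1: "G \<in> \<G>" "\<forall>x\<in>G \<inter> K. norm (x - w0) \<le> r + e" ..
    obtain x where "x \<in> G \<inter> K" using meet[OF G1(1) K(2,1)] by blast
    then have "norm (x - w0) \<le> r + e" using G1(2) by blast
    then show "0 \<le> r + e" using norm_ge_zero[of "x - w0"] by linarith
  qed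
  have "up (2 * B) w0"
    unfolding up_def
  proof (intro allI impI)
    fix \<epsilon> :: real assume "\<epsilon> > 0"
    have "norm (x - w0) \<le> 2 * B + \<epsilon>" if "x \<in> K" for x
      using norm_triangle_ineq4[of x w0] B[OF that] B[OF w0] \<open>\<epsilon> > 0\<close> by linarith
    then show "\<exists>G\<in>\<G>. \<forall>x\<in>G \<inter> K. norm (x - w0) \<le> 2 * B + \<epsilon>" using G by blast
  qed
  then have Rne: "R \<noteq> {}" by (auto simp: R_def)
  have bdd: "bdd_below R" using R0 by (auto simp: bdd_below_def)
  define d where "d = Inf R"
  have d0: "d \<ge> 0" unfolding d_def using Rne R0 by (intro cInf_greatest) auto
  have upd: "up d w" if "w \<in> K" for w
  proof -
    have "up d w0"
      unfolding up_def
    proof (intro allI impI)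
      fix \<epsilon> :: real assume "\<epsilon> > 0"
      then have "Inf R < d + \<epsilon> / 2" by (simp add: d_def)
      then obtain r where r: "r \<in> R" "r < d + \<epsilon> / 2" using cInf_lessD[OF Rne] by blast
      have "\<epsilon> / 2 > 0" using \<open>\<epsilon> > 0\<close> by simp
      have "up r w0" using r(1) by (simp add: R_def)
      from up_D[OF this \<open>\<epsilon> / 2 > 0\<close>] obtain G where G1: "G \<in> \<G>" "\<forall>x\<in>G \<inter> K. norm (x - w0) \<le> r + \<epsilon> / 2" ..
      have "r + \<epsilon> / 2 \<le> d + \<epsilon>" using r(2) by simp
      then have "\<forall>x\<in>G \<inter> K. norm (x - w0) \<le> d + \<epsilon>" using G1(2) order_trans by blast
      then show "\<exists>G\<in>\<G>. \<forall>x\<in>G \<inter> K. norm (x - w0) \<le> d + \<epsilon>" using G1(1) by blast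
    qed
    then show ?thesis using up_all[OF _ w0 that] by blast
  qed
  \<comment> \<open>If points selected along \<open>\<G>\<close> stay within
    \<open>d - \<epsilon>\<close> of one \<open>w\<close>, minimality makes this hold asymptotically
    for every \<open>v\<close> in \<open>K\<close>. The enlarged balls about all \<open>v\<close>
    then meet in a point \<open>u\<close> within \<open>d - \<epsilon>\<close> of the whole of
    \<open>K\<close>, so \<open>up (d - \<epsilon>) u\<close>, against the choice of
    \<open>d\<close>.\<close>
  have low: "\<exists>G\<in>\<G>. \<forall>x\<in>G \<inter> K. d - \<epsilon> \<le> norm (x - w)" if w: "w \<in> K" and \<epsilon>: "\<epsilon> > 0" for w \<epsilon>
  proof (rule ccontr)
    assume "\<not> ?thesis"
    then have "\<forall>G\<in>\<G>. \<exists>x. x \<in> G \<inter> K \<and> norm (x - w) < d - \<epsilon>" by (meson not_le)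
    then obtain x where x: "\<And>G. G \<in> \<G> \<Longrightarrow> x G \<in> G \<inter> K" "\<And>G. G \<in> \<G> \<Longrightarrow> norm (x G - w) < d - \<epsilon>" by metis
    have "{v \<in> K. \<forall>e>0. \<exists>G\<in>\<G>. \<forall>H\<in>\<G>. H \<subseteq> G \<longrightarrow> (\<forall>x\<in>{x H}. norm (x - v) \<le> (d - \<epsilon>) + e)} = K"
    proof (rule sublevel[of "\<lambda>H. {x H}" w])
      show "\<exists>G\<in>\<G>. \<forall>H\<in>\<G>. H \<subseteq> G \<longrightarrow> (\<forall>x\<in>{x H}. norm (x - w) \<le> d - \<epsilon> + e)" if "e > 0" for e
      proof -
        have "norm (x H - w) \<le> d - \<epsilon> + e" if "H \<in> \<G>" for H using x(2)[OF that] \<open>e > 0\<close> by linarith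
        then show ?thesis using G by auto
      qed
    qed (use x w in auto)
    then have near: "\<exists>G\<in>\<G>. \<forall>H\<in>\<G>. H \<subseteq> G \<longrightarrow> norm (x H - v) \<le> (d - \<epsilon>) + e" if "v \<in> K" "e > 0" for v e
    proof -
      have "v \<in> {v \<in> K. \<forall>e>0. \<exists>G\<in>\<G>. \<forall>H\<in>\<G>. H \<subseteq> G \<longrightarrow> (\<forall>x\<in>{x H}. norm (x - v) \<le> (d - \<epsilon>) + e)}"
        using that(1) \<open>_ = K\<close> by simp
      then show ?thesis using that(2) by simp
    qed
    define \<A> where "\<A> = insert K ((\<lambda>(v, e). K \<inter> {u. norm (u - v) \<le> d - \<epsilon> + e}) ` (K \<times> {0<..}))"
    have "\<Inter>\<A> \<noteq> {}"
    proof (rule closed_convex_fip[OF fr, of _ K])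
      show "closed A \<and> convex A" if "A \<in> \<A>" for A
        using that Kp(2,4) by (auto simp: \<A>_def intro!: closed_Int convex_Int convex_norm_le)
      show "K \<in> \<A>" by (simp add: \<A>_def)
      fix F assume F: "finite F" "F \<subseteq> \<A>"
      have "\<forall>A\<in>F. \<exists>G. G \<in> \<G> \<and> (\<forall>H\<in>\<G>. H \<subseteq> G \<longrightarrow> x H \<in> A)"
      proof
        fix A assume "A \<in> F"
        then have "A \<in> \<A>" using F(2) by blast
        then consider "A = K" | v e where "v \<in> K" "e > 0" "A = K \<inter> {u. norm (u - v) \<le> d - \<epsilon> + e}"
          by (auto simp: \<A>_def)
        then show "\<exists>G. G \<in> \<G> \<and> (\<forall>H\<in>\<G>. H \<subseteq> G \<longrightarrow> x H \<in> A)"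
        proof cases
          case 1 then show ?thesis using x(1) G by blast
        next
          case 2
          then show ?thesis using near[OF 2(1,2)] x(1) by blast
        qed
      qed
      then obtain g where g: "\<And>A. A \<in> F \<Longrightarrow> g A \<in> \<G>" "\<And>A H. A \<in> F \<Longrightarrow> H \<in> \<G> \<Longrightarrow> H \<subseteq> g A \<Longrightarrow> x H \<in> A" by metis
      obtain L where L: "L \<in> \<G>" "\<forall>G\<in>g ` F. L \<subseteq> G" using dirF[of "g ` F"] F(1) g(1) by blast
      then have "x L \<in> \<Inter>F" using g(2) by blast
      then show "\<Inter>F \<noteq> {}" by blast
    qed (rule Kp(3))
    then obtain u where u: "u \<in> \<Inter>\<A>" by blast
    then have uK: "u \<in> K" by (simp add: \<A>_def)
    have un: "norm (u - v) \<le> d - \<epsilon> + e" if "v \<in> K" "e > 0" for v e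
      using u that by (auto simp: \<A>_def)
    have "up (d - \<epsilon>) u"
      unfolding up_def
    proof (intro allI impI)
      fix e :: real assume "e > 0"
      obtain G0 where "G0 \<in> \<G>" using G by blast
      moreover have "\<forall>x\<in>G0 \<inter> K. norm (x - u) \<le> d - \<epsilon> + e" using un \<open>e > 0\<close> by (simp add: norm_minus_commute)
      ultimately show "\<exists>G\<in>\<G>. \<forall>x\<in>G \<inter> K. norm (x - u) \<le> d - \<epsilon> + e" by blast
    qed
    then have "up (d - \<epsilon>) w0" by (rule up_all[OF _ uK w0])
    then have "d - \<epsilon> \<in> R" by (simp add: R_def)
    then have "d \<le> d - \<epsilon>" using cInf_lower[OF _ bdd] by (simp add: d_def)
    then show False using \<epsilon> by simp
  qed
  show ?thesis
  proof (cases "d = 0")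
    case True
    have "\<sigma> w0 = w0" if \<sigma>: "\<sigma> \<in> \<Sigma>" for \<sigma>
    proof -
      have "norm (\<sigma> w0 - w0) \<le> 0 + e" if "e > 0" for e
      proof -
        have e: "e / 3 > 0" using that by simp
        obtain G1 where G1: "G1 \<in> \<G>" "\<forall>x\<in>G1 \<inter> K. norm (x - w0) \<le> e / 3" using up_D[OF upd[OF w0] e] True by auto
        obtain G2 where G2: "G2 \<in> \<G>" "\<forall>x\<in>G2 \<inter> K0. norm (\<sigma> x - x) \<le> e / 3" using app[OF \<sigma> e] by blast
        obtain L where L: "L \<in> \<G>" "L \<subseteq> G1 \<inter> G2" using dir[OF G1(1) G2(1)] by blast
        obtain x where x: "x \<in> L" "x \<in> K" using meet[OF L(1) K(2,1)] by blast
        then have 1: "norm (x - w0) \<le> e / 3" "norm (\<sigma> x - x) \<le> e / 3" using G1(2) G2(2) L(2) K(1) by blast+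
        have 2: "norm (\<sigma> x - \<sigma> w0) \<le> norm (x - w0)"
          using ne \<sigma> x(2) w0 K(1) unfolding nonexpansive_on_def by blast
        have "\<sigma> w0 - w0 = (\<sigma> w0 - \<sigma> x) + ((\<sigma> x - x) + (x - w0))" by simp
        then have "norm (\<sigma> w0 - w0) \<le> norm (\<sigma> w0 - \<sigma> x) + (norm (\<sigma> x - x) + norm (x - w0))"
          using order_trans[OF norm_triangle_ineq add_left_mono[OF norm_triangle_ineq]] by metis
        then show ?thesis using 1 2 by (simp add: norm_minus_commute)
      qed
      then have "norm (\<sigma> w0 - w0) \<le> 0" by (rule field_le_epsilon)
      then show ?thesis by simp
    qed
    then show ?thesis using w0 K(1) by blast
  next
    case False
    then have d: "d > 0" using d0 by simp
    have False
    proof (rule no_equidistant_family[OF fr Kp(2,4,3) d, of "(\<lambda>G. G \<inter> K) ` \<G>"])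
      show "(\<lambda>G. G \<inter> K) ` \<G> \<noteq> {}" using G by blast
      show "\<exists>L\<in>(\<lambda>G. G \<inter> K) ` \<G>. L \<subseteq> A \<inter> B" if AB: "A \<in> (\<lambda>G. G \<inter> K) ` \<G>" "B \<in> (\<lambda>G. G \<inter> K) ` \<G>" for A B
      proof -
        obtain G H where GH: "G \<in> \<G>" "H \<in> \<G>" "A = G \<inter> K" "B = H \<inter> K" using AB by blast
        obtain L where L: "L \<in> \<G>" "L \<subseteq> G \<inter> H" using dir[OF GH(1,2)] ..
        then have "L \<inter> K \<subseteq> A \<inter> B" unfolding GH(3,4) by blast
        then show ?thesis using L(1) by blast
      qed
      show "A \<noteq> {}" if "A \<in> (\<lambda>G. G \<inter> K) ` \<G>" for A using that meet[OF _ K(2,1)] by blast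
      show "\<exists>G\<in>(\<lambda>G. G \<inter> K) ` \<G>. \<forall>x\<in>G. d - \<epsilon> \<le> norm (x - w) \<and> norm (x - w) \<le> d + \<epsilon>"
        if w: "w \<in> K" and \<epsilon>: "\<epsilon> > 0" for w \<epsilon>
      proof -
        obtain G1 where G1: "G1 \<in> \<G>" "\<forall>x\<in>G1 \<inter> K. d - \<epsilon> \<le> norm (x - w)" using low[OF w \<epsilon>] by blast
        obtain G2 where G2: "G2 \<in> \<G>" "\<forall>x\<in>G2 \<inter> K. norm (x - w) \<le> d + \<epsilon>" using up_D[OF upd[OF w] \<epsilon>] ..
        obtain L where L: "L \<in> \<G>" "L \<subseteq> G1 \<inter> G2" using dir[OF G1(1) G2(1)] by blast
        then have "\<forall>x\<in>L \<inter> K. d - \<epsilon> \<le> norm (x - w) \<and> norm (x - w) \<le> d + \<epsilon>" using G1(2) G2(2) by blast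
        then show ?thesis using L(1) by blast
      qed
      show "\<exists>H\<in>(\<lambda>G. G \<inter> K) ` \<G>. \<forall>x\<in>H. \<forall>y\<in>H. \<forall>\<tau>. 0 \<le> \<tau> \<longrightarrow> \<tau> \<le> 1 \<longrightarrow>
        (\<exists>z\<in>A. norm (z - x) \<le> \<tau> * norm (x - y) + \<epsilon> \<and> norm (z - y) \<le> (1 - \<tau>) * norm (x - y) + \<epsilon>)"
        if A: "A \<in> (\<lambda>G. G \<inter> K) ` \<G>" and \<epsilon>: "\<epsilon> > 0" for A \<epsilon>
      proof -
        obtain G where GG: "G \<in> \<G>" "A = G \<inter> K" using A by blast
        obtain H where H: "H \<in> \<G>" "\<forall>x\<in>H \<inter> K. \<forall>y\<in>H \<inter> K. \<forall>\<tau>. 0 \<le> \<tau> \<longrightarrow> \<tau> \<le> 1 \<longrightarrow>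
          (\<exists>z\<in>G \<inter> K. norm (z - x) \<le> \<tau> * norm (x - y) + \<epsilon> \<and> norm (z - y) \<le> (1 - \<tau>) * norm (x - y) + \<epsilon>)"
          using seg[OF GG(1) K(2,1) \<epsilon>] ..
        show ?thesis unfolding GG(2) by (intro bexI[of _ "H \<inter> K"], rule H(2)) (use H(1) in blast)
      qed
    qed auto
    then show ?thesis ..
  qed
qed

end

text \<open>The Goebel--Kirk inequality; only convexity of the distances to the points \<open>x n\<close> and \<open>y m\<close>
  is used, so it is available in the nonconvex fixed point sets below.\<close>

lemma goebel_kirk:
  fixes x y :: "nat \<Rightarrow> 'z::real_normed_vector"
  assumes ne: "\<And>n. norm (y (Suc n) - y n) \<le> norm (x (Suc n) - x n)"
    and half: "\<And>n. norm (x (Suc n) - x n) \<le> norm (y n - x n) / 2"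
    and mid: "\<And>n m. norm (x (Suc n) - y m) \<le> norm (x n - y m) / 2 + norm (y n - y m) / 2"
  shows "(1 + real n / 2) * norm (y i - x i) \<le> norm (y (i + n) - x i) + 2 ^ n * (norm (y i - x i) - norm (y (i + n) - x (i + n)))"
    and "norm (y (Suc i) - x (Suc i)) \<le> norm (y i - x i)"
proof -
  define d where "d n = norm (y n - x n)" for n
  have dec: "d (Suc n) \<le> d n" for n
  proof -
    have "d (Suc n) \<le> norm (x (Suc n) - y n) + norm (y (Suc n) - y n)"
      using norm_triangle_ineq4[of "y (Suc n) - y n" "x (Suc n) - y n"] by (simp add: d_def add.commute)
    moreover have "norm (x (Suc n) - y n) \<le> d n / 2" using mid[of n n] by (simp add: d_def norm_minus_commute)
    ultimately show ?thesis using ne[of n] half[of n] by (simp add: d_def)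
  qed
  then show "norm (y (Suc i) - x (Suc i)) \<le> norm (y i - x i)" by (simp add: d_def)
  have decn: "d (i + k) \<le> d i" for i k by (induction k) (use dec order_trans in auto)
  have ydist: "norm (y (i + k) - y i) \<le> real k / 2 * d i" for i k
  proof (induction k)
    case (Suc k)
    have "norm (y (i + Suc k) - y i) \<le> norm (y (Suc (i + k)) - y (i + k)) + norm (y (i + k) - y i)"
      using norm_triangle_ineq[of "y (Suc (i + k)) - y (i + k)" "y (i + k) - y i"] by simp
    also have "\<dots> \<le> d i / 2 + real k / 2 * d i"
      using ne[of "i + k"] half[of "i + k"] decn[of i k] Suc by (simp add: d_def)
    finally show ?case by (simp add: field_simps)
  qed simp
  have "(1 + real n / 2) * d i \<le> norm (y (i + n) - x i) + 2 ^ n * (d i - d (i + n))" for i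
  proof (induction n arbitrary: i)
    case (Suc n)
    \<comment> \<open>\<open>2 ^ Suc n - (real n + 2)\<close> multiplies
      \<open>d i - d (Suc i)\<close> when \<open>d (Suc i)\<close> is replaced by \<open>d i\<close>
      in the induction step, so it must be nonnegative.\<close>
    have pow: "real n + 2 \<le> 2 ^ Suc n"
    proof (induction n)
      case (Suc n)
      have "real (Suc n) + 2 \<le> 2 * (real n + 2)" by simp
      also have "\<dots> \<le> 2 * 2 ^ Suc n" using Suc by (intro mult_left_mono) auto
      finally show ?case by simp
    qed simp
    have "norm (y (Suc i + n) - x (Suc i)) \<le> norm (y (i + Suc n) - x i) / 2 + norm (y (i + Suc n) - y i) / 2"
      using mid[of i "i + Suc n"] by (simp add: norm_minus_commute)
    moreover have "norm (y (i + Suc n) - y i) \<le> real (Suc n) / 2 * d i" by (rule ydist)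
    ultimately have "2 * ((1 + real n / 2) * d (Suc i)) \<le> norm (y (i + Suc n) - x i) + real (Suc n) / 2 * d i
        + 2 * (2 ^ n * (d (Suc i) - d (i + Suc n)))"
      using Suc[of "Suc i"] by simp
    moreover have "(2 ^ Suc n - (real n + 2)) * (d i - d (Suc i)) \<ge> 0"
      using pow dec[of i] by (intro mult_nonneg_nonneg) auto
    ultimately show ?case by (simp add: algebra_simps add_divide_distrib)
  qed (simp add: d_def)
  then show "(1 + real n / 2) * norm (y i - x i) \<le> norm (y (i + n) - x i) + 2 ^ n * (norm (y i - x i) - norm (y (i + n) - x (i + n)))"
    unfolding d_def .
qed

text \<open>\<open>N\<close> depends on \<open>D\<close> and \<open>\<epsilon>\<close> only, which
  lets one number of steps serve all sets and starting points in \<open>commuting_step\<close>. If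
  the distance stayed above \<open>\<epsilon>\<close>, each block of \<open>n\<close> steps would
  lower it by \<open>D / 2 ^ n\<close>, and \<open>2 ^ n\<close> blocks would use up all of
  \<open>D\<close>.\<close>

lemma goebel_kirk_uniform:
  assumes "D \<ge> 0" "\<epsilon> > 0"
  obtains N where "\<And>x y :: nat \<Rightarrow> 'z::real_normed_vector.
    (\<And>n. norm (y (Suc n) - y n) \<le> norm (x (Suc n) - x n)) \<Longrightarrow>
    (\<And>n. norm (x (Suc n) - x n) \<le> norm (y n - x n) / 2) \<Longrightarrow>
    (\<And>n m. norm (x (Suc n) - y m) \<le> norm (x n - y m) / 2 + norm (y n - y m) / 2) \<Longrightarrow>
    (\<And>n m. norm (y n - x m) \<le> D) \<Longrightarrow> norm (y N - x N) \<le> \<epsilon>"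
proof -
  \<comment> \<open>This makes \<open>(1 + real n / 2) * \<epsilon>\<close> at least
    \<open>2 * D\<close>: one \<open>D\<close> pays for \<open>norm (y (i + n) - x i)\<close>, the
    other for the drop over the block.\<close>
  obtain n :: nat where n: "4 * D / \<epsilon> < real n" using reals_Archimedean2 by blast
  then have n2: "2 * D \<le> (1 + real n / 2) * \<epsilon>" using assms(2) by (simp add: field_simps)
  show thesis
  proof (rule that[of "2 ^ n * n"])
    fix x y :: "nat \<Rightarrow> 'z"
    assume gk: "\<And>n. norm (y (Suc n) - y n) \<le> norm (x (Suc n) - x n)"
      "\<And>n. norm (x (Suc n) - x n) \<le> norm (y n - x n) / 2"
      "\<And>n m. norm (x (Suc n) - y m) \<le> norm (x n - y m) / 2 + norm (y n - y m) / 2"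
      and D: "\<And>n m. norm (y n - x m) \<le> D"
    define d where "d n = norm (y n - x n)" for n
    have dec: "d (Suc i) \<le> d i" for i unfolding d_def by (rule goebel_kirk(2)[where x = x and y = y, OF gk])
    have decm: "d j \<le> d i" if "i \<le> j" for i j using lift_Suc_antimono_le[of d, OF dec that] .
    show "norm (y (2 ^ n * n) - x (2 ^ n * n)) \<le> \<epsilon>"
    proof (rule ccontr)
      assume "\<not> ?thesis"
      then have big: "\<epsilon> < d (2 ^ n * n)" by (simp add: d_def)
      have step: "D / 2 ^ n \<le> d i - d (i + n)" if "i \<le> 2 ^ n * n" for i
      proof -
        have "\<epsilon> \<le> d i" using big decm[OF that] by linarith
        then have "(1 + real n / 2) * \<epsilon> \<le> (1 + real n / 2) * d i" by (intro mult_left_mono) auto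
        also have "\<dots> \<le> norm (y (i + n) - x i) + 2 ^ n * (d i - d (i + n))"
          unfolding d_def by (rule goebel_kirk(1)[where x = x and y = y, OF gk])
        finally have "D \<le> (d i - d (i + n)) * 2 ^ n" using D[of "i + n" i] n2 by (simp add: mult.commute)
        then show ?thesis by (simp add: pos_divide_le_eq)
      qed
      have "real k * (D / 2 ^ n) \<le> d 0 - d (k * n)" if "k \<le> 2 ^ n" for k
        using that
      proof (induction k)
        case (Suc k)
        have "D / 2 ^ n \<le> d (k * n) - d (k * n + n)" by (rule step) (use Suc.prems in \<open>simp add: mult_le_mono1\<close>)
        then show ?case using Suc by (simp add: algebra_simps add_divide_distrib)
      qed simp
      from this[of "2 ^ n"] have "D \<le> d 0 - d (2 ^ n * n)" by simp
      then show False using D[of 0 0] big assms(2) by (simp add: d_def)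
    qed
  qed
qed

section \<open>Finite and arbitrary commuting families\<close>

context unc_sum
begin

text \<open>The common fixed points \<open>E K\<close> of \<open>F\<close> need not form a convex
  set, but \<open>R\<close> maps them to themselves and they admit a substitute for segments.
  Halving steps from \<open>w\<close> towards \<open>R w\<close> in this structure satisfy the
  Goebel-Kirk hypotheses, so \<open>E K\<close> contains approximate fixed points of
  \<open>R\<close>.\<close>

lemma commuting_step:
  fixes K0 :: "'z::banach set"
  assumes fr: "fin_rep TYPE('z) (psi_sum S) (psi_norm \<psi>)"
    and inv: "invariant_set (insert R F) K0" and ne: "nonexpansive_on K0 (insert R F)"
    and com: "commute_on K0 (insert R F)"
    and fp: "\<And>K. K \<subseteq> K0 \<Longrightarrow> invariant_set F K \<Longrightarrow> \<exists>x\<in>K. \<forall>\<sigma>\<in>F. \<sigma> x = x"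
  shows "\<exists>x\<in>K0. \<forall>\<sigma>\<in>insert R F. \<sigma> x = x"
proof -
  define G where "G n = {x. (\<forall>\<sigma>\<in>F. \<sigma> x = x) \<and> norm (R x - x) \<le> 1 / real (Suc n)}" for n
  define E where "E K = {x \<in> K. \<forall>\<sigma>\<in>F. \<sigma> x = x}" for K
  \<comment> \<open>The points of \<open>K\<close> obeying the distance bounds to all of
    \<open>E K\<close> form a convex set invariant under \<open>F\<close>, nonempty because it
    contains the linear point of division; \<open>fp\<close> yields a fixed point in it.\<close>
  have takahashi: "\<exists>w\<in>E K. \<forall>p\<in>E K. norm (w - p) \<le> (1 - t) * norm (a - p) + t * norm (b - p)"
    if K: "invariant_set (insert R F) K" "K \<subseteq> K0" and ab: "a \<in> K" "b \<in> K" and t: "0 \<le> t" "t \<le> 1" for K a b and t :: real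
  proof -
    define D where "D = K \<inter> (\<Inter>p\<in>E K. {w. norm (w - p) \<le> (1 - t) * norm (a - p) + t * norm (b - p)})"
    have "\<exists>x\<in>D. \<forall>\<sigma>\<in>F. \<sigma> x = x"
    proof (rule fp)
      show "D \<subseteq> K0" using K(2) by (auto simp: D_def)
      show "invariant_set F D"
        unfolding invariant_set_def
      proof (intro conjI ballI)
        have "norm ((1 - t) *\<^sub>R a + t *\<^sub>R b - p) \<le> (1 - t) * norm (a - p) + t * norm (b - p)" for p
        proof -
          have "(1 - t) *\<^sub>R a + t *\<^sub>R b - p = (1 - t) *\<^sub>R (a - p) + t *\<^sub>R (b - p)" by (simp add: algebra_simps)
          then show ?thesis using norm_triangle_ineq[of "(1 - t) *\<^sub>R (a - p)" "t *\<^sub>R (b - p)"] t by simp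
        qed
        moreover have "(1 - t) *\<^sub>R a + t *\<^sub>R b \<in> K"
          using K(1) ab t by (intro convexD) (auto simp: invariant_set_def)
        ultimately have "(1 - t) *\<^sub>R a + t *\<^sub>R b \<in> D" by (simp add: D_def)
        then show "D \<noteq> {}" by blast
        show "closed D" unfolding D_def using K(1)
          by (intro closed_Int closed_INT ballI convex_norm_le) (simp_all add: invariant_set_def)
        show "convex D" unfolding D_def using K(1)
          by (intro convex_Int convex_INT convex_norm_le) (simp_all add: invariant_set_def)
        show "bounded D" using K(1) by (auto simp: D_def invariant_set_def intro: bounded_subset)
        fix \<sigma> w assume \<sigma>: "\<sigma> \<in> F" and w: "w \<in> D"
        have "norm (\<sigma> w - p) \<le> norm (w - p)" if p: "p \<in> E K" for p
        proof -
          have "norm (\<sigma> w - \<sigma> p) \<le> norm (w - p)"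
            using ne \<sigma> w p K(2) unfolding nonexpansive_on_def D_def E_def by blast
          moreover have "\<sigma> p = p" using p \<sigma> unfolding E_def by blast
          ultimately show ?thesis by simp
        qed
        moreover have "\<sigma> w \<in> K" using K(1) \<sigma> w by (simp add: invariant_set_def D_def)
        ultimately show "\<sigma> w \<in> D" using w unfolding D_def by (auto intro: order_trans)
      qed
    qed
    then obtain w where "w \<in> D" "\<forall>\<sigma>\<in>F. \<sigma> w = w" by blast
    then show ?thesis by (intro bexI[of _ w]) (auto simp: D_def E_def)
  qed
  have RE: "R p \<in> E K" if K: "invariant_set (insert R F) K" "K \<subseteq> K0" and p: "p \<in> E K" for K p
  proof -
    have pK: "p \<in> K" "p \<in> K0" using p K(2) by (auto simp: E_def)
    have "\<sigma> (R p) = R p" if \<sigma>: "\<sigma> \<in> F" for \<sigma>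
    proof -
      have "\<sigma> (R p) = R (\<sigma> p)" using com \<sigma> pK(2) unfolding commute_on_def by blast
      moreover have "\<sigma> p = p" using p \<sigma> unfolding E_def by blast
      ultimately show ?thesis by simp
    qed
    moreover have "R p \<in> K" using K(1) pK(1) by (simp add: invariant_set_def)
    ultimately show ?thesis by (simp add: E_def)
  qed
  have bK0: "bounded K0" using inv by (simp add: invariant_set_def)
  obtain B where B: "\<And>x. x \<in> K0 \<Longrightarrow> norm x \<le> B" using bK0 by (auto simp: bounded_iff)
  have "0 \<le> B"
  proof -
    obtain x where "x \<in> K0" using inv by (auto simp: invariant_set_def)
    then show ?thesis using B[of x] norm_ge_zero[of x] by linarith
  qed
  \<comment> \<open>Besides being moved little by \<open>R\<close>, the new point must nearly keep
    the distance bounds of \<open>w0\<close>: each of the \<open>N\<close> steps raises the distance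
    to \<open>p\<close> by at most \<open>norm (R p - p)\<close>, which is tiny if \<open>p\<close>
    is itself an approximate fixed point.\<close>
  have approx: "\<exists>N::nat. \<forall>K. invariant_set (insert R F) K \<longrightarrow> K \<subseteq> K0 \<longrightarrow> (\<forall>w0\<in>E K. \<exists>w\<in>E K. norm (R w - w) \<le> \<epsilon> \<and>
      (\<forall>p\<in>E K. norm (w - p) \<le> norm (w0 - p) + real N * norm (R p - p)))" if \<epsilon>: "\<epsilon> > 0" for \<epsilon>
  proof -
    have "2 * B \<ge> 0" using \<open>0 \<le> B\<close> by simp
    then obtain N where N: "\<And>x y :: nat \<Rightarrow> 'z. (\<And>n. norm (y (Suc n) - y n) \<le> norm (x (Suc n) - x n)) \<Longrightarrow>
      (\<And>n. norm (x (Suc n) - x n) \<le> norm (y n - x n) / 2) \<Longrightarrow>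
      (\<And>n m. norm (x (Suc n) - y m) \<le> norm (x n - y m) / 2 + norm (y n - y m) / 2) \<Longrightarrow>
      (\<And>n m. norm (y n - x m) \<le> 2 * B) \<Longrightarrow> norm (y N - x N) \<le> \<epsilon>"
      using goebel_kirk_uniform[OF _ \<epsilon>, of "2 * B", where 'z = 'z] by metis
    show ?thesis
    proof (intro exI[of _ N] allI impI ballI)
      fix K w0 assume K: "invariant_set (insert R F) K" "K \<subseteq> K0" and w0: "w0 \<in> E K"
      have EK: "E K \<subseteq> K" "E K \<subseteq> K0" using K(2) by (auto simp: E_def)
      have "\<exists>x. x 0 = w0 \<and> (\<forall>n. x n \<in> E K \<and>
        (\<forall>p\<in>E K. norm (x (Suc n) - p) \<le> (1 - 1/2) * norm (x n - p) + 1/2 * norm (R (x n) - p)))"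
      proof -
        have "\<exists>x. \<forall>n. (x n \<in> E K \<and> (n = 0 \<longrightarrow> x n = w0)) \<and>
          (\<forall>p\<in>E K. norm (x (Suc n) - p) \<le> (1 - 1/2) * norm (x n - p) + 1/2 * norm (R (x n) - p))"
        proof (rule dependent_nat_choice)
          show "\<exists>x. x \<in> E K \<and> ((0::nat) = 0 \<longrightarrow> x = w0)" using w0 by blast
          fix x and n :: nat assume "x \<in> E K \<and> (n = 0 \<longrightarrow> x = w0)"
          then have x: "x \<in> E K" by simp
          show "\<exists>w. (w \<in> E K \<and> (Suc n = 0 \<longrightarrow> w = w0)) \<and>
            (\<forall>p\<in>E K. norm (w - p) \<le> (1 - 1/2) * norm (x - p) + 1/2 * norm (R x - p))"
            using takahashi[OF K, of x "R x" "1/2"] x RE[OF K x] EK(1) by auto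
        qed
        then show ?thesis by blast
      qed
      then obtain x where x0: "x 0 = w0" and xE: "\<And>n. x n \<in> E K" and
        xs: "\<And>n p. p \<in> E K \<Longrightarrow> norm (x (Suc n) - p) \<le> (1 - 1/2) * norm (x n - p) + 1/2 * norm (R (x n) - p)" by blast
      define y where "y n = R (x n)" for n
      have yE: "y n \<in> E K" for n unfolding y_def by (rule RE[OF K xE])
      have Rne: "norm (R a - R b) \<le> norm (a - b)" if "a \<in> E K" "b \<in> E K" for a b
        using ne that EK(2) unfolding nonexpansive_on_def by blast
      have fin: "norm (y N - x N) \<le> \<epsilon>"
      proof (rule N)
        show "norm (y (Suc n) - y n) \<le> norm (x (Suc n) - x n)" for n unfolding y_def by (rule Rne[OF xE xE])
        show "norm (x (Suc n) - x n) \<le> norm (y n - x n) / 2" for n using xs[OF xE[of n], of n] by (simp add: y_def)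
        show "norm (x (Suc n) - y m) \<le> norm (x n - y m) / 2 + norm (y n - y m) / 2" for n m
          using xs[OF yE[of m], of n] by (simp add: y_def)
        show "norm (y n - x m) \<le> 2 * B" for n m
        proof -
          have "y n \<in> K0" "x m \<in> K0" using yE xE EK(2) by blast+
          then show ?thesis using B[of "y n"] B[of "x m"] norm_triangle_ineq4[of "y n" "x m"] by linarith
        qed
      qed
      have "norm (x n - p) \<le> norm (w0 - p) + real n * norm (R p - p)" if p: "p \<in> E K" for n p
      proof (induction n)
        case 0 show ?case by (simp add: x0)
      next
        case (Suc n)
        have "norm (R (x n) - p) \<le> norm (x n - p) + norm (R p - p)"
          using norm_triangle_ineq[of "R (x n) - R p" "R p - p"] Rne[OF xE p, of n] by simp
        then have "norm (x (Suc n) - p) \<le> norm (x n - p) + norm (R p - p)"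
          using xs[OF p, of n] norm_ge_zero[of "R p - p"] by argo
        then show ?case using Suc by (simp add: algebra_simps)
      qed
      then show "\<exists>w\<in>E K. norm (R w - w) \<le> \<epsilon> \<and> (\<forall>p\<in>E K. norm (w - p) \<le> norm (w0 - p) + real N * norm (R p - p))"
        using fin xE[of N] by (intro bexI[of _ "x N"]) (auto simp: y_def)
    qed
  qed
  have Gdec: "G k \<subseteq> G n" if "n \<le> k" for n k
  proof -
    have "1 / real (Suc k) \<le> 1 / real (Suc n)" using that by (simp add: frac_le)
    then show ?thesis by (auto simp: G_def)
  qed
  show ?thesis
  proof (rule common_fixed_point_of_approximations[OF fr inv ne, of "range G"])
    show "range G \<noteq> {}" by simp
    show "\<exists>L\<in>range G. L \<subseteq> A \<inter> B" if AB: "A \<in> range G" "B \<in> range G" for A B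
    proof -
      obtain m n where "A = G m" "B = G n" using AB by blast
      then have "G (max m n) \<subseteq> A \<inter> B" using Gdec[of m "max m n"] Gdec[of n "max m n"] by simp
      then show ?thesis by blast
    qed
    show "\<exists>A\<in>range G. \<forall>x\<in>A \<inter> K0. norm (\<sigma> x - x) \<le> \<epsilon>" if \<sigma>: "\<sigma> \<in> insert R F" and \<epsilon>: "\<epsilon> > 0" for \<sigma> \<epsilon>
    proof -
      obtain n where "inverse (real (Suc n)) < \<epsilon>" using reals_Archimedean[OF \<epsilon>] by blast
      then have "\<forall>x\<in>G n \<inter> K0. norm (\<sigma> x - x) \<le> \<epsilon>" using \<sigma> \<epsilon> by (auto simp: G_def inverse_eq_divide)
      then show ?thesis by blast
    qed
  next
    fix A K assume A: "A \<in> range G" and K: "invariant_set (insert R F) K" "K \<subseteq> K0"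
    obtain n where n: "A = G n" using A by blast
    have "0 < 1 / real (Suc n)" by simp
    from approx[OF this] obtain N :: nat where N: "\<And>w0. w0 \<in> E K \<Longrightarrow> \<exists>w\<in>E K. norm (R w - w) \<le> 1 / real (Suc n) \<and>
      (\<forall>p\<in>E K. norm (w - p) \<le> norm (w0 - p) + real N * norm (R p - p))" using K by blast
    have "invariant_set F K" using K(1) by (simp add: invariant_set_def)
    then obtain w0 where "w0 \<in> K" "\<forall>\<sigma>\<in>F. \<sigma> w0 = w0" using fp[OF K(2)] by blast
    then have "w0 \<in> E K" by (simp add: E_def)
    from N[OF this] show "A \<inter> K \<noteq> {}" by (auto simp: n G_def E_def)
    fix \<epsilon> :: real assume \<epsilon>: "\<epsilon> > 0"
    \<comment> \<open>With \<open>k\<close> this large, \<open>N\<close> steps started at a dividing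
      point of \<open>x\<close> and \<open>y\<close> from \<open>G k\<close> spoil its distances to
      them by at most \<open>\<epsilon>\<close>.\<close>
    obtain k :: nat where "real N / \<epsilon> < real k" using reals_Archimedean2 by blast
    then have k: "real N * (1 / real (Suc k)) \<le> \<epsilon>" using \<epsilon> by (simp add: field_simps)
    have "\<exists>z\<in>A \<inter> K. norm (z - x) \<le> \<tau> * norm (x - y) + \<epsilon> \<and> norm (z - y) \<le> (1 - \<tau>) * norm (x - y) + \<epsilon>"
      if xy: "x \<in> G k \<inter> K" "y \<in> G k \<inter> K" and \<tau>: "0 \<le> \<tau>" "\<tau> \<le> 1" for x y \<tau>
    proof -
      have E: "x \<in> E K" "y \<in> E K" and R: "norm (R x - x) \<le> 1 / real (Suc k)" "norm (R y - y) \<le> 1 / real (Suc k)"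
        using xy by (auto simp: E_def G_def)
      obtain w0 where w0: "w0 \<in> E K" "\<forall>p\<in>E K. norm (w0 - p) \<le> (1 - \<tau>) * norm (x - p) + \<tau> * norm (y - p)"
        using takahashi[OF K _ _ \<tau>, of x y] xy by blast
      obtain z where z: "z \<in> E K" "norm (R z - z) \<le> 1 / real (Suc n)"
        "\<forall>p\<in>E K. norm (z - p) \<le> norm (w0 - p) + real N * norm (R p - p)" using N[OF w0(1)] by blast
      have small: "real N * norm (R p - p) \<le> \<epsilon>" if "norm (R p - p) \<le> 1 / real (Suc k)" for p
        using mult_left_mono[OF that, of "real N"] k by linarith
      have "norm (z - x) \<le> \<tau> * norm (x - y) + \<epsilon>"
        using z(3) w0(2) E(1) small[OF R(1)] by (force simp: norm_minus_commute)
      moreover have "norm (z - y) \<le> (1 - \<tau>) * norm (x - y) + \<epsilon>"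
        using z(3) w0(2) E(2) small[OF R(2)] by force
      moreover have "z \<in> A \<inter> K" using z(1,2) by (auto simp: n G_def E_def)
      ultimately show ?thesis by blast
    qed
    then show "\<exists>H\<in>range G. \<forall>x\<in>H \<inter> K. \<forall>y\<in>H \<inter> K. \<forall>\<tau>. 0 \<le> \<tau> \<longrightarrow> \<tau> \<le> 1 \<longrightarrow>
      (\<exists>z\<in>A \<inter> K. norm (z - x) \<le> \<tau> * norm (x - y) + \<epsilon> \<and> norm (z - y) \<le> (1 - \<tau>) * norm (x - y) + \<epsilon>)"
      by (intro bexI[of _ "G k"]) auto
  qed
qed

lemma commuting_finite:
  fixes K :: "'z::banach set"
  assumes fr: "fin_rep TYPE('z) (psi_sum S) (psi_norm \<psi>)" and F: "finite F"
    and "invariant_set F K" "nonexpansive_on K F" "commute_on K F"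
  shows "\<exists>x\<in>K. \<forall>\<sigma>\<in>F. \<sigma> x = x"
  using F assms(3-5)
proof (induction F arbitrary: K)
  case empty
  then show ?case by (auto simp: invariant_set_def)
next
  case (insert R F)
  show ?case
  proof (rule commuting_step[OF fr insert.prems])
    fix K' assume K': "K' \<subseteq> K" "invariant_set F K'"
    show "\<exists>x\<in>K'. \<forall>\<sigma>\<in>F. \<sigma> x = x"
      by (rule insert.IH[OF K'(2) nonexpansive_on_mono[OF insert.prems(2) K'(1)] commute_on_mono[OF insert.prems(3) K'(1)]]) auto
  qed
qed

text \<open>The directed family consists of the exact fixed point sets of finite subfamilies.
  Dividing points then come without iteration: the intersection of two balls about fixed points
  \<open>x\<close> and \<open>y\<close> is invariant under \<open>F\<close>, and the finite case
  applies inside it.\<close>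

theorem commuting_nonexpansive_common_fixed_point:
  fixes K0 :: "'z::banach set"
  assumes fr: "fin_rep TYPE('z) (psi_sum S) (psi_norm \<psi>)"
    and inv: "invariant_set \<Sigma> K0" and ne: "nonexpansive_on K0 \<Sigma>" and com: "commute_on K0 \<Sigma>"
  shows "\<exists>x\<in>K0. \<forall>\<sigma>\<in>\<Sigma>. \<sigma> x = x"
proof -
  define G where "G F = {x. \<forall>\<sigma>\<in>F. \<sigma> x = x}" for F :: "('z \<Rightarrow> 'z) set"
  define \<G> where "\<G> = G ` {F. finite F \<and> F \<subseteq> \<Sigma>}"
  have fp: "\<exists>x\<in>K. x \<in> G F" if "finite F" "F \<subseteq> \<Sigma>" "K \<subseteq> K0" "invariant_set F K" for F K
    using commuting_finite[OF fr that(1,4) nonexpansive_on_mono[OF ne that(3,2)] commute_on_mono[OF com that(3,2)]]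
    by (simp add: G_def)
  show ?thesis
  proof (rule common_fixed_point_of_approximations[OF fr inv ne, of \<G>])
    show "\<G> \<noteq> {}" by (auto simp: \<G>_def)
    show "\<exists>L\<in>\<G>. L \<subseteq> A \<inter> B" if AB: "A \<in> \<G>" "B \<in> \<G>" for A B
    proof -
      obtain F1 F2 where F: "finite F1" "F1 \<subseteq> \<Sigma>" "finite F2" "F2 \<subseteq> \<Sigma>" "A = G F1" "B = G F2"
        using AB by (auto simp: \<G>_def)
      then have "G (F1 \<union> F2) \<in> \<G>" "G (F1 \<union> F2) \<subseteq> A \<inter> B" by (auto simp: \<G>_def G_def)
      then show ?thesis by blast
    qed
    show "\<exists>A\<in>\<G>. \<forall>x\<in>A \<inter> K0. norm (\<sigma> x - x) \<le> \<epsilon>" if \<sigma>: "\<sigma> \<in> \<Sigma>" and \<epsilon>: "\<epsilon> > 0" for \<sigma> \<epsilon>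
    proof -
      have "G {\<sigma>} \<in> \<G>" using \<sigma> by (auto simp: \<G>_def)
      moreover have "\<forall>x\<in>G {\<sigma>} \<inter> K0. norm (\<sigma> x - x) \<le> \<epsilon>" using \<epsilon> by (simp add: G_def)
      ultimately show ?thesis by blast
    qed
  next
    fix A K assume A: "A \<in> \<G>" and K: "invariant_set \<Sigma> K" "K \<subseteq> K0"
    obtain F where F: "finite F" "F \<subseteq> \<Sigma>" "A = G F" using A by (auto simp: \<G>_def)
    have KF: "invariant_set F K" using K(1) F(2) by (auto simp: invariant_set_def)
    then show "A \<inter> K \<noteq> {}" using fp[OF F(1,2) K(2)] F(3) by blast
    fix \<epsilon> :: real assume \<epsilon>: "\<epsilon> > 0"
    have "\<exists>z\<in>A \<inter> K. norm (z - x) \<le> \<tau> * norm (x - y) + \<epsilon> \<and> norm (z - y) \<le> (1 - \<tau>) * norm (x - y) + \<epsilon>"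
      if xy: "x \<in> A \<inter> K" "y \<in> A \<inter> K" and \<tau>: "0 \<le> \<tau>" "\<tau> \<le> 1" for x y and \<tau> :: real
    proof -
      define D where "D = K \<inter> ({w. norm (w - x) \<le> \<tau> * norm (x - y)} \<inter> {w. norm (w - y) \<le> (1 - \<tau>) * norm (x - y)})"
      have "\<exists>z\<in>D. z \<in> G F"
      proof (rule fp[OF F(1,2)])
        show "D \<subseteq> K0" using K(2) by (auto simp: D_def)
        show "invariant_set F D"
          unfolding invariant_set_def
        proof (intro conjI ballI)
          have "x + \<tau> *\<^sub>R (y - x) - y = (1 - \<tau>) *\<^sub>R (x - y)" by (simp add: algebra_simps)
          then have "norm (x + \<tau> *\<^sub>R (y - x) - y) = (1 - \<tau>) * norm (x - y)" using \<tau> by simp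
          moreover have "norm (x + \<tau> *\<^sub>R (y - x) - x) = \<tau> * norm (x - y)" using \<tau> by (simp add: norm_minus_commute)
          moreover have "(1 - \<tau>) *\<^sub>R x + \<tau> *\<^sub>R y \<in> K"
            using K(1) xy \<tau> by (intro convexD) (auto simp: invariant_set_def)
          then have "x + \<tau> *\<^sub>R (y - x) \<in> K" by (simp add: algebra_simps)
          ultimately have "x + \<tau> *\<^sub>R (y - x) \<in> D" by (simp add: D_def)
          then show "D \<noteq> {}" by blast
          show "closed D" unfolding D_def using K(1) by (intro closed_Int convex_norm_le) (simp add: invariant_set_def)
          show "convex D" unfolding D_def using K(1) by (intro convex_Int convex_norm_le) (simp add: invariant_set_def)
          show "bounded D" using K(1) by (auto simp: D_def invariant_set_def intro: bounded_subset)
          fix \<sigma> w assume \<sigma>: "\<sigma> \<in> F" and w: "w \<in> D"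
          have "norm (\<sigma> w - p) \<le> norm (w - p)" if p: "p \<in> A \<inter> K" for p
          proof -
            have "norm (\<sigma> w - \<sigma> p) \<le> norm (w - p)"
              using ne \<sigma> F(2) w p K(2) unfolding nonexpansive_on_def D_def by blast
            moreover have "\<sigma> p = p" using p \<sigma> unfolding F(3) G_def by blast
            ultimately show ?thesis by simp
          qed
          from this[OF xy(1)] this[OF xy(2)] show "\<sigma> w \<in> D"
            using w KF \<sigma> by (auto simp: D_def invariant_set_def)
        qed
      qed
      then obtain z where "z \<in> D" "z \<in> G F" by blast
      then show ?thesis using \<epsilon> F(3) by (intro bexI[of _ z]) (auto simp: D_def)
    qed
    then show "\<exists>H\<in>\<G>. \<forall>x\<in>H \<inter> K. \<forall>y\<in>H \<inter> K. \<forall>\<tau>. 0 \<le> \<tau> \<longrightarrow> \<tau> \<le> 1 \<longrightarrow>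
      (\<exists>z\<in>A \<inter> K. norm (z - x) \<le> \<tau> * norm (x - y) + \<epsilon> \<and> norm (z - y) \<le> (1 - \<tau>) * norm (x - y) + \<epsilon>)"
      by (intro bexI[OF _ A]) auto
  qed
qed

end

section \<open>Asymptotically nonexpansive mappings in the intermediate sense\<close>

lemma asympt_nonexpD:
  assumes ani: "asympt_nonexp_intermediate C T" and \<epsilon>: "\<epsilon> > 0"
  shows "\<exists>N. \<forall>n\<ge>N. \<forall>x\<in>C. \<forall>y\<in>C. norm ((T ^^ n) x - (T ^^ n) y) \<le> norm (x - y) + \<epsilon>"
proof -
  let ?s = "\<lambda>n. SUP x\<in>C. SUP y\<in>C. ereal (dist ((T ^^ n) x) ((T ^^ n) y) - dist x y)"
  have "limsup ?s < ereal \<epsilon>"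
    using ani \<epsilon> unfolding asympt_nonexp_intermediate_def by (auto intro: le_less_trans)
  then have "eventually (\<lambda>n. ?s n < ereal \<epsilon>) sequentially" by (rule Limsup_lessD)
  then obtain N where N: "\<And>n. n \<ge> N \<Longrightarrow> ?s n < ereal \<epsilon>" by (auto simp: eventually_sequentially)
  have "norm ((T ^^ n) x - (T ^^ n) y) \<le> norm (x - y) + \<epsilon>" if n: "n \<ge> N" and xy: "x \<in> C" "y \<in> C" for n x y
  proof -
    have "ereal (dist ((T ^^ n) x) ((T ^^ n) y) - dist x y) \<le> (SUP y\<in>C. ereal (dist ((T ^^ n) x) ((T ^^ n) y) - dist x y))"
      by (rule SUP_upper[OF xy(2)])
    also have "\<dots> \<le> ?s n" by (rule SUP_upper[OF xy(1)])
    also have "\<dots> < ereal \<epsilon>" by (rule N[OF n])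
    finally show ?thesis by (simp add: dist_norm)
  qed
  then show ?thesis by blast
qed

lemma geometric_steps_convergent:
  fixes X :: "nat \<Rightarrow> 'z::banach"
  assumes "\<And>k. norm (X (Suc k) - X k) \<le> c * (1/2) ^ k"
  shows "convergent X"
proof -
  have "summable (\<lambda>k. X (Suc k) - X k)"
    by (rule summable_comparison_test[where g = "\<lambda>k. c * (1/2) ^ k"])
       (use assms in \<open>auto intro!: summable_mult summable_geometric\<close>)
  then obtain s where "(\<lambda>k. X (Suc k) - X k) sums s" by (auto simp: summable_def)
  then have "(\<lambda>n. \<Sum>k<n. X (Suc k) - X k) \<longlonglongrightarrow> s" by (simp add: sums_def)
  then have "(\<lambda>n. X n - X 0) \<longlonglongrightarrow> s" by (simp add: sum_lessThan_telescope)
  from tendsto_add[OF this tendsto_const[of "X 0"]] show ?thesis by (auto simp: convergent_def)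
qed

text \<open>A limsup bound \<open>r\<close> is expressed by requiring this for
  \<open>r + \<epsilon>\<close> with every \<open>\<epsilon> > 0\<close>, which leaves plain norm
  estimates along the orbit.\<close>

definition orbit_dist_le :: "('z::real_normed_vector \<Rightarrow> 'z) \<Rightarrow> 'z \<Rightarrow> 'z \<Rightarrow> real \<Rightarrow> bool" where
  "orbit_dist_le T x z r \<longleftrightarrow> (\<exists>N. \<forall>n\<ge>N. norm (z - (T ^^ n) x) \<le> r)"

lemma orbit_dist_le_mono: "orbit_dist_le T x z r \<Longrightarrow> norm (w - z) + r \<le> s \<Longrightarrow> orbit_dist_le T x w s"
  unfolding orbit_dist_le_def
proof (elim exE)
  fix N assume N: "\<forall>n\<ge>N. norm (z - (T ^^ n) x) \<le> r" and s: "norm (w - z) + r \<le> s"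
  have "norm (w - (T ^^ n) x) \<le> s" if "n \<ge> N" for n
    using norm_triangle_ineq[of "w - z" "z - (T ^^ n) x"] N that s by fastforce
  then show "\<exists>N. \<forall>n\<ge>N. norm (w - (T ^^ n) x) \<le> s" by blast
qed

lemma ucls_eq_scaled:
  fixes u w :: "nat \<Rightarrow> 'z::real_normed_vector"
  assumes "bounded (range u)" "bounded (range w)" "\<And>k. eventually (\<lambda>n. norm (u n - w n) \<le> 1 / real (Suc k)) \<U>"
  shows "ucls u = ucls w"
proof -
  have "norm (ucls u - ucls w) \<le> 1 / real (Suc k)" for k
    by (rule tendsto_upperbound[OF ucls_dist[OF assms(1,2)] assms(3) freeuf_bot])
  then have "norm (ucls u - ucls w) \<le> 0"
    by (intro LIMSEQ_le_const[OF LIMSEQ_inverse_real_of_nat]) (auto simp: inverse_eq_divide)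
  then show ?thesis by simp
qed

section \<open>Powers of the map on the ultrapower, and the iteration towards a fixed point\<close>

locale ani_map =
  fixes C :: "'y::banach set" and T :: "'y \<Rightarrow> 'y"
  assumes C: "bounded C" "closed C" "convex C" and TC: "T ` C \<subseteq> C"
    and T: "asympt_nonexp_intermediate C T"
begin

lemma Tn: "x \<in> C \<Longrightarrow> (T ^^ n) x \<in> C"
  using TC by (induction n) auto

lemma seqC: "(\<And>n. u n \<in> C) \<Longrightarrow> bounded (range u)"
  using C(1) by (rule bounded_subset) auto

lemma ev_nonexp:
  assumes M: "filterlim M at_top \<U>" and u: "\<And>n. u n \<in> C" "\<And>n. v n \<in> C" and \<epsilon>: "\<epsilon> > 0"
  shows "eventually (\<lambda>j. norm ((T ^^ M j) (u j) - (T ^^ M j) (v j)) \<le> norm (u j - v j) + \<epsilon>) \<U>"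
proof -
  obtain N where N: "\<forall>n\<ge>N. \<forall>x\<in>C. \<forall>y\<in>C. norm ((T ^^ n) x - (T ^^ n) y) \<le> norm (x - y) + \<epsilon>"
    using asympt_nonexpD[OF T \<epsilon>] ..
  have "eventually (\<lambda>j. N \<le> M j) \<U>" using M by (simp add: filterlim_at_top)
  then show ?thesis by (rule eventually_mono) (use N u in blast)
qed

text \<open>Independent of the chosen representative as soon as \<open>M\<close> tends to infinity along \<open>\<U>\<close>;
  for other \<open>M\<close>, and outside the ultrapower of \<open>C\<close>, the value is junk.\<close>

definition upow :: "(nat \<Rightarrow> nat) \<Rightarrow> 'y ultra \<Rightarrow> 'y ultra" where
  "upow M x = (let u = (SOME u. (\<forall>n. u n \<in> C) \<and> x = ucls u) in ucls (\<lambda>j. (T ^^ M j) (u j)))"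

lemma upow_nonexp0:
  assumes M: "filterlim M at_top \<U>" and u: "\<And>n. u n \<in> C" "\<And>n. v n \<in> C"
  shows "norm (ucls (\<lambda>j. (T ^^ M j) (u j)) - ucls (\<lambda>j. (T ^^ M j) (v j))) \<le> norm (ucls u - ucls v)"
proof (rule field_le_epsilon)
  fix \<epsilon> :: real assume \<epsilon>: "\<epsilon> > 0"
  have 1: "((\<lambda>j. norm ((T ^^ M j) (u j) - (T ^^ M j) (v j))) \<longlongrightarrow>
      norm (ucls (\<lambda>j. (T ^^ M j) (u j)) - ucls (\<lambda>j. (T ^^ M j) (v j)))) \<U>"
    by (intro ucls_dist seqC Tn u)
  have 2: "((\<lambda>j. norm (u j - v j) + \<epsilon>) \<longlongrightarrow> norm (ucls u - ucls v) + \<epsilon>) \<U>"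
    by (intro tendsto_add ucls_dist seqC u tendsto_const)
  show "norm (ucls (\<lambda>j. (T ^^ M j) (u j)) - ucls (\<lambda>j. (T ^^ M j) (v j))) \<le> norm (ucls u - ucls v) + \<epsilon>"
    by (rule tendsto_le[OF freeuf_bot 2 1 ev_nonexp[OF M u \<epsilon>]])
qed

lemma upow_eq:
  assumes M: "filterlim M at_top \<U>" and u: "\<And>n. u n \<in> C"
  shows "upow M (ucls u) = ucls (\<lambda>j. (T ^^ M j) (u j))"
proof -
  define v where "v = (SOME v. (\<forall>n. v n \<in> C) \<and> ucls u = ucls v)"
  have "\<exists>v. (\<forall>n. v n \<in> C) \<and> ucls u = ucls v" using u by blast
  from someI_ex[OF this] have v: "\<And>n. v n \<in> C" "ucls u = ucls v" by (auto simp: v_def)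
  have "upow M (ucls u) = ucls (\<lambda>j. (T ^^ M j) (v j))" by (simp add: upow_def v_def Let_def)
  moreover have "norm (ucls (\<lambda>j. (T ^^ M j) (v j)) - ucls (\<lambda>j. (T ^^ M j) (u j))) \<le> norm (ucls v - ucls u)"
    by (rule upow_nonexp0[OF M v(1) u])
  ultimately show ?thesis using v(2) by simp
qed

definition orbit_ball :: "'y \<Rightarrow> real \<Rightarrow> 'y ultra set" where
  "orbit_ball x r = {ucls u | u. (\<forall>n. u n \<in> C) \<and> (\<forall>\<epsilon>>0. eventually (\<lambda>j. orbit_dist_le T x (u j) (r + \<epsilon>)) \<U>)}"

lemma orbit_ballE:
  assumes "v \<in> orbit_ball x r"
  obtains u where "\<And>n. u n \<in> C" "\<And>\<epsilon>. \<epsilon> > 0 \<Longrightarrow> eventually (\<lambda>j. orbit_dist_le T x (u j) (r + \<epsilon>)) \<U>" "v = ucls u"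
  using assms unfolding orbit_ball_def by auto

lemma orbit_ballI:
  assumes "\<And>n. u n \<in> C" "\<And>\<epsilon>. \<epsilon> > 0 \<Longrightarrow> eventually (\<lambda>j. orbit_dist_le T x (u j) (r + \<epsilon>)) \<U>"
  shows "ucls u \<in> orbit_ball x r"
  using assms unfolding orbit_ball_def by blast

text \<open>All exponent sequences at once: in \<open>improve\<close> the offending exponents are
  chosen after the fixed point, and only a point fixed by every such map excludes them.\<close>

definition pows :: "('y ultra \<Rightarrow> 'y ultra) set" where
  "pows = {upow M | M. filterlim M at_top \<U>}"

text \<open>Membership asks for one representative that is good for all errors. Saturation supplies
  it, near \<open>w\<close> and within the orbit bounds at the same time.\<close>

lemma orbit_ball_closed:
  assumes x: "x \<in> C" shows "closed (orbit_ball x r)"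
  unfolding closed_sequential_limits
proof (intro allI impI)
  fix V v assume "(\<forall>k. V k \<in> orbit_ball x r) \<and> V \<longlonglongrightarrow> v"
  then have V: "\<And>k. V k \<in> orbit_ball x r" and lim: "V \<longlonglongrightarrow> v" by auto
  obtain w where w: "bounded (range w)" "v = ucls w" by (rule ucls_cases)
  define P where "P k n z \<longleftrightarrow> z \<in> C \<and> norm (z - w n) \<le> 1 / real (Suc k) \<and> orbit_dist_le T x z (r + 1 / real (Suc k))"
    for k n z
  have "\<exists>z. \<forall>k. eventually (\<lambda>n. P k n (z n)) \<U>"
  proof (rule freeuf_saturation)
    fix k
    have pos: "1 / real (Suc k) > 0" by simp
    obtain m where m: "norm (V m - v) < 1 / real (Suc k)" using LIMSEQ_D[OF lim pos] by blast
    obtain u where u: "\<And>n. u n \<in> C" "\<And>\<epsilon>. \<epsilon> > 0 \<Longrightarrow> eventually (\<lambda>j. orbit_dist_le T x (u j) (r + \<epsilon>)) \<U>" "V m = ucls u"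
      using orbit_ballE[OF V] by metis
    have "eventually (\<lambda>n. norm (u n - w n) < 1 / real (Suc k)) \<U>"
      by (rule order_tendstoD(2)[OF ucls_dist[OF seqC[OF u(1)] w(1)]]) (use m u(3) w(2) in simp)
    with u(2)[OF pos] show "eventually (\<lambda>n. \<exists>z. \<forall>j\<le>k. P j n z) \<U>"
    proof eventually_elim
      case (elim n)
      have "P j n (u n)" if "j \<le> k" for j
      proof -
        have le: "1 / real (Suc k) \<le> 1 / real (Suc j)" using that by (simp add: frac_le)
        then have "orbit_dist_le T x (u n) (r + 1 / real (Suc j))"
          by (intro orbit_dist_le_mono[OF elim(1)]) simp
        then show ?thesis using elim(2) le u(1) by (simp add: P_def)
      qed
      then show ?case by blast
    qed
  qed
  then obtain z where z: "\<And>k. eventually (\<lambda>n. P k n (z n)) \<U>" by blast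
  \<comment> \<open>Where the conditions fail \<open>z n\<close> is arbitrary; \<open>x\<close> is
    put there to stay in \<open>C\<close> at every index.\<close>
  define z' where "z' n = (if z n \<in> C then z n else x)" for n
  have z'C: "z' n \<in> C" for n using x by (simp add: z'_def)
  have z': "eventually (\<lambda>n. P k n (z' n)) \<U>" for k
    using z[of k] by (rule eventually_mono) (simp add: P_def z'_def)
  have "ucls z' = v" unfolding w(2)
  proof (rule ucls_eq_scaled[OF seqC[OF z'C] w(1)])
    show "eventually (\<lambda>n. norm (z' n - w n) \<le> 1 / real (Suc k)) \<U>" for k
      using z'[of k] by (rule eventually_mono) (simp add: P_def)
  qed
  moreover have "ucls z' \<in> orbit_ball x r"
  proof (rule orbit_ballI[OF z'C])
    fix \<epsilon> :: real assume "\<epsilon> > 0"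
    then obtain k where k: "inverse (real (Suc k)) < \<epsilon>" using reals_Archimedean by blast
    show "eventually (\<lambda>j. orbit_dist_le T x (z' j) (r + \<epsilon>)) \<U>"
      using z'[of k]
    proof (rule eventually_mono)
      fix n assume "P k n (z' n)"
      then have "orbit_dist_le T x (z' n) (r + 1 / real (Suc k))" by (simp add: P_def)
      then show "orbit_dist_le T x (z' n) (r + \<epsilon>)"
        by (rule orbit_dist_le_mono) (use k in \<open>simp add: inverse_eq_divide\<close>)
    qed
  qed
  ultimately show "v \<in> orbit_ball x r" by simp
qed

lemma orbit_ball_convex: "convex (orbit_ball x r)"
  unfolding convex_def
proof (intro ballI allI impI)
  fix v v' and s t :: real assume v: "v \<in> orbit_ball x r" "v' \<in> orbit_ball x r" and st: "0 \<le> s" "0 \<le> t" "s + t = 1"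
  obtain u where u: "\<And>n. u n \<in> C" "\<And>\<epsilon>. \<epsilon> > 0 \<Longrightarrow> eventually (\<lambda>j. orbit_dist_le T x (u j) (r + \<epsilon>)) \<U>" "v = ucls u"
    using orbit_ballE[OF v(1)] by metis
  obtain u' where u': "\<And>n. u' n \<in> C" "\<And>\<epsilon>. \<epsilon> > 0 \<Longrightarrow> eventually (\<lambda>j. orbit_dist_le T x (u' j) (r + \<epsilon>)) \<U>" "v' = ucls u'"
    using orbit_ballE[OF v(2)] by metis
  have eq: "s *\<^sub>R v + t *\<^sub>R v' = ucls (\<lambda>n. s *\<^sub>R u n + t *\<^sub>R u' n)"
    unfolding u(3) u'(3)
    by (simp add: ucls_plus[OF bounded_range_scaleR[OF seqC[OF u(1)]] bounded_range_scaleR[OF seqC[OF u'(1)]]]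
        ucls_scaleR[OF seqC[OF u(1)]] ucls_scaleR[OF seqC[OF u'(1)]])
  show "s *\<^sub>R v + t *\<^sub>R v' \<in> orbit_ball x r"
    unfolding eq
  proof (rule orbit_ballI)
    show "s *\<^sub>R u n + t *\<^sub>R u' n \<in> C" for n by (rule convexD[OF C(3) u(1) u'(1) st])
    fix \<epsilon> :: real assume \<epsilon>: "\<epsilon> > 0"
    show "eventually (\<lambda>j. orbit_dist_le T x (s *\<^sub>R u j + t *\<^sub>R u' j) (r + \<epsilon>)) \<U>"
      using u(2)[OF \<epsilon>] u'(2)[OF \<epsilon>]
    proof eventually_elim
      case (elim j)
      then obtain N N' where N: "\<forall>n\<ge>N. norm (u j - (T ^^ n) x) \<le> r + \<epsilon>" "\<forall>n\<ge>N'. norm (u' j - (T ^^ n) x) \<le> r + \<epsilon>"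
        unfolding orbit_dist_le_def by blast
      have "norm (s *\<^sub>R u j + t *\<^sub>R u' j - (T ^^ n) x) \<le> r + \<epsilon>" if n: "n \<ge> max N N'" for n
      proof -
        have "u j \<in> {w. norm (w - (T ^^ n) x) \<le> r + \<epsilon>}" "u' j \<in> {w. norm (w - (T ^^ n) x) \<le> r + \<epsilon>}" using N n by auto
        from convexD[OF convex_norm_le(1) this st] show ?thesis by simp
      qed
      then show ?case unfolding orbit_dist_le_def by blast
    qed
  qed
qed

lemma orbit_ball_invariant:
  assumes x: "x \<in> C" and r: "\<And>\<epsilon>. \<epsilon> > 0 \<Longrightarrow> orbit_dist_le T x x (r + \<epsilon>)"
  shows "invariant_set pows (orbit_ball x r)"
  unfolding invariant_set_def
proof (intro conjI ballI)
  have "ucls (\<lambda>_. x) \<in> orbit_ball x r" by (rule orbit_ballI) (use x r in auto)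
  then show "orbit_ball x r \<noteq> {}" by blast
  show "closed (orbit_ball x r)" by (rule orbit_ball_closed[OF x])
  show "convex (orbit_ball x r)" by (rule orbit_ball_convex)
  show "bounded (orbit_ball x r)"
  proof -
    obtain B where B: "\<And>y. y \<in> C \<Longrightarrow> norm y \<le> B" using C(1) by (auto simp: bounded_iff)
    have "norm v \<le> B" if v: "v \<in> orbit_ball x r" for v
    proof -
      obtain u where u: "\<And>n. u n \<in> C" "v = ucls u" using orbit_ballE[OF v] by metis
      show ?thesis unfolding u(2)
        by (rule tendsto_upperbound[OF ucls_norm[OF seqC[OF u(1)]] _ freeuf_bot]) (use B u(1) in auto)
    qed
    then show ?thesis by (auto simp: bounded_iff)
  qed
  fix \<sigma> v assume "\<sigma> \<in> pows" and v: "v \<in> orbit_ball x r"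
  then obtain M where M: "filterlim M at_top \<U>" "\<sigma> = upow M" by (auto simp: pows_def)
  obtain u where u: "\<And>n. u n \<in> C" "\<And>\<epsilon>. \<epsilon> > 0 \<Longrightarrow> eventually (\<lambda>j. orbit_dist_le T x (u j) (r + \<epsilon>)) \<U>" "v = ucls u"
    using orbit_ballE[OF v] by metis
  show "\<sigma> v \<in> orbit_ball x r"
    unfolding M(2) u(3) upow_eq[OF M(1) u(1)]
  proof (rule orbit_ballI)
    show "(T ^^ M n) (u n) \<in> C" for n by (rule Tn[OF u(1)])
    fix \<epsilon> :: real assume "\<epsilon> > 0"
    then have e2: "\<epsilon> / 2 > 0" by simp
    obtain N0 where N0: "\<forall>n\<ge>N0. \<forall>x\<in>C. \<forall>y\<in>C. norm ((T ^^ n) x - (T ^^ n) y) \<le> norm (x - y) + \<epsilon> / 2"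
      using asympt_nonexpD[OF T e2] ..
    have "eventually (\<lambda>j. N0 \<le> M j) \<U>" using M(1) by (simp add: filterlim_at_top)
    with u(2)[OF e2] show "eventually (\<lambda>j. orbit_dist_le T x ((T ^^ M j) (u j)) (r + \<epsilon>)) \<U>"
    proof eventually_elim
      case (elim j)
      then obtain N where N: "\<forall>n\<ge>N. norm (u j - (T ^^ n) x) \<le> r + \<epsilon> / 2" unfolding orbit_dist_le_def by blast
      have "norm ((T ^^ M j) (u j) - (T ^^ n) x) \<le> r + \<epsilon>" if n: "n \<ge> N + M j" for n
      proof -
        \<comment> \<open>\<open>(T ^^ n) x\<close> is the power \<open>M j\<close> applied to an
          orbit point that is still late, so the near-nonexpansiveness of that power transports the
          orbit bound from \<open>u j\<close>.\<close>
        have "n = M j + (n - M j)" using n by simp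
        then have "(T ^^ n) x = (T ^^ M j) ((T ^^ (n - M j)) x)" by (metis comp_apply funpow_add)
        moreover have "norm ((T ^^ M j) (u j) - (T ^^ M j) ((T ^^ (n - M j)) x)) \<le> norm (u j - (T ^^ (n - M j)) x) + \<epsilon> / 2"
          using N0 elim(2) u(1) Tn[OF x] by blast
        moreover have "norm (u j - (T ^^ (n - M j)) x) \<le> r + \<epsilon> / 2" using N n by simp
        ultimately show ?thesis by simp
      qed
      then show ?case unfolding orbit_dist_le_def by blast
    qed
  qed
qed

lemma pows_nonexpansive: "nonexpansive_on (orbit_ball x r) pows"
  unfolding nonexpansive_on_def
proof (intro ballI)
  fix \<sigma> v v' assume "\<sigma> \<in> pows" and v: "v \<in> orbit_ball x r" "v' \<in> orbit_ball x r"
  then obtain M where M: "filterlim M at_top \<U>" "\<sigma> = upow M" by (auto simp: pows_def)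
  obtain u where u: "\<And>n. u n \<in> C" "v = ucls u" using orbit_ballE[OF v(1)] by metis
  obtain u' where u': "\<And>n. u' n \<in> C" "v' = ucls u'" using orbit_ballE[OF v(2)] by metis
  show "norm (\<sigma> v - \<sigma> v') \<le> norm (v - v')"
    unfolding M(2) u(2) u'(2) upow_eq[OF M(1) u(1)] upow_eq[OF M(1) u'(1)] by (rule upow_nonexp0[OF M(1) u(1) u'(1)])
qed

lemma pows_commute: "commute_on (orbit_ball x r) pows"
  unfolding commute_on_def
proof (intro ballI)
  fix \<sigma> \<tau> v assume "\<sigma> \<in> pows" "\<tau> \<in> pows" and v: "v \<in> orbit_ball x r"
  then obtain M M' where M: "filterlim M at_top \<U>" "\<sigma> = upow M" "filterlim M' at_top \<U>" "\<tau> = upow M'"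
    by (auto simp: pows_def)
  obtain u where u: "\<And>n. u n \<in> C" "v = ucls u" using orbit_ballE[OF v] by metis
  have "(T ^^ M j) ((T ^^ M' j) (u j)) = (T ^^ M' j) ((T ^^ M j) (u j))" for j
    by (metis add.commute comp_apply funpow_add)
  then show "\<sigma> (\<tau> v) = \<tau> (\<sigma> v)"
    unfolding M(2,4) u(2) upow_eq[OF M(1) u(1)] upow_eq[OF M(3) u(1)]
    by (simp add: upow_eq[OF M(1) Tn[OF u(1)]] upow_eq[OF M(3) Tn[OF u(1)]])
qed

text \<open>If along \<U> the orbits of the \<open>u j\<close> were farther than
  \<open>\<delta>\<close> from \<open>u j\<close> at arbitrarily late times, such times
  \<open>M j \<ge> j\<close> would define a map in \<open>pows\<close> that moves \<open>v\<close>.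
  So \<open>\<delta>\<close> can be prescribed independently of \<open>r\<close>, which only limits
  the distance of the new point from \<open>x\<close>.\<close>

lemma improve:
  assumes x: "x \<in> C" and r: "r > 0" "\<And>\<epsilon>. \<epsilon> > 0 \<Longrightarrow> orbit_dist_le T x x (r + \<epsilon>)"
    and fp: "\<exists>v\<in>orbit_ball x r. \<forall>\<sigma>\<in>pows. \<sigma> v = v" and \<delta>: "\<delta> > 0"
  shows "\<exists>y\<in>C. norm (y - x) \<le> 3 * r \<and> orbit_dist_le T y y \<delta>"
proof -
  obtain v where v: "v \<in> orbit_ball x r" "\<forall>\<sigma>\<in>pows. \<sigma> v = v" using fp by blast
  obtain u where u: "\<And>n. u n \<in> C" "\<And>\<epsilon>. \<epsilon> > 0 \<Longrightarrow> eventually (\<lambda>j. orbit_dist_le T x (u j) (r + \<epsilon>)) \<U>" "v = ucls u"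
    using orbit_ballE[OF v(1)] by metis
  have ev: "eventually (\<lambda>j. orbit_dist_le T (u j) (u j) \<delta>) \<U>"
  proof (rule ccontr)
    assume "\<not> ?thesis"
    then have bad: "eventually (\<lambda>j. \<not> orbit_dist_le T (u j) (u j) \<delta>) \<U>" by (simp add: not_eventually_freeuf)
    have "\<forall>j. \<exists>n. j \<le> n \<and> (\<not> orbit_dist_le T (u j) (u j) \<delta> \<longrightarrow> norm (u j - (T ^^ n) (u j)) > \<delta>)"
      unfolding orbit_dist_le_def by (meson not_le order_refl)
    then obtain M where M: "\<And>j. j \<le> M j" "\<And>j. \<not> orbit_dist_le T (u j) (u j) \<delta> \<Longrightarrow> norm (u j - (T ^^ M j) (u j)) > \<delta>"
      by metis
    have fM: "filterlim M at_top \<U>"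
      by (rule filterlim_mono[OF filterlim_at_top_mono[OF filterlim_ident] order_refl freeuf_le]) (use M(1) in auto)
    then have "upow M \<in> pows" by (auto simp: pows_def)
    then have "upow M v = v" using v(2) by blast
    then have "ucls u = ucls (\<lambda>j. (T ^^ M j) (u j))" unfolding u(3) upow_eq[OF fM u(1)] by simp
    moreover have bM: "bounded (range (\<lambda>j. (T ^^ M j) (u j)))" by (intro seqC Tn u(1))
    ultimately have "((\<lambda>j. norm (u j - (T ^^ M j) (u j))) \<longlongrightarrow> 0) \<U>"
      using ucls_eq_iff[of u, OF seqC[OF u(1)] bM] by blast
    from order_tendstoD(2)[OF this \<delta>] bad have "eventually (\<lambda>j. False) \<U>"
      by eventually_elim (use M(2) in force)
    then show False by simp
  qed
  \<comment> \<open>Both \<open>u j\<close> and \<open>x\<close> are within \<open>r + r / 2\<close>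
    of a late point of the orbit of \<open>x\<close>; this gives the constant 3.\<close>
  have "r / 2 > 0" using r(1) by simp
  from eventually_happens'[OF freeuf_bot eventually_conj[OF ev u(2)[OF this]]]
  obtain j where j: "orbit_dist_le T (u j) (u j) \<delta>" "orbit_dist_le T x (u j) (r + r / 2)" by blast
  obtain N N' where N: "\<forall>n\<ge>N. norm (u j - (T ^^ n) x) \<le> r + r / 2" "\<forall>n\<ge>N'. norm (x - (T ^^ n) x) \<le> r + r / 2"
    using j(2) r(2)[OF \<open>r / 2 > 0\<close>] unfolding orbit_dist_le_def by blast
  have "norm (u j - x) \<le> norm (u j - (T ^^ (N + N')) x) + norm (x - (T ^^ (N + N')) x)"
    using norm_triangle_ineq4[of "u j - (T ^^ (N + N')) x" "x - (T ^^ (N + N')) x"] by simp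
  moreover have "norm (u j - (T ^^ (N + N')) x) \<le> r + r / 2" "norm (x - (T ^^ (N + N')) x) \<le> r + r / 2"
    using N by simp_all
  ultimately have "norm (u j - x) \<le> 3 * r" by argo
  then show ?thesis using u(1) j(1) by blast
qed

lemma fixed_point_from_ultrapower:
  assumes ne: "C \<noteq> {}"
    and fp: "\<And>x r. x \<in> C \<Longrightarrow> (\<And>\<epsilon>. \<epsilon> > 0 \<Longrightarrow> orbit_dist_le T x x (r + \<epsilon>)) \<Longrightarrow> \<exists>v\<in>orbit_ball x r. \<forall>\<sigma>\<in>pows. \<sigma> v = v"
  shows "\<exists>x\<in>C. T x = x"
proof -
  obtain B where B: "\<And>y. y \<in> C \<Longrightarrow> norm y \<le> B" using C(1) by (auto simp: bounded_iff)
  obtain x0 where x0: "x0 \<in> C" using ne by blast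
  \<comment> \<open>Points of \<open>C\<close> are at most \<open>2 * \<bar>B\<bar>\<close> apart,
    so this radius is valid at the starting point; the added 1 makes it positive.\<close>
  define R where "R = 2 * \<bar>B\<bar> + 1"
  have R: "R > 0" by (simp add: R_def)
  define r where "r k = R * (1/2) ^ k" for k :: nat
  have r: "r k > 0" for k using R by (simp add: r_def)
  have "\<exists>X. \<forall>k. (X k \<in> C \<and> orbit_dist_le T (X k) (X k) (r k)) \<and> norm (X (Suc k) - X k) \<le> 3 * r k"
  proof (rule dependent_nat_choice)
    have "norm (x0 - (T ^^ n) x0) \<le> r 0" for n
      using norm_triangle_ineq4[of x0 "(T ^^ n) x0"] B[OF x0] B[OF Tn[OF x0, of n]] by (simp add: r_def R_def)
    then show "\<exists>x. x \<in> C \<and> orbit_dist_le T x x (r 0)" using x0 unfolding orbit_dist_le_def by blast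
    fix x k assume x: "x \<in> C \<and> orbit_dist_le T x x (r k)"
    then have le: "orbit_dist_le T x x (r k + \<epsilon>)" if "\<epsilon> > 0" for \<epsilon>
      using orbit_dist_le_mono[of T x x "r k" x "r k + \<epsilon>"] that by simp
    have "x \<in> C" using x by simp
    from improve[OF this r le fp[OF this le] r[of "Suc k"]]
    show "\<exists>y. (y \<in> C \<and> orbit_dist_le T y y (r (Suc k))) \<and> norm (y - x) \<le> 3 * r k" by blast
  qed
  then obtain X where X: "\<And>k. X k \<in> C" "\<And>k. orbit_dist_le T (X k) (X k) (r k)" "\<And>k. norm (X (Suc k) - X k) \<le> 3 * r k"
    by blast
  have "convergent X"
    by (rule geometric_steps_convergent[where c = "3 * R"]) (use X(3) in \<open>simp add: r_def mult.assoc\<close>)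
  then obtain c where lim: "X \<longlonglongrightarrow> c" by (auto simp: convergent_def)
  have cC: "c \<in> C" using closed_sequentially[OF C(2) _ lim] X(1) by blast
  have r_lim: "r \<longlonglongrightarrow> 0" unfolding r_def using tendsto_mult[OF tendsto_const[of R] LIMSEQ_power_zero[of "1/2 :: real"]] by simp
  \<comment> \<open>As only high powers are controlled, \<open>T c\<close> is not compared with
    \<open>c\<close> directly: the orbit of \<open>c\<close> is shown to converge to
    \<open>c\<close>, and continuity of \<open>T\<close> then gives \<open>T c = c\<close>.\<close>
  have orb: "(\<lambda>n. (T ^^ n) c) \<longlonglongrightarrow> c"
  proof (rule LIMSEQ_I)
    fix \<epsilon> :: real assume "\<epsilon> > 0"
    then have e: "\<epsilon> / 5 > 0" by simp
    have "eventually (\<lambda>k. norm (X k - c) < \<epsilon> / 5 \<and> r k < \<epsilon> / 5) sequentially"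
      using tendstoD[OF lim e] order_tendstoD(2)[OF r_lim e] by eventually_elim (simp add: dist_norm)
    then obtain k where k: "norm (X k - c) < \<epsilon> / 5" "r k < \<epsilon> / 5" using eventually_happens'[OF sequentially_bot] by blast
    obtain N where N: "\<forall>n\<ge>N. norm (X k - (T ^^ n) (X k)) \<le> r k" using X(2)[of k] unfolding orbit_dist_le_def ..
    obtain N' where N': "\<forall>n\<ge>N'. \<forall>x\<in>C. \<forall>y\<in>C. norm ((T ^^ n) x - (T ^^ n) y) \<le> norm (x - y) + \<epsilon> / 5"
      using asympt_nonexpD[OF T e] ..
    have "norm ((T ^^ n) c - c) < \<epsilon>" if n: "n \<ge> max N N'" for n
    proof -
      have 1: "norm ((T ^^ n) (X k) - (T ^^ n) c) \<le> norm (X k - c) + \<epsilon> / 5" using N' n X(1) cC by simp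
      have 2: "norm (X k - (T ^^ n) (X k)) \<le> r k" using N n by simp
      have "(T ^^ n) c - c = ((X k - c) - (X k - (T ^^ n) (X k))) - ((T ^^ n) (X k) - (T ^^ n) c)" by simp
      then have "norm ((T ^^ n) c - c) \<le> (norm (X k - c) + norm (X k - (T ^^ n) (X k))) + norm ((T ^^ n) (X k) - (T ^^ n) c)"
        using order_trans[OF norm_triangle_ineq4 add_right_mono[OF norm_triangle_ineq4]] by metis
      then show ?thesis using 1 2 k e by argo
    qed
    then show "\<exists>N. \<forall>n\<ge>N. norm ((T ^^ n) c - c) < \<epsilon>" by blast
  qed
  have "continuous_on C T" using T by (simp add: asympt_nonexp_intermediate_def)
  then have "(\<lambda>n. T ((T ^^ n) c)) \<longlonglongrightarrow> T c"
    by (rule continuous_on_tendsto_compose[OF _ orb cC]) (simp add: Tn cC)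
  moreover have "(\<lambda>n. T ((T ^^ n) c)) \<longlonglongrightarrow> c" using LIMSEQ_Suc[OF orb] by simp
  ultimately have "T c = c" by (rule LIMSEQ_unique)
  then show ?thesis using cC by blast
qed

end

theorem theorem3p9:
  fixes S :: "'r::finite \<Rightarrow> 'a::banach set"
    and \<psi> :: "real^'r \<Rightarrow> real"
  assumes "\<And>i. subspace (S i)" and "\<And>i. closed (S i)"
    and "\<And>i. unif_noncreasy (S i)"
    and "is_norm_fn \<psi>" and "absolute_norm \<psi>" and "normalized_norm \<psi>"
    and "strictly_monotone_norm \<psi>"
  shows "fin_rep TYPE('y::banach) (psi_sum S) (psi_norm \<psi>) \<longrightarrow> fpp_ani TYPE('y)"
proof
  assume fr: "fin_rep TYPE('y) (psi_sum S) (psi_norm \<psi>)"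
  interpret unc_sum \<psi> S using assms by unfold_locales simp_all
  show "fpp_ani TYPE('y)"
    unfolding fpp_ani_def
  proof (intro allI impI)
    fix C :: "'y set" and T
    assume H: "C \<noteq> {} \<and> bounded C \<and> closed C \<and> convex C" and T: "T ` C \<subseteq> C \<and> asympt_nonexp_intermediate C T"
    interpret ani_map C T using H T by unfold_locales simp_all
    show "\<exists>x\<in>C. T x = x"
    proof (rule fixed_point_from_ultrapower)
      show "C \<noteq> {}" using H by simp
      fix x r assume "x \<in> C" "\<And>\<epsilon>. \<epsilon> > 0 \<Longrightarrow> orbit_dist_le T x x (r + \<epsilon>)"
      \<comment> \<open>The common fixed point theorem is applied in the ultrapower of
        \<open>'y\<close>; that it is available there is the purpose of
        \<open>fin_rep_ultra\<close>.\<close>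
      from orbit_ball_invariant[OF this]
      show "\<exists>v\<in>orbit_ball x r. \<forall>\<sigma>\<in>pows. \<sigma> v = v"
        by (rule commuting_nonexpansive_common_fixed_point[OF fin_rep_ultra[OF fr] _ pows_nonexpansive pows_commute])
    qed
  qed
qed

end
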